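(* Let $p$ be a prime, let $K$ be a finite field extension of $\mathbb{Q}_p$ of degree $d$, ramification index $e$ and inertia degree $f$, let $R$ be the ring of integers of $K$, let $\pi\in R$ be a uniformizing parameter, and let $q=p^f$ be the cardinality of the residue field of $R$. Let $n\geq 2$, $k\geq 1$ and $m\geq e$ be integers. Then the following holds. (1) If $(n^2-1)d\leq p$, then the uniform pro-$p$ group $\mathrm{SL}_n^m(R)$ is self-similar of index $q^{(n-1)k}$. (2) If $n$ is even and $(n^2+n)d\leq 2p$, then the uniform pro-$p$ group $\mathrm{Sp}_n^m(R)$ is self-similar of index $q^{nk}$. (3) If $n\geq 3$ and $(n^2-n)d\leq 2p$, then the uniform pro-$p$ group $\mathrm{SO}_n^m(R)$ is self-similar of index $q^{(n-2)k}$.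
   Context: Self-similarity of groups: for an integer $\delta\geq 1$, a group $G$ is self-similar of index $\delta$ if it admits a faithful self-similar action on a regular rooted $\delta$-ary tree that is transitive on the first level. Equivalently (known fact), $G$ admits a simple virtual endomorphism of index $\delta$: a group homomorphism $\varphi:D\to G$, where $D\leq G$ is a subgroup of index $\delta$, such that there is no nontrivial normal subgroup $N$ of $G$ with $N\subseteq D$ and $\varphi(N)\subseteq N$. Classical groups: $\mathrm{SL}_n(R)=\{x\in \mathrm{M}_n(R): \det x=1\}$. For $n=2l$, $\mathrm{Sp}_{n}(R)=\{x\in \mathrm{M}_{n}(R): x^{\mathrm t}sx=s\}$ with $s=\begin{bmatrix}0&\mathrm{Id}_l\\-\mathrm{Id}_l&0\end{bmatrix}$. $\mathrm{SO}_n(R)=\{x\in \mathrm{SL}_n(R): x^{\mathrm t}sx=s\}$ with $s=\begin{bmatrix}0&\mathrm{Id}_l\\ \mathrm{Id}_l&0\end{bmatrix}$ if $n=2l$, and $s=\begin{bmatrix}1&0&0\\0&0&\mathrm{Id}_l\\0&\mathrm{Id}_l&0\end{bmatrix}$ if $n=2l+1$. For $\Sigma\in\{\mathrm{SL},\mathrm{Sp},\mathrm{SO}\}$ and $m\geq 1$, the $m$-th principal congruence subgroup $\Sigma_n^m(R)$ is the kernel of the map $\Sigma_n(R)\to\Sigma_n(R/\pi^mR)$ of reduction modulo $\pi^m$, i.e. the set of $x\in\Sigma_n(R)$ with $x\equiv \mathrm{Id}_n$ modulo $\pi^m$. *)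

theory Defs
  imports
    "Jordan_Normal_Form.Determinant"
    "HOL-Algebra.Embedded_Algebras"
    "HOL-Algebra.QuotRing"
    "HOL-Algebra.Group_Action"
    "HOL-Analysis.Abstract_Metric_Spaces"
    "HOL-Analysis.Product_Topology"
    "HOL-Computational_Algebra.Polynomial"
begin

definition padic_abs :: "nat \<Rightarrow> rat \<Rightarrow> real" where
  "padic_abs p r = (if r = 0 then 0 else
     real p powi (int (multiplicity (int p) (snd (quotient_of r)))
                  - int (multiplicity (int p) (fst (quotient_of r)))))"

text \<open>
  The type \<open>'q\<close>, equipped with the absolute value \<open>av\<close>, is the completion of the rationals
  with respect to the \<open>p\<close>-adic absolute value. This determines the pair up to unique
  isometric isomorphism.
\<close>

definition is_padic_field :: "nat \<Rightarrow> ('q::field_char_0 \<Rightarrow> real) \<Rightarrow> bool" where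
  "is_padic_field p av \<longleftrightarrow>
     (\<forall>x. 0 \<le> av x \<and> (av x = 0 \<longleftrightarrow> x = 0)) \<and>
     (\<forall>x y. av (x * y) = av x * av y) \<and>
     (\<forall>x y. av (x + y) \<le> av x + av y) \<and>
     (\<forall>r. av (of_rat r) = padic_abs p r) \<and>
     Metric_space.mcomplete UNIV (\<lambda>x y. av (x - y)) \<and>
     Metric_space.mtopology UNIV (\<lambda>x y. av (x - y)) closure_of (range of_rat) = UNIV"

definition padic_integers :: "('q::field_char_0 \<Rightarrow> real) \<Rightarrow> 'q set" where
  "padic_integers av = {a. av a \<le> 1}"

definition sub_ring :: "'k::field set \<Rightarrow> 'k ring" where
  "sub_ring S = \<lparr>carrier = S, mult = (*), one = 1, zero = 0, add = (+)\<rparr>"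

text \<open>
  A field extension is given by a field homomorphism \<open>\<iota>\<close> from \<open>'q\<close> to \<open>'k\<close>.
\<close>

definition finite_extension_of_degree :: "('q::field \<Rightarrow> 'k::field) \<Rightarrow> nat \<Rightarrow> bool" where
  "finite_extension_of_degree \<iota> d \<longleftrightarrow>
     field_hom \<iota> \<and> ring.dimension (sub_ring UNIV) d (range \<iota>) UNIV"

definition ring_of_integers ::
    "('q::field_char_0 \<Rightarrow> real) \<Rightarrow> ('q \<Rightarrow> 'k::field) \<Rightarrow> 'k set" where
  "ring_of_integers av \<iota> =
     {x. \<exists>P :: 'k poly. lead_coeff P = 1 \<and>
           (\<forall>i. Polynomial.coeff P i \<in> \<iota> ` padic_integers av) \<and> poly P x = 0}"

text \<open>A uniformizing parameter generates the unique maximal ideal.\<close>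

definition uniformizer :: "'k::field set \<Rightarrow> 'k \<Rightarrow> bool" where
  "uniformizer R \<pi> \<longleftrightarrow>
     \<pi> \<in> R \<and> {I. maximalideal I (sub_ring R)} = {PIdl\<^bsub>sub_ring R\<^esub> \<pi>}"

definition ramification_index :: "nat \<Rightarrow> 'k::field set \<Rightarrow> 'k \<Rightarrow> nat \<Rightarrow> bool" where
  "ramification_index p R \<pi> e \<longleftrightarrow>
     PIdl\<^bsub>sub_ring R\<^esub> (of_nat p) = PIdl\<^bsub>sub_ring R\<^esub> (\<pi> ^ e)"

definition residue_field :: "'k::field set \<Rightarrow> 'k \<Rightarrow> 'k set ring" where
  "residue_field R \<pi> = sub_ring R Quot (PIdl\<^bsub>sub_ring R\<^esub> \<pi>)"

text \<open>
  The subfield below is the image in the residue field of the \<open>p\<close>-adic integers \<open>Zp\<close>,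
  embedded in \<open>R\<close>; it is a copy of the residue field of the base field.
\<close>

definition inertia_degree :: "'k::field set \<Rightarrow> 'k set \<Rightarrow> 'k \<Rightarrow> nat \<Rightarrow> bool" where
  "inertia_degree Zp R \<pi> f \<longleftrightarrow>
     ring.dimension (residue_field R \<pi>) f
       ((\<lambda>a. PIdl\<^bsub>sub_ring R\<^esub> \<pi> +>\<^bsub>sub_ring R\<^esub> a) ` Zp) (carrier (residue_field R \<pi>))"

definition SL :: "nat \<Rightarrow> 'k::field set \<Rightarrow> 'k mat set" where
  "SL n R = {x \<in> carrier_mat n n. elements_mat x \<subseteq> R \<and> det x = 1}"

text \<open>The forms below have size \<open>n\<close> only if \<open>n\<close> is even.\<close>

definition symplectic_form :: "nat \<Rightarrow> 'k::field mat" where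
  "symplectic_form n = (let l = n div 2 in
     four_block_mat (0\<^sub>m l l) (1\<^sub>m l) (- 1\<^sub>m l) (0\<^sub>m l l))"

definition hyperbolic_form :: "nat \<Rightarrow> 'k::field mat" where
  "hyperbolic_form n = (let l = n div 2 in
     four_block_mat (0\<^sub>m l l) (1\<^sub>m l) (1\<^sub>m l) (0\<^sub>m l l))"

definition orthogonal_form :: "nat \<Rightarrow> 'k::field mat" where
  "orthogonal_form n = (if even n then hyperbolic_form n
     else four_block_mat (1\<^sub>m 1) (0\<^sub>m 1 (n - 1)) (0\<^sub>m (n - 1) 1) (hyperbolic_form (n - 1)))"

definition Sp :: "nat \<Rightarrow> 'k::field set \<Rightarrow> 'k mat set" where
  "Sp n R = {x \<in> carrier_mat n n. elements_mat x \<subseteq> R \<and>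
     transpose_mat x * symplectic_form n * x = symplectic_form n}"

definition SO :: "nat \<Rightarrow> 'k::field set \<Rightarrow> 'k mat set" where
  "SO n R = {x \<in> SL n R. transpose_mat x * orthogonal_form n * x = orthogonal_form n}"

definition mat_cong :: "'k::field set \<Rightarrow> 'k \<Rightarrow> nat \<Rightarrow> 'k mat \<Rightarrow> 'k mat \<Rightarrow> bool" where
  "mat_cong R \<pi> j x y \<longleftrightarrow> elements_mat (x - y) \<subseteq> PIdl\<^bsub>sub_ring R\<^esub> (\<pi> ^ j)"

definition matrix_group :: "nat \<Rightarrow> 'k::field mat set \<Rightarrow> 'k mat monoid" where
  "matrix_group n S = \<lparr>carrier = S, mult = (*), one = 1\<^sub>m n\<rparr>"

definition congruence_subgroup ::
    "nat \<Rightarrow> 'k::field set \<Rightarrow> 'k \<Rightarrow> nat \<Rightarrow> 'k mat set \<Rightarrow> 'k mat monoid" where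
  "congruence_subgroup n R \<pi> m S = matrix_group n {x \<in> S. mat_cong R \<pi> m x (1\<^sub>m n)}"

text \<open>
  The topology induced by that of the local field, which on matrices over \<open>R\<close> is the
  \<open>\<pi>\<close>-adic topology: the congruence classes modulo powers of \<open>\<pi>\<close> form a base.
\<close>

definition adic_topology :: "'k::field set \<Rightarrow> 'k \<Rightarrow> 'k mat monoid \<Rightarrow> 'k mat topology" where
  "adic_topology R \<pi> G =
     topology_generated_by {{y \<in> carrier G. mat_cong R \<pi> j y x} | x j. x \<in> carrier G}"

definition topological_group :: "('a, 'b) monoid_scheme \<Rightarrow> 'a topology \<Rightarrow> bool" where
  "topological_group G T \<longleftrightarrow>
     group G \<and> topspace T = carrier G \<and>
     continuous_map (prod_topology T T) T (\<lambda>(x, y). x \<otimes>\<^bsub>G\<^esub> y) \<and>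
     continuous_map T T (\<lambda>x. inv\<^bsub>G\<^esub> x)"

definition profinite_group :: "('a, 'b) monoid_scheme \<Rightarrow> 'a topology \<Rightarrow> bool" where
  "profinite_group G T \<longleftrightarrow>
     topological_group G T \<and> compact_space T \<and> Hausdorff_space T \<and>
     (\<forall>U. openin T U \<and> \<one>\<^bsub>G\<^esub> \<in> U \<longrightarrow> (\<exists>H. subgroup H G \<and> openin T H \<and> H \<subseteq> U))"

definition pro_p_group :: "nat \<Rightarrow> ('a, 'b) monoid_scheme \<Rightarrow> 'a topology \<Rightarrow> bool" where
  "pro_p_group p G T \<longleftrightarrow>
     profinite_group G T \<and>
     (\<forall>N. N \<lhd> G \<and> openin T N \<longrightarrow> (\<exists>i. card (rcosets\<^bsub>G\<^esub> N) = p ^ i))"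

definition topologically_fg :: "('a, 'b) monoid_scheme \<Rightarrow> 'a topology \<Rightarrow> bool" where
  "topologically_fg G T \<longleftrightarrow>
     (\<exists>X. finite X \<and> X \<subseteq> carrier G \<and> T closure_of (generate G X) = carrier G)"

text \<open>
  Powerful: the quotient by the closed subgroup generated by the \<open>p\<close>-th powers
  (the fourth powers if \<open>p = 2\<close>) is abelian.
\<close>

definition powerful :: "nat \<Rightarrow> ('a, 'b) monoid_scheme \<Rightarrow> 'a topology \<Rightarrow> bool" where
  "powerful p G T \<longleftrightarrow>
     derived G (carrier G) \<subseteq>
       T closure_of (generate G {x [^]\<^bsub>G\<^esub> (if p = 2 then 4 else p) | x. x \<in> carrier G})"

definition torsion_free :: "('a, 'b) monoid_scheme \<Rightarrow> bool" where
  "torsion_free G \<longleftrightarrow>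
     (\<forall>x \<in> carrier G. \<forall>i::nat. 0 < i \<and> x [^]\<^bsub>G\<^esub> i = \<one>\<^bsub>G\<^esub> \<longrightarrow> x = \<one>\<^bsub>G\<^esub>)"

definition uniform_pro_p_group :: "nat \<Rightarrow> ('a, 'b) monoid_scheme \<Rightarrow> 'a topology \<Rightarrow> bool" where
  "uniform_pro_p_group p G T \<longleftrightarrow>
     pro_p_group p G T \<and> topologically_fg G T \<and> powerful p G T \<and> torsion_free G"

text \<open>
  The vertices of the regular rooted \<open>\<delta>\<close>-ary tree are the finite words over
  \<open>{0, \<dots>, \<delta> - 1}\<close>; the root is the empty word, and the children of \<open>w\<close> are the
  words \<open>w @ [x]\<close>.
\<close>

definition tree_words :: "nat \<Rightarrow> nat list set" where
  "tree_words \<delta> = lists {..<\<delta>}"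

definition tree_action ::
    "('a, 'b) monoid_scheme \<Rightarrow> nat \<Rightarrow> ('a \<Rightarrow> nat list \<Rightarrow> nat list) \<Rightarrow> bool" where
  "tree_action G \<delta> \<phi> \<longleftrightarrow>
     group_action G (tree_words \<delta>) \<phi> \<and>
     (\<forall>g \<in> carrier G. \<phi> g [] = [] \<and>
        (\<forall>w \<in> tree_words \<delta>. \<forall>x < \<delta>. \<exists>y < \<delta>. \<phi> g (w @ [x]) = \<phi> g w @ [y]))"

definition self_similar_action ::
    "('a, 'b) monoid_scheme \<Rightarrow> nat \<Rightarrow> ('a \<Rightarrow> nat list \<Rightarrow> nat list) \<Rightarrow> bool" where
  "self_similar_action G \<delta> \<phi> \<longleftrightarrow>
     tree_action G \<delta> \<phi> \<and>
     (\<forall>g \<in> carrier G. \<forall>x < \<delta>. \<exists>h \<in> carrier G. \<exists>y < \<delta>.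
        \<forall>w \<in> tree_words \<delta>. \<phi> g (x # w) = y # \<phi> h w)"

definition self_similar :: "('a, 'b) monoid_scheme \<Rightarrow> nat \<Rightarrow> bool" where
  "self_similar G \<delta> \<longleftrightarrow>
     1 \<le> \<delta> \<and>
     (\<exists>\<phi>. self_similar_action G \<delta> \<phi> \<and> faithful_action G (tree_words \<delta>) \<phi> \<and>
        (\<forall>x < \<delta>. \<forall>y < \<delta>. \<exists>g \<in> carrier G. \<phi> g [x] = [y]))"

end

theory Submission
  imports Defs "HOL-Algebra.Finite_Extensions" "HOL-Algebra.Sylow" "HOL-Number_Theory.Cong"
begin

text \<open>
  The virtual endomorphism is conjugation by a diagonal matrix \<open>diag(\<pi>\<^sup>-\<^sup>k\<^sup>c\<^sup>i)\<close>, where the weights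
  \<open>c\<close> are \<open>0\<close> on one basis vector \<open>e\<close>, \<open>2\<close> on the basis vector dual to \<open>e\<close> (if there is a form) and
  \<open>1\<close> on the others. Its domain consists of the matrices whose column at \<open>e\<close> is sufficiently divisible
  off the diagonal, and a unipotent transversal shows that the index is the asserted power of \<open>q\<close>.
  An invariant normal subgroup stabilises the line of \<open>e\<close> and all its translates, so it consists of
  scalars, which are trivial because the group is torsion-free. No Lie theory is needed for this.

  The groups are uniform because, with \<open>p = \<pi>\<^sup>e u\<close>, \<open>p > 2\<close> and \<open>m \<ge> e\<close>, every matrix congruent to
  the identity modulo \<open>\<pi>\<^sup>m\<^sup>+\<^sup>s\<^sup>e\<close> has exactly one \<open>p\<^sup>s\<close>-th root congruent to the identity modulo
  \<open>\<pi>\<^sup>m\<close>; by uniqueness this root satisfies the equations that define the group.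
\<close>

section \<open>Self-similar actions from simple virtual endomorphisms\<close>

text \<open>The exponents of \<open>q\<close> count coordinates: modulo the domain, an element is
  known by its column at \<open>e\<close> up to a unit factor. Without a form the
  \<open>n - 1\<close> other coordinates are free, each contributing \<open>k\<close>. With a form,
  the diagonal matrix must be a similitude, so the weights of two dual basis vectors must have a
  constant sum; this is where 0, 1, 2 come from. For an alternating form every vector is isotropic,
  so the dual coordinate is free as well and contributes \<open>2 k\<close>, in total
  \<open>n k\<close>. For a symmetric form isotropy of the column determines the dual coordinate
  from the others, which leaves \<open>(n - 2) k\<close>.

  The inequalities between \<open>n\<close>, \<open>d\<close> and \<open>p\<close> enter through
  \<open>p \<noteq> 2\<close>. Since the field is given abstractly and \<open>R\<close> is its
  integral closure, completeness, locality and the finite residue field have to be derived first;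
  afterwards all estimates are memberships in the powers of the maximal ideal. The isometry groups
  inherit their structure from the special linear group as fixed points of an automorphism.\<close>

locale virtual_endo = group G for G (structure) +
  fixes D and \<phi> :: "'a \<Rightarrow> 'a" and \<delta> :: nat and t :: "nat \<Rightarrow> 'a"
  assumes D: "subgroup D G"
    and phi_closed: "x \<in> D \<Longrightarrow> \<phi> x \<in> carrier G"
    and phi_mult: "x \<in> D \<Longrightarrow> y \<in> D \<Longrightarrow> \<phi> (x \<otimes> y) = \<phi> x \<otimes> \<phi> y"
    and t_closed: "i < \<delta> \<Longrightarrow> t i \<in> carrier G"
    and t_trans: "g \<in> carrier G \<Longrightarrow> \<exists>!i. i < \<delta> \<and> inv (t i) \<otimes> g \<in> D"
    and simple: "N \<lhd> G \<Longrightarrow> N \<subseteq> D \<Longrightarrow> \<phi> ` N \<subseteq> N \<Longrightarrow> N = {\<one>}"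
begin

definition coset_index :: "'a \<Rightarrow> nat" where
  "coset_index g = (THE x. x < \<delta> \<and> inv (t x) \<otimes> g \<in> D)"

definition section_elt :: "'a \<Rightarrow> 'a" where
  "section_elt g = \<phi> (inv (t (coset_index g)) \<otimes> g)"

text \<open>Letters stand for the left cosets of \<open>D\<close>. The coset of
  \<open>g \<otimes> t x\<close> gives the new letter, and the element of \<open>D\<close> left over
  is carried by \<open>\<phi>\<close> to the section that acts on the rest of the word. The group
  element is a varying argument because it changes at every letter.\<close>

primrec act :: "nat list \<Rightarrow> 'a \<Rightarrow> nat list" where
  "act [] g = []"
| "act (x # w) g = coset_index (g \<otimes> t x) # act w (section_elt (g \<otimes> t x))"

lemma coset_index:
  assumes "g \<in> carrier G"
  shows "coset_index g < \<delta>" "inv (t (coset_index g)) \<otimes> g \<in> D"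
  using theI'[OF t_trans[OF assms]] unfolding coset_index_def by auto

lemma coset_index_eqI:
  assumes "g \<in> carrier G" "x < \<delta>" "inv (t x) \<otimes> g \<in> D"
  shows "coset_index g = x"
  using t_trans[OF assms(1)] coset_index[OF assms(1)] assms by blast

lemma section_elt_closed [simp]: "g \<in> carrier G \<Longrightarrow> section_elt g \<in> carrier G"
  unfolding section_elt_def by (intro phi_closed coset_index)

lemma phi_one: "\<phi> \<one> = \<one>"
proof -
  have "\<phi> \<one> \<otimes> \<phi> \<one> = \<phi> \<one>" "\<phi> \<one> \<in> carrier G"
    using phi_mult[of \<one> \<one>] phi_closed[of \<one>] subgroup.one_closed[OF D] by auto
  then show ?thesis by (metis l_cancel_one')
qed

text \<open>Inserting \<open>t y\<close> and its inverse splits the leftover element into two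
  factors in \<open>D\<close>, where \<open>\<phi>\<close> is multiplicative. This is the cocycle
  rule of sections, and it turns \<open>act_mult\<close> into an induction on words.\<close>

lemma coset_index_mult:
  assumes g: "g \<in> carrier G" and h: "h \<in> carrier G" and x: "x < \<delta>"
  defines "y \<equiv> coset_index (h \<otimes> t x)"
  shows "coset_index (g \<otimes> h \<otimes> t x) = coset_index (g \<otimes> t y)"
    and "section_elt (g \<otimes> h \<otimes> t x) = section_elt (g \<otimes> t y) \<otimes> section_elt (h \<otimes> t x)"
proof -
  have hx: "h \<otimes> t x \<in> carrier G" using h x t_closed by auto
  note Y = coset_index[OF hx, folded y_def]
  have ty: "t y \<in> carrier G" and tx: "t x \<in> carrier G" using Y t_closed x by auto
  have gy: "g \<otimes> t y \<in> carrier G" using g ty by auto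
  define z where "z = coset_index (g \<otimes> t y)"
  note Z = coset_index[OF gy, folded z_def]
  have tz: "t z \<in> carrier G" using Z t_closed by auto
  have split: "inv (t z) \<otimes> (g \<otimes> h \<otimes> t x) = (inv (t z) \<otimes> (g \<otimes> t y)) \<otimes> (inv (t y) \<otimes> (h \<otimes> t x))"
  proof -
    have "t y \<otimes> (inv (t y) \<otimes> (h \<otimes> t x)) = h \<otimes> t x"
      using hx ty by (simp flip: m_assoc)
    then show ?thesis using g h tx ty tz by (simp add: m_assoc)
  qed
  have "inv (t z) \<otimes> (g \<otimes> h \<otimes> t x) \<in> D"
    unfolding split using Z Y subgroup.m_closed[OF D] by blast
  then have e: "coset_index (g \<otimes> h \<otimes> t x) = z"
    using coset_index_eqI Z g h tx by auto
  then show "coset_index (g \<otimes> h \<otimes> t x) = coset_index (g \<otimes> t y)" by (simp add: z_def)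
  show "section_elt (g \<otimes> h \<otimes> t x) = section_elt (g \<otimes> t y) \<otimes> section_elt (h \<otimes> t x)"
    unfolding section_elt_def e split using phi_mult[OF Z(2) Y(2)]
    by (simp add: z_def y_def)
qed

lemma words_Cons [simp]: "x # w \<in> tree_words \<delta> \<longleftrightarrow> x < \<delta> \<and> w \<in> tree_words \<delta>"
  and words_Nil [simp]: "[] \<in> tree_words \<delta>"
  by (auto simp: tree_words_def)

lemma act_closed: "w \<in> tree_words \<delta> \<Longrightarrow> g \<in> carrier G \<Longrightarrow> act w g \<in> tree_words \<delta>"
  by (induction w arbitrary: g) (auto simp: coset_index t_closed)

lemma act_mult:
  "w \<in> tree_words \<delta> \<Longrightarrow> g \<in> carrier G \<Longrightarrow> h \<in> carrier G \<Longrightarrow> act w (g \<otimes> h) = act (act w h) g"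
  by (induction w arbitrary: g h) (auto simp: coset_index t_closed coset_index_mult)

lemma act_one: "w \<in> tree_words \<delta> \<Longrightarrow> act w \<one> = w"
proof (induction w)
  case (Cons x w)
  then have x: "x < \<delta>" "t x \<in> carrier G" by (auto simp: t_closed)
  have "coset_index (\<one> \<otimes> t x) = x"
    using x subgroup.one_closed[OF D] by (intro coset_index_eqI) auto
  with x Cons show ?case by (auto simp: section_elt_def phi_one)
qed simp

lemma act_snoc:
  "w \<in> tree_words \<delta> \<Longrightarrow> x < \<delta> \<Longrightarrow> g \<in> carrier G \<Longrightarrow> \<exists>y<\<delta>. act (w @ [x]) g = act w g @ [y]"
  by (induction w arbitrary: g) (auto simp: coset_index t_closed)

definition tree_act :: "'a \<Rightarrow> nat list \<Rightarrow> nat list" where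
  "tree_act g = restrict (\<lambda>w. act w g) (tree_words \<delta>)"

lemma tree_act_Bij: "g \<in> carrier G \<Longrightarrow> tree_act g \<in> Bij (tree_words \<delta>)"
  unfolding Bij_def tree_act_def
  by (auto intro!: bij_betw_byWitness[where f' = "\<lambda>w. act w (inv g)"]
      simp: act_closed act_mult[symmetric] act_one)

lemma tree_act_group_action: "group_action G (tree_words \<delta>) tree_act"
proof -
  have "tree_act \<in> hom G (BijGroup (tree_words \<delta>))"
  proof (rule homI)
    fix g assume "g \<in> carrier G"
    then show "tree_act g \<in> carrier (BijGroup (tree_words \<delta>))"
      by (simp add: BijGroup_def tree_act_Bij)
  next
    fix g h assume "g \<in> carrier G" "h \<in> carrier G"
    then show "tree_act (g \<otimes> h) = tree_act g \<otimes>\<^bsub>BijGroup (tree_words \<delta>)\<^esub> tree_act h"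
      by (simp add: BijGroup_def tree_act_Bij)
        (auto simp: compose_def tree_act_def act_mult act_closed)
  qed
  then show ?thesis
    unfolding group_action_def group_hom_def group_hom_axioms_def
    by (simp add: group_BijGroup is_group)
qed

lemma tree_act_tree_action: "tree_action G \<delta> tree_act"
  unfolding tree_action_def
proof (intro conjI ballI tree_act_group_action allI impI)
  fix g w x assume *: "g \<in> carrier G" "w \<in> tree_words \<delta>" "x < \<delta>"
  then have "w @ [x] \<in> tree_words \<delta>" by (auto simp: tree_words_def)
  with act_snoc[of w x g] * show "\<exists>y<\<delta>. tree_act g (w @ [x]) = tree_act g w @ [y]"
    by (auto simp: tree_act_def)
qed (auto simp: tree_act_def)

lemma tree_act_self_similar: "self_similar_action G \<delta> tree_act"
  unfolding self_similar_action_def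
proof (intro conjI ballI tree_act_tree_action allI impI)
  fix g x assume *: "g \<in> carrier G" "x < \<delta>"
  show "\<exists>h\<in>carrier G. \<exists>y<\<delta>. \<forall>w\<in>tree_words \<delta>. tree_act g (x # w) = y # tree_act h w"
    using * by (intro bexI[of _ "section_elt (g \<otimes> t x)"] exI[of _ "coset_index (g \<otimes> t x)"])
      (auto simp: tree_act_def coset_index t_closed)
qed

text \<open>The hypothesis \<open>simple\<close> is applied to the kernel of the action. Its
  normality is formal; the point is that it lies in \<open>D\<close> and that \<open>\<phi>\<close>
  maps it into itself.\<close>

lemma kernel_trivial:
  assumes "g \<in> carrier G" "\<And>w. w \<in> tree_words \<delta> \<Longrightarrow> act w g = w"
  shows "g = \<one>"
proof -
  define N where "N = {g \<in> carrier G. \<forall>w \<in> tree_words \<delta>. act w g = w}"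
  have inv: "inv h \<in> N" if "h \<in> N" for h
  proof -
    have "act w (inv h) = w" if w: "w \<in> tree_words \<delta>" for w
    proof -
      have "act w (inv h) = act (act w h) (inv h)" using w \<open>h \<in> N\<close> by (simp add: N_def)
      also have "\<dots> = w" using w \<open>h \<in> N\<close> by (subst act_mult[symmetric]) (auto simp: N_def act_one)
      finally show ?thesis .
    qed
    then show ?thesis using that by (auto simp: N_def)
  qed
  have "subgroup N G"
  proof (rule subgroupI)
    show "N \<noteq> {}" using act_one by (auto simp: N_def)
  qed (use inv in \<open>auto simp: N_def act_mult\<close>)
  moreover have "h \<otimes> n \<otimes> inv h \<in> N" if h: "h \<in> carrier G" and n: "n \<in> N" for h n
  proof -
    have "act w (h \<otimes> n \<otimes> inv h) = w" if w: "w \<in> tree_words \<delta>" for w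
    proof -
      have "act w (h \<otimes> n \<otimes> inv h) = act (act (act w (inv h)) n) h"
        using h n w by (simp add: act_mult act_closed N_def)
      also have "act (act w (inv h)) n = act w (inv h)"
        using n w h by (simp add: N_def act_closed)
      also have "act (act w (inv h)) h = w"
        using w h by (subst act_mult[symmetric]) (auto simp: act_one)
      finally show ?thesis .
    qed
    then show ?thesis using h n by (simp add: N_def)
  qed
  ultimately have N: "N \<lhd> G" by (simp add: normal_inv_iff)
  obtain x where x: "x < \<delta>" "inv (t x) \<otimes> \<one> \<in> D" using t_trans[of \<one>] by auto
  have tx: "t x \<in> carrier G" using x t_closed by auto
  have sub: "n \<in> D \<and> \<phi> n \<in> N" if n: "n \<in> N" for n
  proof -
    have nc: "n \<in> carrier G" using n by (auto simp: N_def)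
    \<comment> \<open>Conjugation by \<open>t x\<close> makes the section of \<open>n'\<close> at
      the letter \<open>x\<close> equal to \<open>\<phi> n\<close>. Hence fixing \<open>[x]\<close>
      puts \<open>n\<close> into \<open>D\<close>, and fixing all words \<open>x # w\<close> puts
      \<open>\<phi> n\<close> into the kernel.\<close>
    define n' where "n' = t x \<otimes> n \<otimes> inv (t x)"
    have n': "n' \<in> N" unfolding n'_def using normal.inv_op_closed2[OF N tx n] .
    have eq: "n' \<otimes> t x = t x \<otimes> n" using nc tx by (simp add: n'_def m_assoc)
    have "coset_index (n' \<otimes> t x) = x" using n' x(1) by (auto simp: N_def dest!: bspec[of _ _ "[x]"])
    then have s: "section_elt (n' \<otimes> t x) = \<phi> n" and "n \<in> D"
      using coset_index(2)[of "n' \<otimes> t x"] nc tx unfolding section_elt_def eq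
      by (auto simp flip: m_assoc)
    have "act w (\<phi> n) = w" if "w \<in> tree_words \<delta>" for w
    proof -
      have "\<forall>w \<in> tree_words \<delta>. act w n' = w" using n' by (simp add: N_def)
      then have "act (x # w) n' = x # w" by (rule bspec) (use x that in simp)
      then show ?thesis by (simp add: s)
    qed
    with \<open>n \<in> D\<close> show ?thesis by (auto simp: N_def phi_closed)
  qed
  have "N = {\<one>}" using sub by (intro simple N) auto
  then show ?thesis using assms by (auto simp: N_def)
qed

lemma tree_act_faithful: "faithful_action G (tree_words \<delta>) tree_act"
  unfolding faithful_action_def faithful_action_axioms_def
proof (intro conjI tree_act_group_action inj_onI)
  fix g h assume g: "g \<in> carrier G" and h: "h \<in> carrier G" and eq: "tree_act g = tree_act h"
  have "act w (inv h \<otimes> g) = w" if "w \<in> tree_words \<delta>" for w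
  proof -
    have "act w g = act w h" using fun_cong[OF eq, of w] that by (simp add: tree_act_def)
    then have "act w (inv h \<otimes> g) = act (act w h) (inv h)" using that g h by (simp add: act_mult)
    also have "\<dots> = w" using that h by (subst act_mult[symmetric]) (auto simp: act_one)
    finally show ?thesis .
  qed
  then have "inv h \<otimes> g = \<one>" using g h by (intro kernel_trivial) auto
  then show "g = h" using g h by (metis inv_closed inv_equality inv_inv)
qed

lemma index_pos: "1 \<le> \<delta>"
  using t_trans[of \<one>] by auto

theorem self_similar: "self_similar G \<delta>"
proof -
  have "\<exists>g\<in>carrier G. tree_act g [x] = [y]" if "x < \<delta>" "y < \<delta>" for x y
  proof (intro bexI[of _ "t y \<otimes> inv (t x)"])
    have tx: "t x \<in> carrier G" "t y \<in> carrier G" using that t_closed by auto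
    then have "coset_index (t y \<otimes> inv (t x) \<otimes> t x) = y"
      using that subgroup.one_closed[OF D] by (intro coset_index_eqI) (auto simp: m_assoc)
    then show "tree_act (t y \<otimes> inv (t x)) [x] = [y]" using that by (simp add: tree_act_def)
  qed (use that t_closed in auto)
  then show ?thesis
    unfolding self_similar_def
    using index_pos tree_act_self_similar tree_act_faithful by blast
qed

end

section \<open>The field of p-adic numbers\<close>

locale padic_field =
  fixes p :: nat and av :: "'q::field_char_0 \<Rightarrow> real"
  assumes prime: "Factorial_Ring.prime p" and padic: "is_padic_field p av"
begin

lemma av_nonneg [simp]: "0 \<le> av x"
  and av_eq_0 [simp]: "av x = 0 \<longleftrightarrow> x = 0"
  and av_mult: "av (x * y) = av x * av y"
  and av_triangle: "av (x + y) \<le> av x + av y"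
  and av_of_rat: "av (of_rat r) = padic_abs p r"
  using padic unfolding is_padic_field_def by auto

lemma av_0 [simp]: "av 0 = 0"
  by simp

lemma av_pos [simp]: "0 < av x \<longleftrightarrow> x \<noteq> 0"
  using av_nonneg[of x] av_eq_0[of x] by linarith

lemma av_1 [simp]: "av 1 = 1"
  using av_mult[of 1 1] av_eq_0[of 1] by (simp del: av_eq_0)

lemma av_power: "av (x ^ n) = av x ^ n"
  by (induction n) (auto simp: av_mult)

lemma av_minus [simp]: "av (- x) = av x"
proof -
  have "av (- 1) ^ 2 = 1" using av_power[of "- 1" 2] by simp
  then have "av (- 1) = 1" using av_nonneg[of "- 1"] by (simp add: power2_eq_1_iff del: av_nonneg)
  then show ?thesis using av_mult[of "- 1" x] by simp
qed

lemma av_diff_commute: "av (x - y) = av (y - x)"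
  using av_minus[of "x - y"] by simp

lemma av_inverse: "av (inverse x) = inverse (av x)"
proof (cases "x = 0")
  case False
  then have "av x * av (inverse x) = 1" by (simp flip: av_mult)
  then show ?thesis by (metis inverse_unique)
qed simp

lemma av_divide: "av (x / y) = av x / av y"
  by (simp add: divide_inverse av_mult av_inverse)

lemma av_of_int:
  "k \<noteq> 0 \<Longrightarrow> av (of_int k) = inverse (real p ^ multiplicity (int p) k)"
proof -
  assume "k \<noteq> 0"
  moreover have "av (of_int k) = padic_abs p (of_int k)"
    using av_of_rat[of "of_int k"] by simp
  ultimately show ?thesis
    by (simp add: padic_abs_def power_int_minus)
qed

lemma p_gt_1: "p > 1" using prime prime_gt_1_nat by blast

lemma av_of_int_le: "av (of_int k) \<le> 1"
  using p_gt_1 by (cases "k = 0") (auto simp: av_of_int inverse_le_1_iff)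

lemma av_of_nat_le: "av (of_nat k) \<le> 1"
  using av_of_int_le[of "int k"] by simp

lemma av_p: "av (of_nat p) = 1 / p"
proof -
  have "multiplicity (int p) (int p) = 1"
    using p_gt_1 by (intro multiplicity_self) auto
  moreover have "av (of_int (int p)) = inverse (real p ^ multiplicity (int p) (int p))"
    using p_gt_1 by (intro av_of_int) auto
  ultimately show ?thesis by (simp only: of_int_of_nat_eq power_one_right divide_inverse mult_1)
qed

lemma av_of_int_unit: "\<not> int p dvd k \<Longrightarrow> av (of_int k) = 1"
  by (subst av_of_int) (auto simp: not_dvd_imp_multiplicity_0)

text \<open>The archimedean inequality applied to \<open>(x + y)\<^sup>N\<close> bounds \<open>(av (x + y) / M)\<^sup>N\<close> by \<open>N + 1\<close>.\<close>

lemma ultrametric: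
  assumes "av x \<le> M" "av y \<le> M"
  shows "av (x + y) \<le> M"
proof (rule ccontr)
  assume *: "\<not> av (x + y) \<le> M"
  have M0: "0 \<le> M" using assms(1) av_nonneg[of x] by linarith
  have M: "0 < M"
  proof (rule ccontr)
    assume "\<not> 0 < M"
    then have "M = 0" using M0 by simp
    then have "av x = 0" "av y = 0" using assms av_nonneg[of x] av_nonneg[of y] by linarith+
    then show False using * M0 by simp
  qed
  define c where "c = av (x + y) / M"
  have c: "c > 1" using * M by (simp add: c_def)
  have sum_le: "av (sum f A) \<le> (\<Sum>i\<in>A. av (f i))" if "finite A" for f :: "nat \<Rightarrow> 'q" and A
    using that by (induction A) (auto intro: order_trans[OF av_triangle])
  have "c ^ N \<le> of_nat (Suc N)" for N
  proof -
    have "av ((x + y) ^ N) \<le> (\<Sum>k\<le>N. av (of_nat (N choose k) * x ^ k * y ^ (N - k)))"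
      by (subst binomial_ring) (rule sum_le, simp)
    also have "\<dots> \<le> (\<Sum>k\<le>N. M ^ N)"
    proof (rule sum_mono)
      fix k assume "k \<in> {..N}"
      have "av (of_nat (N choose k) * x ^ k * y ^ (N - k)) \<le> 1 * M ^ k * M ^ (N - k)"
        unfolding av_mult av_power using assms M
        by (intro mult_mono power_mono av_of_nat_le) auto
      also have "\<dots> = M ^ N" using \<open>k \<in> {..N}\<close> by (simp flip: power_add)
      finally show "av (of_nat (N choose k) * x ^ k * y ^ (N - k)) \<le> M ^ N" .
    qed
    finally show ?thesis
      using M by (simp add: c_def av_power power_divide divide_le_eq)
  qed
  then have bound: "1 \<le> of_nat (Suc N) / c ^ Suc N * c" for N
    using c by (simp add: pos_le_divide_eq del: of_nat_Suc)
  have "(\<lambda>n. of_nat n / c ^ n) \<longlonglongrightarrow> 0"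
    by (rule lim_n_over_pown) (use c in auto)
  then have "(\<lambda>n. of_nat (Suc n) / c ^ (Suc n) * c) \<longlonglongrightarrow> 0 * c"
    by (intro tendsto_mult_right) (rule LIMSEQ_Suc)
  then have "1 \<le> 0 * c" by (rule LIMSEQ_le_const) (use bound in auto)
  then show False by simp
qed

lemma ultrametric_diff: "av x \<le> M \<Longrightarrow> av y \<le> M \<Longrightarrow> av (x - y) \<le> M"
  using ultrametric[of x M "- y"] by simp

lemma ultrametric_sum: "0 \<le> M \<Longrightarrow> (\<And>i. i \<in> A \<Longrightarrow> av (f i) \<le> M) \<Longrightarrow> av (sum f A) \<le> M"
  by (induction A rule: infinite_finite_induct) (auto simp del: av_eq_0 intro: ultrametric)

sublocale metric: Metric_space UNIV "\<lambda>x y. av (x - y)"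
proof
  show "av (x - z) \<le> av (x - y) + av (y - z)" for x y z
    using av_triangle[of "x - y" "y - z"] by simp
qed (auto simp: av_diff_commute)

lemma dense: "0 < \<epsilon> \<Longrightarrow> \<exists>r. av (a - of_rat r) < \<epsilon>"
proof -
  assume "0 < \<epsilon>"
  have "a \<in> metric.mtopology closure_of (range of_rat)"
    using padic unfolding is_padic_field_def by simp
  with \<open>0 < \<epsilon>\<close> show ?thesis unfolding metric.metric_closure_of by (auto simp: metric.mball_def)
qed

text \<open>By the ultrametric inequality the consecutive differences control a whole tail. Radii
  are powers of \<open>1 / p\<close> because radius \<open>1 / p ^ t\<close> corresponds to level
  \<open>e * t\<close> of the filtration of \<open>R\<close>.\<close>

lemma tendsto_exists:
  assumes cauchy: "\<And>t. \<exists>N. \<forall>i\<ge>N. av (c (Suc i) - c i) \<le> 1 / real p ^ t"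
  shows "\<exists>x. \<forall>t. \<exists>N. \<forall>i\<ge>N. av (x - c i) \<le> 1 / real p ^ t"
proof -
  have tail: "av (c i - c N) \<le> 1 / real p ^ t"
    if "\<forall>i\<ge>N. av (c (Suc i) - c i) \<le> 1 / real p ^ t" "i \<ge> N" for N t i
    using that(2)
  proof (induction i rule: dec_induct)
    case (step i)
    then show ?case using ultrametric[of "c (Suc i) - c i" "1 / real p ^ t" "c i - c N"] that(1) by simp
  qed simp
  have small: "\<exists>t. 1 / real p ^ t < \<epsilon>" if eps: "\<epsilon> > 0" for \<epsilon>
  proof -
    obtain t where "(1 / real p) ^ t < \<epsilon>"
      using real_arch_pow_inv[of \<epsilon> "1 / real p"] eps p_gt_1 by auto
    then show ?thesis by (auto simp: power_divide)
  qed
  have "metric.MCauchy c"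
    unfolding metric.MCauchy_def
  proof (intro conjI allI impI)
    fix \<epsilon> :: real assume "\<epsilon> > 0"
    then obtain t where t: "1 / real p ^ t < \<epsilon>" using small by blast
    obtain N where N: "\<forall>i\<ge>N. av (c (Suc i) - c i) \<le> 1 / real p ^ t" using cauchy by blast
    have "av (c n - c n') < \<epsilon>" if "N \<le> n" "N \<le> n'" for n n'
      using ultrametric_diff[OF tail[OF N that(1)] tail[OF N that(2)]] t by simp
    then show "\<exists>N. \<forall>n n'. N \<le> n \<longrightarrow> N \<le> n' \<longrightarrow> av (c n - c n') < \<epsilon>" by blast
  qed auto
  then obtain x where x: "limitin metric.mtopology c x sequentially"
    using padic by (auto simp: is_padic_field_def metric.mcomplete_def)
  show ?thesis
  proof (intro exI[of _ x] allI)
    fix t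
    have "0 < 1 / real p ^ t" using p_gt_1 by simp
    then obtain N where "\<forall>i\<ge>N. av (c i - x) < 1 / real p ^ t"
      using x unfolding metric.limit_metric_sequentially by blast
    then show "\<exists>N. \<forall>i\<ge>N. av (x - c i) \<le> 1 / real p ^ t"
      by (intro exI[of _ N]) (auto simp: av_diff_commute[of x] intro: less_imp_le)
  qed
qed

lemma padic_integers_closed:
  "1 \<in> padic_integers av" "a \<in> padic_integers av \<Longrightarrow> b \<in> padic_integers av \<Longrightarrow> a + b \<in> padic_integers av"
  "a \<in> padic_integers av \<Longrightarrow> b \<in> padic_integers av \<Longrightarrow> a * b \<in> padic_integers av"
  "a \<in> padic_integers av \<Longrightarrow> - a \<in> padic_integers av"
  by (auto simp: padic_integers_def ultrametric av_mult mult_le_one)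

text \<open>Density replaces \<open>a\<close> by a fraction \<open>c / d\<close> of absolute value
  at most 1. In lowest terms \<open>p\<close> cannot divide \<open>d\<close>, so \<open>d\<close> is
  invertible modulo \<open>p\<close> and \<open>i\<close> is the residue of \<open>c / d\<close>.
  This bounds the residue field of the base field by \<open>p\<close> elements.\<close>

lemma residue_nat:
  assumes "av a \<le> 1"
  shows "\<exists>i<p. av (a - of_nat i) \<le> 1 / p"
proof -
  have p0: "0 < 1 / real p" using p_gt_1 by simp
  obtain r where r: "av (a - of_rat r) < 1 / p" using dense[OF p0] by blast
  have "av (of_rat r) \<le> 1"
  proof -
    have "1 / real p \<le> 1" using p_gt_1 by simp
    then show ?thesis
      using ultrametric_diff[of a 1 "a - of_rat r"] assms r by simp
  qed
  obtain c d where cd: "quotient_of r = (c, d)" by fastforce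
  have d: "d > 0" "coprime c d" using cd quotient_of_denom_pos quotient_of_coprime by auto
  have req: "of_rat r = of_int c / (of_int d :: 'q)"
    using quotient_of_div[OF cd] by (simp add: of_rat_divide)
  have ip: "Factorial_Ring.prime (int p)" using prime by simp
  have pd: "\<not> int p dvd d"
  proof
    assume pd: "int p dvd d"
    then have "\<not> int p dvd c" 
      using coprime_common_divisor[OF d(2)] not_prime_unit ip by metis
    then have "av (of_int c) = 1" by (rule av_of_int_unit)
    then have "1 \<le> av (of_int d)"
      using \<open>av (of_rat r) \<le> 1\<close> d by (simp add: req av_divide)
    moreover have "of_int d = (of_nat p * of_int (d div int p) :: 'q)"
    proof -
      have "of_int d = (of_int (int p * (d div int p)) :: 'q)" using pd by simp
      then show ?thesis by (simp only: of_int_mult of_int_of_nat_eq)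
    qed
    then have "av (of_int d) \<le> 1 / p * 1"
      using av_of_int_le[of "d div int p"] p0
      by (simp only: av_mult av_p mult_left_mono less_imp_le)
    ultimately have "1 \<le> 1 / real p" by linarith
    then show False using p_gt_1 by (simp add: field_simps)
  qed
  then have "coprime d (int p)" using prime_imp_coprime[OF ip] by (simp add: coprime_commute)
  then obtain s where s: "[d * s = 1] (mod int p)" using cong_solve_coprime_int by blast
  define i where "i = nat ((s * c) mod int p)"
  have i: "int i = (s * c) mod int p" using p_gt_1 by (simp add: i_def)
  have ip': "i < p" proof -
    have "int i < int p" using p_gt_1 by (simp add: i)
    then show ?thesis by simp
  qed
  have "[int i * d = c] (mod int p)"
  proof -
    have "[int i = s * c] (mod int p)" by (simp add: i cong_def)
    then have "[int i * d = s * c * d] (mod int p)" by (rule cong_scalar_right)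
    also have "s * c * d = (d * s) * c" by simp
    also have "[(d * s) * c = 1 * c] (mod int p)" by (intro cong_mult s) auto
    finally show ?thesis by simp
  qed
  then have "int p dvd c - int i * d" 
    by (metis cong_iff_dvd_diff cong_sym)
  then obtain z where z: "c - int i * d = int p * z" by (elim dvdE)
  have "of_rat r - of_nat i = of_int (c - int i * d) / (of_int d :: 'q)"
    using d by (simp add: req field_simps)
  also have "\<dots> = of_nat p * of_int z / of_int d" by (simp add: z)
  finally have "av (of_rat r - of_nat i) = 1 / p * av (of_int z)"
    by (simp only: av_mult av_divide av_p av_of_int_unit[OF pd] div_by_1)
  also have "\<dots> \<le> 1 / p * 1" using av_of_int_le[of z] p0 by (intro mult_left_mono) auto
  finally have "av (of_rat r - of_nat i) \<le> 1 / p" by simp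
  then have "av ((a - of_rat r) + (of_rat r - of_nat i)) \<le> 1 / p"
    using r by (intro ultrametric) auto
  then show ?thesis using ip' by auto
qed

end

section \<open>The ring of integers is a complete discrete valuation ring\<close>

text \<open>A substitute for a valuation: membership means valuation at least \<open>j\<close>, also
  for \<open>x = 0\<close>. Inside the field this is the ideal generated by
  \<open>\<pi> ^ j\<close>, as \<open>PIdl_power\<close> confirms.\<close>

definition lev :: "'k::field set \<Rightarrow> 'k \<Rightarrow> nat \<Rightarrow> 'k set" where
  "lev R \<pi> j = {x. x / \<pi> ^ j \<in> R}"

locale subring_elt =
  fixes R :: "'k::field set" and \<pi> :: 'k
  assumes one_closed [simp]: "1 \<in> R"
    and diff_closed [simp]: "x \<in> R \<Longrightarrow> y \<in> R \<Longrightarrow> x - y \<in> R"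
    and mult_closed [simp]: "x \<in> R \<Longrightarrow> y \<in> R \<Longrightarrow> x * y \<in> R"
    and pi_closed [simp]: "\<pi> \<in> R"
    and pi_nonzero [simp]: "\<pi> \<noteq> 0"
begin

abbreviation L :: "nat \<Rightarrow> 'k set" where "L \<equiv> lev R \<pi>"

lemma zero_closed [simp]: "0 \<in> R"
  using diff_closed[of 1 1] by simp

lemma uminus_closed [simp]: "x \<in> R \<Longrightarrow> - x \<in> R"
  using diff_closed[of 0 x] by simp

lemma add_closed [simp]: "x \<in> R \<Longrightarrow> y \<in> R \<Longrightarrow> x + y \<in> R"
  using diff_closed[of x "- y"] by simp

lemma power_closed [simp]: "x \<in> R \<Longrightarrow> x ^ n \<in> R"
  by (induction n) auto

lemma of_nat_closed [simp]: "of_nat n \<in> R"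
  by (induction n) auto

lemma of_int_closed [simp]: "of_int n \<in> R"
  by (cases n) auto

lemma sum_closed: "(\<And>i. i \<in> A \<Longrightarrow> f i \<in> R) \<Longrightarrow> sum f A \<in> R"
  by (induction A rule: infinite_finite_induct) auto

lemma prod_closed: "(\<And>i. i \<in> A \<Longrightarrow> f i \<in> R) \<Longrightarrow> prod f A \<in> R"
  by (induction A rule: infinite_finite_induct) auto

lemma lev_0 [simp]: "L 0 = R"
  by (simp add: lev_def)

lemma lev_zero [simp]: "0 \<in> L j"
  by (simp add: lev_def)

lemma lev_add: "x \<in> L j \<Longrightarrow> y \<in> L j \<Longrightarrow> x + y \<in> L j"
  by (simp add: lev_def add_divide_distrib)

lemma lev_diff: "x \<in> L j \<Longrightarrow> y \<in> L j \<Longrightarrow> x - y \<in> L j"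
  by (simp add: lev_def diff_divide_distrib)

lemma lev_uminus: "x \<in> L j \<Longrightarrow> - x \<in> L j"
  by (simp add: lev_def)

lemma lev_mult: "x \<in> L i \<Longrightarrow> y \<in> L j \<Longrightarrow> x * y \<in> L (i + j)"
  using mult_closed[of "x / \<pi> ^ i" "y / \<pi> ^ j"] by (simp add: lev_def power_add)

lemma lev_multR: "x \<in> L j \<Longrightarrow> y \<in> R \<Longrightarrow> x * y \<in> L j"
  using lev_mult[of x j y 0] by simp

lemma lev_multL: "x \<in> R \<Longrightarrow> y \<in> L j \<Longrightarrow> x * y \<in> L j"
  using lev_mult[of x 0 y j] by simp

lemma lev_pi: "\<pi> ^ j \<in> L j"
  by (simp add: lev_def)

lemma lev_mono: "x \<in> L j \<Longrightarrow> i \<le> j \<Longrightarrow> x \<in> L i"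
proof -
  assume x: "x \<in> L j" and ij: "i \<le> j"
  have "\<pi> ^ j = \<pi> ^ i * \<pi> ^ (j - i)" using ij by (simp flip: power_add)
  then have "x / \<pi> ^ i = x / \<pi> ^ j * \<pi> ^ (j - i)" by simp
  then show ?thesis using x mult_closed[of "x / \<pi> ^ j" "\<pi> ^ (j - i)"] by (simp add: lev_def)
qed

lemma lev_R: "x \<in> L j \<Longrightarrow> x \<in> R"
  using lev_mono[of x j 0] by simp

lemma lev_sum: "(\<And>i. i \<in> A \<Longrightarrow> f i \<in> L j) \<Longrightarrow> sum f A \<in> L j"
  by (induction A rule: infinite_finite_induct) (auto intro: lev_add)

lemma lev_cong_sym: "x - y \<in> L j \<Longrightarrow> y - x \<in> L j"
  using lev_uminus[of "x - y" j] by simp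

lemma PIdl_power: "PIdl\<^bsub>sub_ring R\<^esub> (\<pi> ^ j) = L j"
proof -
  have "\<exists>y\<in>R. x = y * \<pi> ^ j" if "x / \<pi> ^ j \<in> R" for x
    using that by (intro bexI[of _ "x / \<pi> ^ j"]) auto
  then show ?thesis by (auto simp: cgenideal_def sub_ring_def lev_def)
qed

end

text \<open>The interface between arithmetic and groups: from here on \<open>R\<close> is known
  through these facts. The first two say that the nonunits are the multiples of
  \<open>\<pi>\<close>, and the two conditions on \<open>p\<close> and \<open>\<pi> ^ e\<close> say
  that these differ by a unit.\<close>

locale complete_dvr = subring_elt R \<pi> for R :: "'k::field set" and \<pi> :: 'k +
  fixes p e q :: nat
  assumes pi_nonunit: "inverse \<pi> \<notin> R"
    and local_ring: "x \<in> R \<Longrightarrow> inverse x \<notin> R \<Longrightarrow> x \<in> L 1"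
    and separated: "(\<And>j. x \<in> L j) \<Longrightarrow> x = 0"
    and complete: "(\<And>i. a (Suc i) - a i \<in> L i) \<Longrightarrow> \<exists>x. \<forall>i. x - a i \<in> L i"
    and prime_p: "Factorial_Ring.prime p" and e_pos: "e \<ge> 1"
    and p_nonzero: "of_nat p \<noteq> (0 :: 'k)"
    and p_lev: "of_nat p \<in> L e" and p_lev': "\<pi> ^ e / of_nat p \<in> R"
    and residue: "\<exists>T. finite T \<and> card T = q \<and> T \<subseteq> R \<and> (\<forall>x\<in>R. \<exists>!t. t \<in> T \<and> x - t \<in> L 1)"

locale padic_extension = padic_field p av
  for p and av :: "'q::field_char_0 \<Rightarrow> real" +
  fixes \<iota> :: "'q \<Rightarrow> 'k::field" and d e f :: nat and R :: "'k set" and \<pi> :: 'k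
  assumes ext: "finite_extension_of_degree \<iota> d"
    and R_def: "R = ring_of_integers av \<iota>"
    and unif: "uniformizer R \<pi>"
    and ram: "ramification_index p R \<pi> e"
    and inert: "inertia_degree (\<iota> ` padic_integers av) R \<pi> f"
begin

sublocale hom: field_hom \<iota>
  using ext unfolding finite_extension_of_degree_def by blast

lemma of_nat_nonzero: "of_nat n = (0 :: 'k) \<longleftrightarrow> n = 0"
  using hom.hom_0_iff[of "of_nat n"] by (simp add: hom.hom_of_nat)

lemma max_ideal: "maximalideal (PIdl\<^bsub>sub_ring R\<^esub> \<pi>) (sub_ring R)"
  using unif unfolding uniformizer_def by blast

lemma ring_R: "ring (sub_ring R)"
  using max_ideal unfolding maximalideal_def ideal_def by blast

lemma cring_R: "cring (sub_ring R)"
  by (rule cring.intro[OF ring_R]) 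
    (use ring_R in \<open>auto simp: ring_def comm_monoid_def comm_monoid_axioms_def sub_ring_def\<close>)

lemma PIdl_eq: "PIdl\<^bsub>sub_ring R\<^esub> a = {x * a | x. x \<in> R}"
  by (simp add: cgenideal_def sub_ring_def)

lemma R_arith: "1 \<in> R" "0 \<in> R" "x \<in> R \<Longrightarrow> y \<in> R \<Longrightarrow> x + y \<in> R" "x \<in> R \<Longrightarrow> y \<in> R \<Longrightarrow> x * y \<in> R"
  "x \<in> R \<Longrightarrow> - x \<in> R"
proof -
  interpret r: ring "sub_ring R" by (rule ring_R)
  show "1 \<in> R" "0 \<in> R" "x \<in> R \<Longrightarrow> y \<in> R \<Longrightarrow> x + y \<in> R" "x \<in> R \<Longrightarrow> y \<in> R \<Longrightarrow> x * y \<in> R"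
    using r.one_closed r.zero_closed r.a_closed[of x y] r.m_closed[of x y]
    by (auto simp: sub_ring_def)
  assume x: "x \<in> R"
  then have "\<ominus>\<^bsub>sub_ring R\<^esub> x \<in> R" "\<ominus>\<^bsub>sub_ring R\<^esub> x + x = 0"
    using r.a_inv_closed[of x] r.l_neg[of x] by (auto simp: sub_ring_def)
  then show "- x \<in> R" by (metis add_eq_0_iff2 minus_equation_iff)
qed

lemma iota_closed: "av a \<le> 1 \<Longrightarrow> \<iota> a \<in> R"
proof -
  assume a: "av a \<le> 1"
  have *: "\<iota> b \<in> \<iota> ` padic_integers av" if "av b \<le> 1" for b
    using that by (auto simp: padic_integers_def)
  have "poly.coeff [:- \<iota> a, 1:] i \<in> \<iota> ` padic_integers av" for i
    using *[of "- a"] *[of 0] *[of 1] a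
    by (auto simp: coeff_pCons hom.hom_uminus hom.hom_one hom.hom_zero split: nat.splits)
  then show ?thesis
    unfolding R_def ring_of_integers_def by (auto intro!: exI[of _ "[:- \<iota> a, 1:]"])
qed

text \<open>Since \<open>x\<close> is nonzero, factors of the indeterminate can be removed from an
  equation of \<open>x\<close> until its constant term is nonzero; that constant term is then a
  multiple of \<open>x\<close>. It plays the part of the norm and moves questions of divisibility to
  the base field.\<close>

lemma integral_sum_zero:
  assumes "x \<in> R" "x \<noteq> 0"
  shows "\<exists>c y. c \<noteq> 0 \<and> av c \<le> 1 \<and> y \<in> R \<and> \<iota> c = x * y"
proof -
  have poly_closed: "poly P x \<in> R" if "\<forall>i. poly.coeff P i \<in> \<iota> ` padic_integers av" for P
    using that
  proof (induction P)
    case (pCons a P)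
    have "a \<in> R" using pCons.prems[rule_format, of 0] by (auto simp: padic_integers_def iota_closed)
    moreover have "\<forall>i. poly.coeff P i \<in> \<iota> ` padic_integers av"
      using pCons.prems by (metis coeff_pCons_Suc)
    ultimately show ?case using pCons.IH assms by (auto intro!: R_arith)
  qed (simp add: R_arith)
  have "\<exists>c y. c \<noteq> 0 \<and> av c \<le> 1 \<and> y \<in> R \<and> \<iota> c = x * y"
    if "P \<noteq> 0" "\<forall>i. poly.coeff P i \<in> \<iota> ` padic_integers av" "poly P x = 0" for P
    using that
  proof (induction P)
    case (pCons a P)
    obtain c where c: "a = \<iota> c" "av c \<le> 1" using pCons.prems(2)[rule_format, of 0] by (auto simp: padic_integers_def)
    have P: "\<forall>i. poly.coeff P i \<in> \<iota> ` padic_integers av"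
      using pCons.prems by (metis coeff_pCons_Suc)
    show ?case
    proof (cases "c = 0")
      case True
      then have "a = 0" by (simp add: c)
      then have "P \<noteq> 0" "poly P x = 0" using pCons.prems assms by auto
      then show ?thesis using pCons.IH P by blast
    next
      case False
      have "\<iota> c = x * (- poly P x)" using pCons.prems(3) c by (simp add: eq_neg_iff_add_eq_0)
      then show ?thesis using False c R_arith(5)[OF poly_closed[OF P]] by blast
    qed
  qed simp
  moreover obtain P :: "'k poly" where "poly.coeff P (Polynomial.degree P) = 1"
    "\<forall>i. poly.coeff P i \<in> \<iota> ` padic_integers av" "poly P x = 0"
    using assms(1) unfolding R_def ring_of_integers_def by blast
  moreover from this have "P \<noteq> 0" by auto
  ultimately show ?thesis by blast
qed

text \<open>Multiplying a monic equation for \<open>1/p\<close> over the \<open>p\<close>-adic integers by \<open>p\<^sup>N\<close>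
  makes \<open>1\<close> a multiple of \<open>p\<close>.\<close>

lemma inverse_p_notin: "inverse (of_nat p) \<notin> R"
proof
  assume "inverse (of_nat p) \<in> R"
  then obtain P :: "'k poly" where P: "poly.coeff P (Polynomial.degree P) = 1" "\<forall>i. poly.coeff P i \<in> \<iota> ` padic_integers av"
    "poly P (inverse (of_nat p)) = 0"
    unfolding R_def ring_of_integers_def by blast
  define N where "N = Polynomial.degree P"
  obtain c where c: "\<And>i. poly.coeff P i = \<iota> (c i)" "\<And>i. av (c i) \<le> 1"
  proof -
    have "\<forall>i. \<exists>c. poly.coeff P i = \<iota> c \<and> av c \<le> 1" using P(2) by (fastforce simp: padic_integers_def)
    then show ?thesis using that by metis
  qed
  have cN: "c N = 1"
    using P(1) c(1)[of N] hom.injectivity[of "c N" 1] by (simp add: N_def)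
  have p0: "(of_nat p :: 'q) \<noteq> 0" using p_gt_1 by simp
  have "0 = \<iota> (\<Sum>i\<le>N. c i * inverse (of_nat p) ^ i)"
    using P(3) by (simp add: poly_altdef c N_def hom.hom_sum hom.hom_mult hom.hom_power hom.hom_inverse hom.hom_of_nat)
  then have "(\<Sum>i\<le>N. c i * inverse (of_nat p) ^ i) = 0" by (metis hom.hom_0_iff)
  then have "0 = of_nat p ^ N * (\<Sum>i\<le>N. c i * inverse (of_nat p) ^ i)" by simp
  also have "\<dots> = (\<Sum>i\<le>N. c i * of_nat p ^ (N - i))"
    unfolding sum_distrib_left
    by (intro sum.cong) (use p0 in \<open>auto simp: power_diff field_simps\<close>)
  also have "{..N} = insert N {..<N}" by auto
  finally have "1 = - (\<Sum>i<N. c i * of_nat p ^ (N - i))" by (simp add: cN eq_neg_iff_add_eq_0)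
  moreover have "av (\<Sum>i<N. c i * of_nat p ^ (N - i)) \<le> 1 / p"
  proof (rule ultrametric_sum)
    fix i assume "i \<in> {..<N}"
    then have "N - i = Suc (N - i - 1)" by simp
    then have "(1 / real p) ^ (N - i) = 1 / p * (1 / p) ^ (N - i - 1)" by (metis power_Suc)
    then have "av (c i * of_nat p ^ (N - i)) = av (c i) * (1 / p * (1 / p) ^ (N - i - 1))"
      by (simp only: av_mult av_power av_p)
    also have "\<dots> \<le> 1 * (1 / p * 1)"
      using c(2) p_gt_1 by (intro mult_mono power_le_one) auto
    finally show "av (c i * of_nat p ^ (N - i)) \<le> 1 / p" by simp
  qed simp
  ultimately have "av 1 \<le> 1 / p" by (metis av_minus)
  then show False using p_gt_1 by (simp add: field_simps)
qed

lemma p_pi: obtains a b where "a \<in> R" "b \<in> R" "a * b = 1" "of_nat p = a * \<pi> ^ e" "\<pi> ^ e = b * of_nat p"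
proof -
  have eq: "{x * of_nat p | x. x \<in> R} = {x * \<pi> ^ e | x. x \<in> R}"
    using ram unfolding ramification_index_def PIdl_eq .
  have "1 * of_nat p \<in> {x * \<pi> ^ e | x. x \<in> R}" "1 * \<pi> ^ e \<in> {x * of_nat p | x. x \<in> R}"
    using R_arith(1) eq by blast+
  then have "\<exists>a. of_nat p = a * \<pi> ^ e \<and> a \<in> R" "\<exists>b. \<pi> ^ e = b * of_nat p \<and> b \<in> R"
    unfolding mem_Collect_eq mult_1_left .
  then obtain a b where ab: "a \<in> R" "of_nat p = a * \<pi> ^ e" "b \<in> R" "\<pi> ^ e = b * of_nat p"
    by blast
  have "of_nat p \<noteq> (0 :: 'k)" using of_nat_nonzero p_gt_1 by auto
  moreover have "a * b * of_nat p = a * (b * of_nat p)" by (rule mult.assoc)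
  then have "a * b * of_nat p = 1 * of_nat p"
    by (simp only: ab(4)[symmetric] ab(2)[symmetric] mult_1_left)
  ultimately have "a * b = 1" by (metis mult_right_cancel)
  then show ?thesis using ab that by blast
qed

lemma e_pos: "e \<ge> 1"
proof (rule ccontr)
  assume "\<not> e \<ge> 1"
  then have "e = 0" by simp
  then obtain b where "b \<in> R" "of_nat p * b = (1 :: 'k)" using p_pi by (metis mult.right_neutral power_0)
  then show False using inverse_p_notin by (metis inverse_unique)
qed

sublocale subring_elt R \<pi>
proof
  show "\<pi> \<in> R" using unif unfolding uniformizer_def by blast
  show "\<pi> \<noteq> 0"
  proof
    assume "\<pi> = 0"
    then have "of_nat p = (0 :: 'k)" using p_pi e_pos by (metis mult_zero_right not_one_le_zero power_0_left)
    then show False using of_nat_nonzero p_gt_1 by auto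
  qed
  show "x - y \<in> R" if "x \<in> R" "y \<in> R" for x y
    using R_arith(3)[OF that(1) R_arith(5)[OF that(2)]] by simp
qed (auto intro: R_arith)

lemma PIdl_pi: "PIdl\<^bsub>sub_ring R\<^esub> \<pi> = L 1"
  using PIdl_power[of 1] by simp

lemma p_nonzero: "of_nat p \<noteq> (0 :: 'k)"
  using of_nat_nonzero p_gt_1 by auto

lemma p_lev: "of_nat p \<in> L e" and p_lev': "\<pi> ^ e / of_nat p \<in> R"
proof -
  obtain a b where ab: "a \<in> R" "b \<in> R" "of_nat p = a * \<pi> ^ e" "\<pi> ^ e = b * of_nat p"
    using p_pi by blast
  show "of_nat p \<in> L e" using ab(1,3) by (simp add: lev_multL lev_pi)
  have "\<pi> ^ e / of_nat p = b" using ab(4) p_nonzero by (simp add: field_simps)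
  then show "\<pi> ^ e / of_nat p \<in> R" using ab(2) by simp
qed

text \<open>A nonzero \<open>x\<close> divisible by all powers of \<open>\<pi>\<close> would have a
  multiple \<open>\<iota> c\<close> with \<open>c\<close> nonzero and the same property, hence
  divisible by all powers of \<open>p\<close>. As \<open>p ^ j / c\<close> is integral for large
  \<open>j\<close>, this would put the inverse of \<open>p\<close> into \<open>R\<close>.\<close>

lemma separated: "x = 0" if x: "\<And>j. x \<in> L j"
proof (rule ccontr)
  assume "x \<noteq> 0"
  moreover have "x \<in> R" using x[of 0] by simp
  ultimately obtain c y where c: "c \<noteq> 0" "av c \<le> 1" "y \<in> R" "\<iota> c = x * y"
    using integral_sum_zero by blast
  obtain j where j: "(1 / real p) ^ j < av c"
    using real_arch_pow_inv[of "av c" "1 / real p"] c p_gt_1 by auto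
  have "\<iota> c \<in> L (e * Suc j)" using c lev_multR x by simp
  then have "\<iota> c / \<pi> ^ (e * Suc j) \<in> R" by (simp add: lev_def)
  then have "\<iota> c / \<pi> ^ (e * Suc j) * (\<pi> ^ e / of_nat p) ^ Suc j \<in> R"
    using p_lev' by (intro mult_closed power_closed)
  moreover have "\<iota> c / \<pi> ^ (e * Suc j) * (\<pi> ^ e / of_nat p) ^ Suc j = \<iota> c / of_nat p ^ Suc j"
  proof -
    have "a / x * (x / b) = a / b" if "x \<noteq> 0" for a x b :: 'k using that by simp
    then show ?thesis by (simp only: power_divide power_mult[symmetric]) (simp del: power_Suc)
  qed
  ultimately have "\<iota> c / of_nat p ^ Suc j \<in> R" by simp
  moreover have "\<iota> (of_nat p ^ j / c) \<in> R"
    using j c by (intro iota_closed) (simp add: av_divide av_power av_p)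
  ultimately have "\<iota> c / of_nat p ^ Suc j * \<iota> (of_nat p ^ j / c) \<in> R" by (rule mult_closed)
  moreover have "\<iota> c / of_nat p ^ Suc j * \<iota> (of_nat p ^ j / c) = inverse (of_nat p)"
    using c(1) p_nonzero by (simp add: hom.hom_div hom.hom_power hom.hom_of_nat field_simps)
  ultimately show False using inverse_p_notin by simp
qed

end

lemma sub_ring_simps [simp]:
  "carrier (sub_ring S) = S" "\<one>\<^bsub>sub_ring S\<^esub> = 1" "\<zero>\<^bsub>sub_ring S\<^esub> = 0"
  "x \<otimes>\<^bsub>sub_ring S\<^esub> y = x * y" "x \<oplus>\<^bsub>sub_ring S\<^esub> y = x + y"
  by (simp_all add: sub_ring_def)

lemma field_sub_ring_UNIV: "field (sub_ring (UNIV :: 'k::field set))"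
proof -
  have ex: "\<exists>y. y + x = 0" "\<exists>y. x + y = 0" for x :: 'k by (rule exI[of _ "- x"], simp)+
  interpret r: cring "sub_ring (UNIV :: 'k set)"
    by (rule cringI; (rule abelian_groupI | rule comm_monoidI)?) 
      (auto simp: algebra_simps ex)
  have "\<exists>y. x * y = 1" if "x \<noteq> 0" for x :: 'k using that by (intro exI[of _ "inverse x"]) simp
  then show ?thesis
    by (intro r.cring_fieldI2) (auto simp: sub_ring_def)
qed

section \<open>Completeness of the extension field\<close>

context padic_extension
begin

text \<open>Consecutive differences suffice, because each \<open>L j\<close> is closed under
  addition.\<close>

definition cauchy :: "(nat \<Rightarrow> 'k) \<Rightarrow> bool" where
  "cauchy a \<longleftrightarrow> (\<forall>j. \<exists>N. \<forall>i\<ge>N. a (Suc i) - a i \<in> L j)"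

definition converges :: "(nat \<Rightarrow> 'k) \<Rightarrow> 'k \<Rightarrow> bool" where
  "converges a x \<longleftrightarrow> (\<forall>j. \<exists>N. \<forall>i\<ge>N. x - a i \<in> L j)"

lemma subfield_range: "subfield (range \<iota>) (sub_ring UNIV)"
proof -
  interpret r: field "sub_ring (UNIV :: 'k set)" by (rule field_sub_ring_UNIV)
  have inv: "a_inv (sub_ring UNIV) x = - x" for x :: 'k
    using r.minus_equality[of "- x" x] by (simp add: sub_ring_def)
  have minv: "m_inv (sub_ring UNIV) x = inverse x" if "x \<noteq> 0" for x :: 'k
    using r.inv_char[of x "inverse x"] that by (simp add: sub_ring_def)
  show ?thesis
  proof (rule r.subfieldI', rule r.subringI)
    show "\<one>\<^bsub>sub_ring UNIV\<^esub> \<in> range \<iota>"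
      using hom.hom_one by (auto simp: sub_ring_def intro!: image_eqI[of _ _ 1])
    show "\<ominus>\<^bsub>sub_ring UNIV\<^esub> h \<in> range \<iota>" if "h \<in> range \<iota>" for h
      using that by (auto simp: inv hom.hom_uminus[symmetric])
    show "h1 \<otimes>\<^bsub>sub_ring UNIV\<^esub> h2 \<in> range \<iota>" if "h1 \<in> range \<iota>" "h2 \<in> range \<iota>" for h1 h2
      using that by (auto simp: sub_ring_def hom.hom_mult[symmetric])
    show "h1 \<oplus>\<^bsub>sub_ring UNIV\<^esub> h2 \<in> range \<iota>" if "h1 \<in> range \<iota>" "h2 \<in> range \<iota>" for h1 h2
      using that by (auto simp: sub_ring_def hom.hom_add[symmetric])
    show "inv\<^bsub>sub_ring UNIV\<^esub> k \<in> range \<iota>" if "k \<in> range \<iota> - {\<zero>\<^bsub>sub_ring UNIV\<^esub>}" for k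
    proof -
      have "k \<noteq> 0" "k \<in> range \<iota>" using that by (auto simp: sub_ring_def)
      then show ?thesis by (auto simp: minv hom.hom_inverse[symmetric])
    qed
  qed (auto simp: sub_ring_def)
qed

lemma dimension_UNIV: "ring.dimension (sub_ring UNIV) d (range \<iota>) UNIV"
  using ext unfolding finite_extension_of_degree_def by blast

text \<open>Finite dimension makes every element algebraic. The rest is a change of representation:
  the polynomials of the algebra library are lists with the leading coefficient first, whence
  \<open>rev\<close>.\<close>

lemma algebraic_poly:
  obtains P :: "'k poly" where "P \<noteq> 0" "\<forall>i. poly.coeff P i \<in> range \<iota>" "poly P v = 0"
proof -
  interpret r: field "sub_ring (UNIV :: 'k set)" by (rule field_sub_ring_UNIV)
  have "(r.algebraic over range \<iota>) v"
  proof (rule r.finite_dimension_imp_algebraic[OF subfield_range])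
    show "subring UNIV (sub_ring (UNIV :: 'k set))" using r.carrier_is_subring by simp
    show "r.finite_dimension (range \<iota>) UNIV" unfolding r.finite_dimension_def using dimension_UNIV by blast
  qed simp
  then obtain ps where ps: "ps \<in> carrier (univ_poly (sub_ring UNIV) (range \<iota>))" "ps \<noteq> []"
    "r.eval ps v = 0"
    using r.algebraicE[OF subfieldE(1)[OF subfield_range], of v] by auto
  have pol: "polynomial\<^bsub>sub_ring UNIV\<^esub> (range \<iota>) ps"
    using ps(1) by (simp add: univ_poly_carrier)
  have pow: "v [^]\<^bsub>sub_ring UNIV\<^esub> n = v ^ n" for n :: nat
    by (induction n) (auto simp: sub_ring_def nat_pow_def)
  have ev: "r.eval xs v = poly (Poly (rev xs)) v" for xs
    by (induction xs) (auto simp: Poly_append poly_monom pow)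
  have set: "set ps \<subseteq> range \<iota>" and hd: "hd ps \<noteq> 0"
    using pol ps(2) unfolding polynomial_def by auto
  have co: "poly.coeff (Poly (rev ps)) i = (if i < length ps then rev ps ! i else 0)" for i
    by (simp add: coeff_Poly_eq nth_default_def)
  show ?thesis
  proof (rule that[of "Poly (rev ps)"])
    have "poly.coeff (Poly (rev ps)) (length ps - 1) = hd ps"
      using ps(2) unfolding co by (simp add: rev_nth hd_conv_nth)
    then show "Poly (rev ps) \<noteq> 0" using hd by (metis coeff_0)
    show "\<forall>i. poly.coeff (Poly (rev ps)) i \<in> range \<iota>"
    proof
      fix i
      show "poly.coeff (Poly (rev ps)) i \<in> range \<iota>"
      proof (cases "i < length ps")
        case True
        then have "rev ps ! i \<in> set (rev ps)" by (intro nth_mem) simp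
        then show ?thesis using True set unfolding co by auto
      next
        case False
        then show ?thesis using hom.hom_zero unfolding co by (auto intro!: image_eqI[of _ _ 0])
      qed
    qed
    show "poly (Poly (rev ps)) v = 0" using ps(3) ev by simp
  qed
qed

text \<open>If \<open>v\<close> is a root of a monic polynomial \<open>Q\<close> of degree \<open>N\<close>, then \<open>c v\<close> is a root of the monic
  polynomial with coefficients \<open>c\<^sup>N\<^sup>-\<^sup>i Q\<^sub>i\<close>.\<close>

lemma scale_into_R: "\<exists>r. of_nat p ^ r * v \<in> R"
proof -
  obtain P :: "'k poly" where P: "P \<noteq> 0" "\<forall>i. poly.coeff P i \<in> range \<iota>" "poly P v = 0"
    using algebraic_poly by blast
  define N where "N = Polynomial.degree P"
  have "\<forall>i. \<exists>c. poly.coeff P i = \<iota> c" using P(2) by blast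
  then obtain c where c: "\<And>i. poly.coeff P i = \<iota> (c i)" by metis
  have cN: "c N \<noteq> 0"
  proof
    assume "c N = 0"
    then have "poly.coeff P N = 0" by (simp add: c hom.hom_zero)
    then show False using P(1) by (simp add: N_def)
  qed
  define b where "b i = c i / c N" for i
  have "\<exists>r. \<forall>i<n. av (b i) \<le> real p ^ r" for n
  proof (induction n)
    case (Suc n)
    then obtain r where r: "\<forall>i<n. av (b i) \<le> real p ^ r" by blast
    obtain r' where r': "av (b n) < real p ^ r'" using real_arch_pow[of "real p" "av (b n)"] p_gt_1 by auto
    have *: "real p ^ k \<le> real p ^ (r + r')" if "k \<le> r + r'" for k
      using that p_gt_1 by (intro power_increasing) auto
    have "av (b i) \<le> real p ^ (r + r')" if "i < Suc n" for i
      using r r' *[of r] *[of r'] that by (cases "i = n") (force simp: less_Suc_eq)+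
    then show ?case by blast
  qed simp
  then obtain r where r: "\<And>i. i < N \<Longrightarrow> av (b i) \<le> real p ^ r" by blast
  define a where "a i = (if i \<le> N then b i * of_nat p ^ (r * (N - i)) else 0)" for i
  have p0: "(of_nat p :: 'q) \<noteq> 0" using p_gt_1 by simp
  have a_le: "av (a i) \<le> 1" for i
  proof (cases "i < N")
    case True
    define k where "k = N - i - 1"
    have k: "N - i = Suc k" using True by (simp add: k_def)
    have "a i = b i * (of_nat p ^ r * (of_nat p ^ r) ^ k)"
      using True by (simp add: a_def k power_add flip: power_mult)
    then have "av (a i) = av (b i) * ((1 / p) ^ r * ((1 / p) ^ r) ^ k)"
      by (simp only: av_mult av_power av_p)
    also have "\<dots> \<le> real p ^ r * ((1 / p) ^ r * 1)"
      using p_gt_1 r[OF True] by (intro mult_mono power_le_one) auto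
    also have "\<dots> = 1" using p_gt_1 by (simp add: power_divide)
    finally show ?thesis .
  next
    case False
    then show ?thesis using cN by (cases "i = N") (auto simp: a_def b_def)
  qed
  define Q where "Q = (\<Sum>i\<le>N. Polynomial.monom (\<iota> (a i)) i)"
  have coeffQ: "poly.coeff Q i = \<iota> (a i)" for i
    by (auto simp: Q_def coeff_sum a_def hom.hom_zero)
  have "a N = 1" using cN by (simp add: a_def b_def)
  moreover have "Polynomial.degree Q = N"
  proof (rule antisym)
    show "Polynomial.degree Q \<le> N"
      by (rule degree_le) (simp add: coeffQ a_def hom.hom_zero)
    show "N \<le> Polynomial.degree Q"
      by (rule le_degree) (simp add: coeffQ \<open>a N = 1\<close> hom.hom_one)
  qed
  ultimately have lead: "poly.coeff Q (Polynomial.degree Q) = 1" by (simp add: coeffQ hom.hom_one)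
  have "poly Q (of_nat p ^ r * v) = (\<Sum>i\<le>N. \<iota> (a i) * (of_nat p ^ r * v) ^ i)"
    by (simp add: Q_def poly_sum poly_monom)
  also have "\<dots> = (\<Sum>i\<le>N. of_nat p ^ (r * N) / \<iota> (c N) * (poly.coeff P i * v ^ i))"
  proof (rule sum.cong[OF refl])
    fix i assume "i \<in> {..N}"
    then have "r * N = r * (N - i) + r * i" by (simp flip: add_mult_distrib2)
    then have "(of_nat p :: 'k) ^ (r * N) = of_nat p ^ (r * (N - i)) * (of_nat p ^ r) ^ i"
      by (simp only: power_add power_mult)
    then show "\<iota> (a i) * (of_nat p ^ r * v) ^ i = of_nat p ^ (r * N) / \<iota> (c N) * (poly.coeff P i * v ^ i)"
      using \<open>i \<in> {..N}\<close>
      by (simp add: a_def b_def c hom.hom_mult hom.hom_div hom.hom_power hom.hom_of_nat power_mult_distrib)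
  qed
  also have "\<dots> = of_nat p ^ (r * N) / \<iota> (c N) * poly P v"
    by (simp add: poly_altdef N_def sum_distrib_left)
  also have "\<dots> = 0" by (simp add: P)
  finally have "poly Q (of_nat p ^ r * v) = 0" .
  moreover have "\<forall>i. poly.coeff Q i \<in> \<iota> ` padic_integers av"
    using a_le by (auto simp: coeffQ padic_integers_def)
  ultimately show ?thesis using lead unfolding R_def ring_of_integers_def by blast
qed

lemma iota_lev: "av a \<le> 1 / real p ^ t \<Longrightarrow> \<iota> a \<in> L (e * t)"
proof -
  assume a: "av a \<le> 1 / real p ^ t"
  have "av (a / of_nat p ^ t) \<le> 1"
    using a p_gt_1 by (simp add: av_divide av_power av_p power_divide field_simps)
  then have "\<iota> (a / of_nat p ^ t) * of_nat p ^ t \<in> L (e * t)"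
  proof (intro lev_multL iota_closed)
    show "of_nat p ^ t \<in> L (e * t)"
    proof (induction t)
      case (Suc t)
      then show ?case using lev_mult[OF p_lev Suc] by simp
    qed simp
  qed
  then show ?thesis
    using p_nonzero by (simp add: hom.hom_div hom.hom_power hom.hom_of_nat)
qed

lemma lev_div_p: "x \<in> L (j + e * t) \<Longrightarrow> x / of_nat p ^ t \<in> L j"
proof -
  assume "x \<in> L (j + e * t)"
  then have "x / \<pi> ^ (j + e * t) * (\<pi> ^ e / of_nat p) ^ t \<in> R"
    by (intro mult_closed power_closed p_lev') (simp add: lev_def)
  moreover have "x / \<pi> ^ (j + e * t) * (\<pi> ^ e / of_nat p) ^ t = x / of_nat p ^ t / \<pi> ^ j"
    by (simp only: power_divide power_mult[symmetric] power_add) (simp add: field_simps)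
  ultimately show ?thesis by (simp add: lev_def)
qed

text \<open>The classical proof that finite-dimensional spaces over a complete field are complete,
  by induction along \<open>dimension\<close>. If \<open>E\<close> is complete, then
  \<open>v\<close> has positive distance from \<open>E\<close>, so the coefficients of
  \<open>v\<close> in a Cauchy sequence of the line extension are Cauchy themselves, and so are the
  remainders in \<open>E\<close>. Closure under the vector space operations is carried along because
  the distance argument uses it.\<close>

lemma converges_in_dimension:
  assumes "ring.dimension (sub_ring UNIV) n K E" "K = range \<iota>"
  shows "0 \<in> E \<and> (\<forall>x\<in>E. \<forall>y\<in>E. x + y \<in> E) \<and> (\<forall>x\<in>E. \<forall>c. \<iota> c * x \<in> E) \<and>
    (\<forall>a. range a \<subseteq> E \<longrightarrow> cauchy a \<longrightarrow> (\<exists>x\<in>E. converges a x))"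
proof -
  interpret r: field "sub_ring (UNIV :: 'k set)" by (rule field_sub_ring_UNIV)
  show ?thesis
  using assms
proof (induction rule: r.dimension.induct)
  case (zero_dim K)
  have "converges a 0" if "range a \<subseteq> {0}" for a
  proof -
    have "a i = 0" for i using that by blast
    then show ?thesis by (simp add: converges_def)
  qed
  then show ?case by simp
next
  case (Suc_dim v E n K)
  define E' where "E' = r.line_extension K v E"
  have mem: "x \<in> E' \<longleftrightarrow> (\<exists>c. \<exists>w\<in>E. x = \<iota> c * v + w)" for x
    unfolding E'_def r.line_extension_mem_iff using Suc_dim(5) by auto
  have E0: "0 \<in> E" and Eadd: "\<And>x y. x \<in> E \<Longrightarrow> y \<in> E \<Longrightarrow> x + y \<in> E"
    and Escale: "\<And>x c. x \<in> E \<Longrightarrow> \<iota> c * x \<in> E"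
    and Ecomp: "\<And>a. range a \<subseteq> E \<Longrightarrow> cauchy a \<Longrightarrow> \<exists>x\<in>E. converges a x"
    using Suc_dim(4)[OF Suc_dim(5)] by auto
  have Ediff: "x - y \<in> E" if "x \<in> E" "y \<in> E" for x y
    using Eadd[OF that(1) Escale[OF that(2), of "- 1"]] by (simp add: hom.hom_uminus hom.hom_one)
  \<comment> \<open>Otherwise approximations of \<open>v\<close> from \<open>E\<close> would form a
    Cauchy sequence, whose limit in \<open>E\<close> would be \<open>v\<close> itself by
    separatedness.\<close>
  have "\<exists>j. \<forall>w\<in>E. v - w \<notin> L j"
  proof (rule ccontr)
    assume "\<not> ?thesis"
    then obtain w where w: "\<And>j. w j \<in> E" "\<And>j. v - w j \<in> L j" by metis
    have "w (Suc i) - w i \<in> L j" if "i \<ge> j" for i j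
      using lev_diff[OF lev_mono[OF w(2)[of i] that] lev_mono[OF w(2)[of "Suc i"]]] that by simp
    then have "cauchy w" unfolding cauchy_def by blast
    then obtain x where x: "x \<in> E" "converges w x" using Ecomp w(1) by blast
    have "v - x \<in> L j" for j
    proof -
      obtain N where N: "\<forall>i\<ge>N. x - w i \<in> L j" using x(2) unfolding converges_def by blast
      define i where "i = max N j"
      have "v - w i \<in> L j" using lev_mono[OF w(2)[of i], of j] by (simp add: i_def)
      moreover have "x - w i \<in> L j" using N by (simp add: i_def)
      ultimately show ?thesis using lev_diff[of "v - w i" j "x - w i"] by simp
    qed
    then have "v - x = 0" by (rule separated)
    then show False using x(1) Suc_dim(2) by simp
  qed
  then obtain j0 where j0: "\<And>w. w \<in> E \<Longrightarrow> v - w \<notin> L j0" by blast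
  \<comment> \<open>If \<open>b\<close> were larger than \<open>1 / p ^ t\<close>, multiplying by
    the integral element \<open>p ^ t / b\<close> and dividing by \<open>p ^ t\<close> would exhibit
    an element of \<open>E\<close> closer to \<open>v\<close> than level \<open>j0\<close>
    allows.\<close>
  have bound: "av b \<le> 1 / real p ^ t" if w: "w \<in> E" and l: "\<iota> b * v + w \<in> L (j0 + e * t)" for b w t
  proof (rule ccontr)
    assume "\<not> av b \<le> 1 / real p ^ t"
    then have b: "1 / real p ^ t < av b" by simp
    then have b0: "b \<noteq> 0" using p_gt_1 by auto
    have "av (of_nat p ^ t / b) \<le> 1"
    proof -
      have "0 < real p ^ t" "0 < av b" using p_gt_1 b0 by auto
      moreover from this b have "1 < av b * real p ^ t" by (simp only: pos_divide_less_eq)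
      ultimately show ?thesis
        by (simp only: av_divide av_power av_p power_divide) (simp add: divide_le_eq mult.commute)
    qed
    then have "\<iota> (of_nat p ^ t / b) * ((\<iota> b * v + w) / of_nat p ^ t) \<in> L j0"
      by (intro lev_multL iota_closed lev_div_p l)
    also have "\<iota> (of_nat p ^ t / b) * ((\<iota> b * v + w) / of_nat p ^ t) = v - \<iota> (- 1 / b) * w"
      using b0 p_nonzero
      by (simp add: hom.hom_div hom.hom_power hom.hom_of_nat hom.hom_uminus hom.hom_one field_simps)
    finally show False using j0[OF Escale[OF w]] by blast
  qed
  have "\<exists>x\<in>E'. converges a x" if a: "range a \<subseteq> E'" "cauchy a" for a
  proof -
    have "\<forall>i. \<exists>c w. w \<in> E \<and> a i = \<iota> c * v + w" using a(1) mem by blast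
    then obtain c w where cw: "\<And>i. w i \<in> E" "\<And>i. a i = \<iota> (c i) * v + w i" by metis
    have "\<exists>N. \<forall>i\<ge>N. av (c (Suc i) - c i) \<le> 1 / real p ^ t" for t
    proof -
      obtain N where N: "\<forall>i\<ge>N. a (Suc i) - a i \<in> L (j0 + e * t)" using a(2) unfolding cauchy_def by blast
      have "av (c (Suc i) - c i) \<le> 1 / real p ^ t" if "i \<ge> N" for i
      proof (rule bound)
        show "w (Suc i) - w i \<in> E" by (intro Ediff cw)
        have "\<iota> (c (Suc i) - c i) * v + (w (Suc i) - w i) = a (Suc i) - a i"
          by (simp add: cw hom.hom_minus algebra_simps)
        then show "\<iota> (c (Suc i) - c i) * v + (w (Suc i) - w i) \<in> L (j0 + e * t)"
          using N that by simp
      qed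
      then show ?thesis by blast
    qed
    then obtain c' where c': "\<And>t. \<exists>N. \<forall>i\<ge>N. av (c' - c i) \<le> 1 / real p ^ t"
      using tendsto_exists by blast
    \<comment> \<open>The vector \<open>v\<close> need not be integral. The power
      \<open>p ^ s\<close> clears its denominator, at the cost of \<open>s\<close> extra powers of
      \<open>p\<close> in the precision of the coefficients.\<close>
    obtain s where s: "of_nat p ^ s * v \<in> R" using scale_into_R by blast
    have scale: "\<iota> b * v \<in> L j" if "av b \<le> 1 / real p ^ (s + j)" for b j
    proof -
      have "\<iota> b * (of_nat p ^ s * v) \<in> L (e * (s + j))"
        using lev_multR[OF iota_lev[OF that] s] .
      then have "\<iota> b * (of_nat p ^ s * v) / of_nat p ^ s \<in> L (e * j)"
        by (intro lev_div_p) (simp add: algebra_simps)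
      then have "\<iota> b * v \<in> L (e * j)" using p_nonzero by simp
      then show ?thesis by (rule lev_mono) (use e_pos in simp)
    qed
    have cv: "\<exists>N. \<forall>i\<ge>N. \<iota> (c' - c i) * v \<in> L j" for j
      using c'[of "s + j"] scale by blast
    have "cauchy w"
      unfolding cauchy_def
    proof
      fix j
      obtain N1 where N1: "\<forall>i\<ge>N1. \<iota> (c' - c i) * v \<in> L j" using cv by blast
      obtain N2 where N2: "\<forall>i\<ge>N2. a (Suc i) - a i \<in> L j" using a(2) unfolding cauchy_def by blast
      have "w (Suc i) - w i \<in> L j" if "i \<ge> max N1 N2" for i
      proof -
        have "w (Suc i) - w i = (a (Suc i) - a i) + (\<iota> (c' - c (Suc i)) * v - \<iota> (c' - c i) * v)"
          by (simp add: cw hom.hom_minus algebra_simps)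
        also have "\<dots> \<in> L j"
          using N1[rule_format, of i] N1[rule_format, of "Suc i"] N2[rule_format, of i] that
          by (intro lev_add[OF _ lev_diff]) auto
        finally show ?thesis .
      qed
      then show "\<exists>N. \<forall>i\<ge>N. w (Suc i) - w i \<in> L j" by blast
    qed
    then obtain x where x: "x \<in> E" "converges w x" using Ecomp cw(1) by blast
    have "converges a (\<iota> c' * v + x)"
      unfolding converges_def
    proof
      fix j
      obtain N1 where N1: "\<forall>i\<ge>N1. \<iota> (c' - c i) * v \<in> L j" using cv by blast
      obtain N2 where N2: "\<forall>i\<ge>N2. x - w i \<in> L j" using x(2) unfolding converges_def by blast
      have "\<iota> c' * v + x - a i \<in> L j" if "i \<ge> max N1 N2" for i
      proof -
        have "\<iota> c' * v + x - a i = \<iota> (c' - c i) * v + (x - w i)"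
          by (simp add: cw hom.hom_minus algebra_simps)
        also have "\<dots> \<in> L j" using N1 N2 that by (intro lev_add) auto
        finally show ?thesis .
      qed
      then show "\<exists>N. \<forall>i\<ge>N. \<iota> c' * v + x - a i \<in> L j" by blast
    qed
    then show ?thesis using mem x(1) by blast
  qed
  moreover have "0 \<in> E'" unfolding mem using E0 by (intro exI[of _ 0] bexI[of _ 0]) (auto simp: hom.hom_zero)
  moreover have "x + y \<in> E'" if xy: "x \<in> E'" "y \<in> E'" for x y
  proof -
    obtain c w c' w' where "w \<in> E" "w' \<in> E" "x = \<iota> c * v + w" "y = \<iota> c' * v + w'" using xy mem by blast
    then show ?thesis unfolding mem
      by (intro exI[of _ "c + c'"] bexI[of _ "w + w'"]) (auto simp: hom.hom_add algebra_simps Eadd)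
  qed
  moreover have "\<iota> b * x \<in> E'" if x: "x \<in> E'" for x b
  proof -
    obtain c w where "w \<in> E" "x = \<iota> c * v + w" using x mem by blast
    then show ?thesis unfolding mem
      by (intro exI[of _ "b * c"] bexI[of _ "\<iota> b * w"]) (auto simp: hom.hom_mult distrib_left mult.assoc Escale)
  qed
  ultimately show ?case unfolding E'_def by blast
qed
qed

lemma complete:
  assumes a: "\<And>i. a (Suc i) - a i \<in> L i"
  shows "\<exists>x. \<forall>i. x - a i \<in> L i"
proof -
  have tail: "a k - a i \<in> L i" if "i \<le> k" for i k
    using that
  proof (induction k rule: dec_induct)
    case (step k)
    then show ?case using lev_add[OF lev_mono[OF a[of k] step(1)] step(3)] by simp
  qed simp
  have "cauchy a" unfolding cauchy_def using lev_mono[OF a] by blast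
  then obtain x where x: "converges a x"
    using converges_in_dimension[OF dimension_UNIV refl] by blast
  have "x - a i \<in> L i" for i
  proof -
    obtain N where "\<forall>k\<ge>N. x - a k \<in> L i" using x unfolding converges_def by blast
    then show ?thesis using lev_add[of "x - a (max N i)" i "a (max N i) - a i"] tail by simp
  qed
  then show ?thesis by blast
qed

lemma d_pos: "d \<noteq> 0"
proof
  interpret r: field "sub_ring (UNIV :: 'k set)" by (rule field_sub_ring_UNIV)
  assume "d = 0"
  then have "r.dimension 0 (range \<iota>) UNIV" using dimension_UNIV by simp
  then have "UNIV = {0 :: 'k}" by (cases rule: r.dimension.cases) auto
  then show False by (metis UNIV_I singletonD zero_neq_one)
qed

end

section \<open>Units and residue field of the ring of integers\<close>

context padic_extension
begin

lemma L1_proper: "1 \<notin> L 1"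
proof
  assume "1 \<in> L 1"
  then have "inverse \<pi> \<in> R" by (simp add: lev_def divide_inverse)
  then have "inverse \<pi> ^ e * (\<pi> ^ e / of_nat p) \<in> R" using p_lev' by (intro mult_closed power_closed)
  moreover have "inverse \<pi> ^ e * (\<pi> ^ e / of_nat p) = inverse (of_nat p)"
    by (simp add: divide_inverse flip: mult.assoc power_mult_distrib)
  ultimately show False using inverse_p_notin by simp
qed

text \<open>The inverse of \<open>1 - z\<close> is a geometric series.\<close>

lemma inverse_one_minus:
  assumes z: "z \<in> L 1"
  shows "inverse (1 - z) \<in> R"
proof -
  have zi: "z ^ i \<in> L i" for i
  proof (induction i)
    case (Suc i)
    then show ?case using lev_mult[OF z Suc] by simp
  qed simp
  define s where "s i = (\<Sum>k<i. z ^ k)" for i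
  have "s (Suc i) - s i \<in> L i" for i by (simp add: s_def zi)
  then obtain g where g: "\<And>i. g - s i \<in> L i" using complete by blast
  have gR: "g \<in> R" using g[of 0] by (simp add: s_def)
  have zR: "1 - z \<in> R" using lev_R[OF z] by simp
  have "1 - g * (1 - z) = 0"
  proof (rule separated)
    fix i
    have "s i * (1 - z) = 1 - z ^ i" by (simp add: s_def one_diff_power_eq mult.commute)
    then have "1 - g * (1 - z) = z ^ i - (g - s i) * (1 - z)" by (simp add: algebra_simps)
    then show "1 - g * (1 - z) \<in> L i" using lev_diff[OF zi lev_multR[OF g zR]] by simp
  qed
  then have "(1 - z) * g = 1" by (simp add: mult.commute)
  then show ?thesis using gR inverse_unique[of "1 - z" g] by simp
qed

text \<open>For \<open>x\<close> outside \<open>L 1\<close>, maximality yields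
  \<open>r * x = 1 - l\<close> with \<open>l\<close> in \<open>L 1\<close>. By completeness
  \<open>1 - l\<close> is invertible in \<open>R\<close>, and then so is \<open>x\<close>.\<close>

lemma local_ring:
  assumes x: "x \<in> R" "inverse x \<notin> R"
  shows "x \<in> L 1"
proof (rule ccontr)
  assume nx: "x \<notin> L 1"
  interpret M: maximalideal "L 1" "sub_ring R" using max_ideal PIdl_pi by simp
  interpret C: cring "sub_ring R" by (rule cring_R)
  define J where "J = L 1 <+>\<^bsub>sub_ring R\<^esub> PIdl\<^bsub>sub_ring R\<^esub> x"
  have J: "J = {l + r * x | l r. l \<in> L 1 \<and> r \<in> R}"
    by (auto simp: J_def set_add_def' PIdl_eq)
  have "ideal J (sub_ring R)"
    unfolding J_def using M.add_ideals[OF M.is_ideal C.cgenideal_ideal[of x]] x by simp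
  moreover have "L 1 \<subseteq> J" unfolding J using zero_closed by force
  moreover have "J \<subseteq> carrier (sub_ring R)" unfolding J using x lev_R by auto
  ultimately have "J = L 1 \<or> J = R" using M.I_maximal[of J] by simp
  moreover have "0 + 1 * x \<in> J" unfolding J using lev_zero one_closed by blast
  ultimately have "1 \<in> J" using nx one_closed by auto
  then obtain l r where lr: "l \<in> L 1" "r \<in> R" "1 = l + r * x" unfolding J by blast
  have "r * x = 1 - l" using lr(3) by (metis add_diff_cancel_left')
  then have "inverse r * inverse x = inverse (1 - l)" by (metis inverse_mult_distrib)
  moreover have "r \<noteq> 0" using lr L1_proper by auto
  ultimately have "inverse x = r * inverse (1 - l)" by (simp flip: \<open>inverse r * inverse x = inverse (1 - l)\<close>)
  then show False using x(2) inverse_one_minus[OF lr(1)] lr(2) by simp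
qed

lemma residue_cosets:
  assumes "a \<in> R" "b \<in> R"
  shows "L 1 +>\<^bsub>sub_ring R\<^esub> a = L 1 +>\<^bsub>sub_ring R\<^esub> b \<longleftrightarrow> a - b \<in> L 1"
proof -
  have mem: "x \<in> L 1 +>\<^bsub>sub_ring R\<^esub> c \<longleftrightarrow> x - c \<in> L 1" for x c
    by (force simp: a_r_coset_def')
  show ?thesis
  proof
    assume "L 1 +>\<^bsub>sub_ring R\<^esub> a = L 1 +>\<^bsub>sub_ring R\<^esub> b"
    then show "a - b \<in> L 1" using mem[of a a] mem[of a b] by simp
  next
    assume ab: "a - b \<in> L 1"
    then have "x - a \<in> L 1 \<longleftrightarrow> x - b \<in> L 1" for x
      using lev_add[of "x - a" 1 "a - b"] lev_diff[of "x - b" 1 "a - b"] by auto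
    then show "L 1 +>\<^bsub>sub_ring R\<^esub> a = L 1 +>\<^bsub>sub_ring R\<^esub> b" using mem by blast
  qed
qed

text \<open>The image \<open>F\<close> of the \<open>p\<close>-adic integers is a field with exactly
  \<open>p\<close> elements, represented by the natural numbers below \<open>p\<close>. Each step of
  the inductive definition of dimension then multiplies the cardinality by \<open>p\<close>.\<close>

lemma residue_card: "finite (carrier (residue_field R \<pi>)) \<and> card (carrier (residue_field R \<pi>)) = p ^ f"
proof -
  interpret M: maximalideal "L 1" "sub_ring R" using max_ideal PIdl_pi by simp
  interpret C: cring "sub_ring R" by (rule cring_R)
  define Q where "Q = residue_field R \<pi>"
  have Qd: "Q = sub_ring R Quot L 1" unfolding Q_def residue_field_def PIdl_pi ..
  interpret Q: field Q unfolding Qd using M.quotient_is_field[OF cring_R] .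
  define h where "h = (+>\<^bsub>sub_ring R\<^esub>) (L 1)"
  interpret h: ring_hom_ring "sub_ring R" Q h
    unfolding Qd h_def by (rule M.rcos_ring_hom_ring)
  define F where "F = h ` \<iota> ` padic_integers av"
  have dim: "Q.dimension f F (carrier Q)"
    using inert unfolding inertia_degree_def PIdl_pi Q_def F_def h_def .
  have pL: "of_nat p \<in> L 1" using lev_mono[OF p_lev] e_pos by simp
  have Fi: "F = (\<lambda>i. h (of_nat i)) ` {..<p}"
  proof
    show "F \<subseteq> (\<lambda>i. h (of_nat i)) ` {..<p}"
    proof
      fix x assume "x \<in> F"
      then obtain a where a: "av a \<le> 1" "x = h (\<iota> a)" by (auto simp: F_def padic_integers_def)
      obtain i where i: "i < p" "av (a - of_nat i) \<le> 1 / real p ^ 1" using residue_nat[OF a(1)] by auto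
      have "\<iota> (a - of_nat i) \<in> L 1" using lev_mono[OF iota_lev[OF i(2)]] e_pos by simp
      then have "h (\<iota> a) = h (of_nat i)"
        unfolding h_def using residue_cosets iota_closed[OF a(1)]
        by (simp add: hom.hom_minus hom.hom_of_nat)
      then show "x \<in> (\<lambda>i. h (of_nat i)) ` {..<p}" using a i by auto
    qed
    show "(\<lambda>i. h (of_nat i)) ` {..<p} \<subseteq> F"
    proof
      fix x assume "x \<in> (\<lambda>i. h (of_nat i)) ` {..<p}"
      then obtain i where "x = h (of_nat i)" by auto
      then have "x = h (\<iota> (of_nat i))" by (simp add: hom.hom_of_nat)
      then show "x \<in> F" using av_of_nat_le by (auto simp: F_def padic_integers_def)
    qed
  qed
  \<comment> \<open>A Bezout relation between \<open>k\<close> and \<open>p\<close> would place 1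
    into the maximal ideal. This keeps the residues of the numbers below \<open>p\<close>
    distinct.\<close>
  have unit: False if "0 < k" "k < p" "of_nat k \<in> L 1" for k
  proof -
    have "coprime (int k) (int p)"
      using prime that by (metis coprime_commute coprime_int_iff nat_dvd_not_less prime_imp_coprime)
    then obtain u v where "u * int k + v * int p = 1" using bezout_int[of "int k" "int p"] by auto
    then have "of_int u * of_int (int k) + of_int v * of_int (int p) = (1 :: 'k)"
      by (metis of_int_1 of_int_add of_int_mult)
    then have "of_int u * of_nat k + of_int v * of_nat p = (1 :: 'k)" by simp
    moreover have "of_int u * of_nat k + of_int v * of_nat p \<in> L 1"
      using that pL by (intro lev_add lev_multL) auto
    ultimately show False using L1_proper by simp
  qed
  have cardF: "card F = p" and finF: "finite F"
  proof -
    have *: "i = j" if "i < p" "j < p" "i \<le> j" "h (of_nat i) = h (of_nat j)" for i j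
    proof (rule ccontr)
      assume "i \<noteq> j"
      have "h (of_nat j) = h (of_nat i)" using that by simp
      then have "of_nat j - of_nat i \<in> L 1" unfolding h_def using residue_cosets by auto
      then have "of_nat (j - i) \<in> L 1" using that by simp
      then show False by (rule unit[rotated 2]) (use that \<open>i \<noteq> j\<close> in auto)
    qed
    have "inj_on (\<lambda>i. h (of_nat i)) {..<p}"
      by (rule inj_onI) (metis * lessThan_iff nat_le_linear)
    then show "card F = p" unfolding Fi by (simp add: card_image)
    show "finite F" unfolding Fi by simp
  qed
  have "subring (\<iota> ` padic_integers av) (sub_ring R)"
  proof (rule M.subringI)
    show "\<iota> ` padic_integers av \<subseteq> carrier (sub_ring R)" by (auto simp: padic_integers_def iota_closed)
    show "\<one>\<^bsub>sub_ring R\<^esub> \<in> \<iota> ` padic_integers av"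
      using padic_integers_closed(1) hom.hom_one by force
    have minus: "\<ominus>\<^bsub>sub_ring R\<^esub> x = - x" if "x \<in> R" for x
      using M.minus_equality[of "- x" x] that by simp
    show "\<ominus>\<^bsub>sub_ring R\<^esub> x \<in> \<iota> ` padic_integers av" if "x \<in> \<iota> ` padic_integers av" for x
      using that padic_integers_closed(4)
      by (auto simp: minus iota_closed padic_integers_def hom.hom_uminus[symmetric])
    show "x \<otimes>\<^bsub>sub_ring R\<^esub> y \<in> \<iota> ` padic_integers av" "x \<oplus>\<^bsub>sub_ring R\<^esub> y \<in> \<iota> ` padic_integers av"
      if "x \<in> \<iota> ` padic_integers av" "y \<in> \<iota> ` padic_integers av" for x y
      using that padic_integers_closed(2,3) by (auto simp: hom.hom_mult[symmetric] hom.hom_add[symmetric])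
  qed
  then have subringF: "subring F Q" unfolding F_def by (rule h.img_is_subring)
  have FQ: "F \<subseteq> carrier Q" using subringE(1)[OF subringF] .
  \<comment> \<open>A finite subring of a field is a field: multiplication by a nonzero element is
    injective on \<open>F\<close>, hence surjective, and so reaches 1.\<close>
  have subfieldF: "subfield F Q"
  proof (rule Q.subfieldI'[OF subringF])
    fix k assume k: "k \<in> F - {\<zero>\<^bsub>Q\<^esub>}"
    then have kc: "k \<in> carrier Q" using FQ by auto
    have "inj_on (\<lambda>x. k \<otimes>\<^bsub>Q\<^esub> x) F"
    proof (rule inj_onI)
      fix x y assume "x \<in> F" "y \<in> F" "k \<otimes>\<^bsub>Q\<^esub> x = k \<otimes>\<^bsub>Q\<^esub> y"
      then show "x = y" using Q.m_lcancel[of k x y] k kc FQ by auto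
    qed
    moreover have "(\<lambda>x. k \<otimes>\<^bsub>Q\<^esub> x) ` F \<subseteq> F" using k subringE(6)[OF subringF] by auto
    ultimately have "(\<lambda>x. k \<otimes>\<^bsub>Q\<^esub> x) ` F = F" using finF by (metis endo_inj_surj)
    then obtain x where x: "x \<in> F" "\<one>\<^bsub>Q\<^esub> = k \<otimes>\<^bsub>Q\<^esub> x" using subringE(3)[OF subringF] by blast
    then have "inv\<^bsub>Q\<^esub> k = x" using Q.comm_inv_char[of k x] kc FQ by auto
    then show "inv\<^bsub>Q\<^esub> k \<in> F" using x by simp
  qed
  have "finite E \<and> card E = p ^ n" if "Q.dimension n K E" "K = F" for n K E
    using that
  proof (induction rule: Q.dimension.induct)
    case (Suc_dim v E n K)
    have E: "finite E" "card E = p ^ n" using Suc_dim by auto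
    have "Q.finite_dimension F E" unfolding Q.finite_dimension_def using Suc_dim by blast
    then have sub: "subalgebra F E Q" by (rule Q.finite_dimension_imp_subalgebra[OF subfieldF])
    have Esub: "subgroup E (add_monoid Q)" and Escale: "\<And>k v. k \<in> F \<Longrightarrow> v \<in> E \<Longrightarrow> k \<otimes>\<^bsub>Q\<^esub> v \<in> E"
      using sub unfolding subalgebra_def subalgebra_axioms_def by auto
    have EQ: "E \<subseteq> carrier Q" using Q.subalgebra_in_carrier[OF sub] .
    have eq: "Q.line_extension K v E = (\<lambda>(k, w). k \<otimes>\<^bsub>Q\<^esub> v \<oplus>\<^bsub>Q\<^esub> w) ` (F \<times> E)"
      unfolding set_eq_iff Q.line_extension_mem_iff Suc_dim(5) by force
    have "inj_on (\<lambda>(k, w). k \<otimes>\<^bsub>Q\<^esub> v \<oplus>\<^bsub>Q\<^esub> w) (F \<times> E)"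
    proof (rule inj_onI, clarify)
      fix k w k' w' assume kF: "k \<in> F" "k' \<in> F" and wE: "w \<in> E" "w' \<in> E"
        and e: "k \<otimes>\<^bsub>Q\<^esub> v \<oplus>\<^bsub>Q\<^esub> w = k' \<otimes>\<^bsub>Q\<^esub> v \<oplus>\<^bsub>Q\<^esub> w'"
      have c: "k \<in> carrier Q" "k' \<in> carrier Q" "w \<in> carrier Q" "w' \<in> carrier Q" "v \<in> carrier Q"
        using kF wE FQ EQ Suc_dim(1) by auto
      have "k = k'"
      proof (rule ccontr)
        assume "k \<noteq> k'"
        define l where "l = k \<ominus>\<^bsub>Q\<^esub> k'"
        have lF: "l \<in> F" unfolding l_def a_minus_def using kF subringE(5,7)[OF subringF] by auto
        have l0: "l \<noteq> \<zero>\<^bsub>Q\<^esub>" using \<open>k \<noteq> k'\<close> c by (simp add: l_def)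
        have "l \<otimes>\<^bsub>Q\<^esub> v = w' \<ominus>\<^bsub>Q\<^esub> w"
        proof -
          have "l \<otimes>\<^bsub>Q\<^esub> v = (k \<otimes>\<^bsub>Q\<^esub> v \<oplus>\<^bsub>Q\<^esub> w) \<ominus>\<^bsub>Q\<^esub> (k' \<otimes>\<^bsub>Q\<^esub> v \<oplus>\<^bsub>Q\<^esub> w)"
            using c by (simp add: l_def) algebra
          also have "\<dots> = w' \<ominus>\<^bsub>Q\<^esub> w" unfolding e using c by algebra
          finally show ?thesis .
        qed
        moreover have "w' \<ominus>\<^bsub>Q\<^esub> w \<in> E"
          unfolding a_minus_def using wE subgroup.m_closed[OF Esub] subgroup.m_inv_closed[OF Esub]
          by (auto simp: a_inv_def)
        ultimately have lv: "l \<otimes>\<^bsub>Q\<^esub> v \<in> E" by simp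
        have invl: "inv\<^bsub>Q\<^esub> l \<in> F" using Q.subfield_m_inv(1)[OF subfieldF] lF l0 by auto
        have "inv\<^bsub>Q\<^esub> l \<otimes>\<^bsub>Q\<^esub> l = \<one>\<^bsub>Q\<^esub>" using Q.subfield_m_inv(3)[OF subfieldF] lF l0 by auto
        then have "v = inv\<^bsub>Q\<^esub> l \<otimes>\<^bsub>Q\<^esub> (l \<otimes>\<^bsub>Q\<^esub> v)"
          using c invl lF FQ Q.m_assoc[of "inv\<^bsub>Q\<^esub> l" l v] by (auto simp: subset_iff)
        then have "v \<in> E" using Escale[OF invl lv] by simp
        then show False using Suc_dim(2) by simp
      qed
      moreover from this e c have "w = w'" using Q.add.l_cancel[of "k \<otimes>\<^bsub>Q\<^esub> v" w w'] by simp
      ultimately show "k = k' \<and> w = w'" by simp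
    qed
    then show ?case unfolding eq using E cardF finF by (simp add: card_image card_cartesian_product)
  qed auto
  from this[OF dim refl] show ?thesis by (simp add: Q_def)
qed

lemma residue:
  "\<exists>T. finite T \<and> card T = p ^ f \<and> T \<subseteq> R \<and> (\<forall>x\<in>R. \<exists>!t. t \<in> T \<and> x - t \<in> L 1)"
proof -
  define h where "h = (+>\<^bsub>sub_ring R\<^esub>) (L 1)"
  have C: "carrier (residue_field R \<pi>) = h ` R"
    unfolding residue_field_def PIdl_pi FactRing_def h_def A_RCOSETS_def' by auto
  define T where "T = inv_into R h ` (h ` R)"
  have hT: "h (inv_into R h c) = c" if "c \<in> h ` R" for c using that by (rule f_inv_into_f)
  have "inj_on (inv_into R h) (h ` R)" by (rule inj_on_inv_into) simp
  then have fT: "finite T" and cT: "card T = p ^ f" using residue_card C by (auto simp: T_def card_image)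
  have TR: "T \<subseteq> R" unfolding T_def by (auto intro: inv_into_into)
  have ex: "\<exists>!t. t \<in> T \<and> x - t \<in> L 1" if x: "x \<in> R" for x
  proof (rule ex1I[of _ "inv_into R h (h x)"])
    have "h x = h (inv_into R h (h x))" using hT x by simp
    then show "inv_into R h (h x) \<in> T \<and> x - inv_into R h (h x) \<in> L 1"
      using residue_cosets[OF x, of "inv_into R h (h x)"] x by (auto simp: T_def h_def inv_into_into)
  next
    fix t assume t: "t \<in> T \<and> x - t \<in> L 1"
    then have "h x = h t" using residue_cosets[OF x] TR by (auto simp: h_def)
    moreover obtain c where "t = inv_into R h c" "c \<in> h ` R" using t by (auto simp: T_def)
    ultimately show "t = inv_into R h (h x)" using hT by simp
  qed
  show ?thesis by (intro exI[of _ T] conjI ballI fT cT TR ex)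
qed

theorem complete_dvr: "complete_dvr R \<pi> p e (p ^ f)"
proof unfold_locales
  show "inverse \<pi> \<notin> R" using L1_proper by (simp add: lev_def divide_inverse)
qed (fact local_ring separated complete prime e_pos p_nonzero p_lev p_lev' residue)+

end

section \<open>Groups with a complete filtration by normal subgroups\<close>

text \<open>The abstract form of an inverse limit of finite groups: the subgroups \<open>F j\<close>
  will be a neighbourhood base of the identity, separatedness gives the Hausdorff property, and
  completeness together with finite index gives compactness.\<close>

locale filtered_group = group G for G (structure) +
  fixes F :: "nat \<Rightarrow> 'a set"
  assumes F_normal: "F j \<lhd> G"
    and F_Suc: "F (Suc j) \<subseteq> F j"
    and F_separated: "(\<And>j. x \<in> F j) \<Longrightarrow> x = \<one>"
    and F_complete: "(\<And>i. a i \<in> carrier G) \<Longrightarrow> (\<And>i. inv (a i) \<otimes> a (Suc i) \<in> F i) \<Longrightarrow>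
      \<exists>x\<in>carrier G. \<forall>i. inv (a i) \<otimes> x \<in> F i"
    and F_finite: "\<exists>Y. finite Y \<and> Y \<subseteq> carrier G \<and> (\<forall>y\<in>carrier G. \<exists>x\<in>Y. inv x \<otimes> y \<in> F j)"
begin

definition nbhd :: "'a \<Rightarrow> nat \<Rightarrow> 'a set" where
  "nbhd x j = {y \<in> carrier G. inv x \<otimes> y \<in> F j}"

definition T :: "'a topology" where
  "T = topology_generated_by {nbhd x j | x j. x \<in> carrier G}"

lemma F_subgroup: "subgroup (F j) G"
  using F_normal normal_imp_subgroup by blast

lemma F_carrier: "x \<in> F j \<Longrightarrow> x \<in> carrier G"
  using subgroup.mem_carrier[OF F_subgroup] .

lemma F_one: "\<one> \<in> F j" and F_mult: "x \<in> F j \<Longrightarrow> y \<in> F j \<Longrightarrow> x \<otimes> y \<in> F j"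
  and F_inv: "x \<in> F j \<Longrightarrow> inv x \<in> F j"
  using F_subgroup subgroup.one_closed subgroup.m_closed subgroup.m_inv_closed by metis+

lemma F_conj: "g \<in> carrier G \<Longrightarrow> x \<in> F j \<Longrightarrow> inv g \<otimes> x \<otimes> g \<in> F j"
  using normal.inv_op_closed1[OF F_normal] by blast

lemma F_mono: "i \<le> j \<Longrightarrow> F j \<subseteq> F i"
  using lift_Suc_antimono_le[of F] F_Suc by blast

lemma cong_sym: "x \<in> carrier G \<Longrightarrow> y \<in> carrier G \<Longrightarrow> inv x \<otimes> y \<in> F j \<Longrightarrow> inv y \<otimes> x \<in> F j"
  using F_inv[of "inv x \<otimes> y" j] by (simp add: inv_mult_group)

lemma cong_trans:
  "x \<in> carrier G \<Longrightarrow> y \<in> carrier G \<Longrightarrow> z \<in> carrier G \<Longrightarrow> inv x \<otimes> y \<in> F j \<Longrightarrow> inv y \<otimes> z \<in> F j \<Longrightarrow>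
    inv x \<otimes> z \<in> F j"
proof -
  assume *: "x \<in> carrier G" "y \<in> carrier G" "z \<in> carrier G" "inv x \<otimes> y \<in> F j" "inv y \<otimes> z \<in> F j"
  have "y \<otimes> (inv y \<otimes> z) = z" using * by (simp flip: m_assoc)
  then have "(inv x \<otimes> y) \<otimes> (inv y \<otimes> z) = inv x \<otimes> z" using * by (simp add: m_assoc)
  then show ?thesis using F_mult[OF *(4,5)] by simp
qed

lemma nbhd_self: "x \<in> carrier G \<Longrightarrow> x \<in> nbhd x j"
  by (simp add: nbhd_def F_one)

lemma nbhd_carrier: "nbhd x j \<subseteq> carrier G"
  by (auto simp: nbhd_def)

lemma nbhd_eq: "x \<in> carrier G \<Longrightarrow> y \<in> nbhd x j \<Longrightarrow> nbhd y j = nbhd x j"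
  unfolding nbhd_def by (auto intro: cong_trans cong_sym)

lemma nbhd_mono: "i \<le> j \<Longrightarrow> nbhd x j \<subseteq> nbhd x i"
  using F_mono by (auto simp: nbhd_def)

text \<open>The generating sets already form a base: \<open>nbhd x j\<close> is the coset of
  \<open>F j\<close> through each of its points, and cosets shrink as \<open>j\<close> grows, so a
  finite intersection contains the coset of the largest index.\<close>

lemma openin_T_iff: "openin T U \<longleftrightarrow> U \<subseteq> carrier G \<and> (\<forall>x\<in>U. \<exists>j. nbhd x j \<subseteq> U)"
proof
  assume "openin T U"
  then have "generate_topology_on {nbhd x j | x j. x \<in> carrier G} U"
    by (simp add: T_def openin_topology_generated_by_iff)
  then show "U \<subseteq> carrier G \<and> (\<forall>x\<in>U. \<exists>j. nbhd x j \<subseteq> U)"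
  proof induction
    case (Int a b)
    have "\<exists>j. nbhd x j \<subseteq> a \<inter> b" if x: "x \<in> a \<inter> b" for x
    proof -
      obtain i j where "nbhd x i \<subseteq> a" "nbhd x j \<subseteq> b" using Int x by blast
      then have "nbhd x (max i j) \<subseteq> a \<inter> b" using nbhd_mono[of i "max i j" x] nbhd_mono[of j "max i j" x] by auto
      then show ?thesis by blast
    qed
    then show ?case using Int by blast
  next
    case (UN K)
    then show ?case by (meson Sup_least UnionE Union_upper order_trans)
  next
    case (Basis s)
    then show ?case using nbhd_eq nbhd_carrier by blast
  qed auto
next
  assume U: "U \<subseteq> carrier G \<and> (\<forall>x\<in>U. \<exists>j. nbhd x j \<subseteq> U)"
  then have "U = \<Union>{nbhd x j | x j. x \<in> U \<and> nbhd x j \<subseteq> U}" using nbhd_self by blast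
  moreover have "openin T (\<Union>{nbhd x j | x j. x \<in> U \<and> nbhd x j \<subseteq> U})"
    unfolding T_def using U
    by (intro openin_Union) (auto intro!: topology_generated_by_Basis)
  ultimately show "openin T U" by simp
qed

lemma openin_nbhdE:
  assumes "openin T U" "x \<in> U"
  obtains j where "nbhd x j \<subseteq> U"
  using assms openin_T_iff[of U] by auto

lemma F_finiteE:
  obtains Y where "finite Y" "Y \<subseteq> carrier G" "\<forall>y\<in>carrier G. \<exists>x\<in>Y. inv x \<otimes> y \<in> F j"
  using F_finite[of j] by auto

lemma topspace_T: "topspace T = carrier G"
proof
  show "topspace T \<subseteq> carrier G" using openin_T_iff openin_topspace by blast
  show "carrier G \<subseteq> topspace T" using nbhd_carrier by (intro openin_subset) (auto simp: openin_T_iff)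
qed

lemma openin_nbhd: "x \<in> carrier G \<Longrightarrow> openin T (nbhd x j)"
  using nbhd_eq nbhd_carrier by (fastforce simp: openin_T_iff)

lemma nbhd_one: "nbhd \<one> j = F j"
  using F_carrier by (auto simp: nbhd_def)

lemma openin_F: "openin T (F j)"
  using openin_nbhd[of \<one> j] by (simp add: nbhd_one)

lemma nbhd_mult:
  assumes "x \<in> carrier G" "y \<in> carrier G" "x' \<in> nbhd x j" "y' \<in> nbhd y j"
  shows "x' \<otimes> y' \<in> nbhd (x \<otimes> y) j"
proof -
  have c: "x' \<in> carrier G" "y' \<in> carrier G" using assms by (auto simp: nbhd_def)
  have a: "inv y \<otimes> (inv x \<otimes> x') \<otimes> y \<in> F j" using assms by (intro F_conj) (auto simp: nbhd_def)
  have b: "inv y \<otimes> y' \<in> F j" using assms by (simp add: nbhd_def)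
  have "inv (x \<otimes> y) \<otimes> (x' \<otimes> y') = (inv y \<otimes> (inv x \<otimes> x') \<otimes> y) \<otimes> (inv y \<otimes> y')"
  proof -
    have "y \<otimes> (inv y \<otimes> y') = y'" using assms c by (simp flip: m_assoc)
    then show ?thesis using assms c by (simp add: m_assoc inv_mult_group)
  qed
  then show ?thesis using F_mult[OF a b] c by (simp add: nbhd_def)
qed

lemma nbhd_inv:
  assumes "x \<in> carrier G" "x' \<in> nbhd x j"
  shows "inv x' \<in> nbhd (inv x) j"
proof -
  have c: "x' \<in> carrier G" using assms by (auto simp: nbhd_def)
  have "inv x' \<otimes> x \<in> F j" using assms cong_sym c by (auto simp: nbhd_def)
  then have "inv (inv x) \<otimes> (inv x' \<otimes> x) \<otimes> inv x \<in> F j" using assms by (intro F_conj) auto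
  then show ?thesis using assms c by (simp add: nbhd_def m_assoc)
qed

lemma topological_group_T: "topological_group G T"
  unfolding topological_group_def
proof (intro conjI is_group topspace_T)
  show "continuous_map (prod_topology T T) T (\<lambda>(x, y). x \<otimes> y)"
    unfolding continuous_map
  proof (intro conjI allI impI)
    fix U assume U: "openin T U"
    show "openin (prod_topology T T) {x \<in> topspace (prod_topology T T). (case x of (x, y) \<Rightarrow> x \<otimes> y) \<in> U}"
      unfolding openin_prod_topology_alt
    proof (intro allI impI)
      fix x y assume "(x, y) \<in> {x \<in> topspace (prod_topology T T). (case x of (x, y) \<Rightarrow> x \<otimes> y) \<in> U}"
      then have xy: "x \<in> carrier G" "y \<in> carrier G" "x \<otimes> y \<in> U" by (auto simp: topspace_T)
      obtain j where "nbhd (x \<otimes> y) j \<subseteq> U" using openin_nbhdE[OF U xy(3)] .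
      then have "nbhd x j \<times> nbhd y j \<subseteq> {x \<in> topspace (prod_topology T T). (case x of (x, y) \<Rightarrow> x \<otimes> y) \<in> U}"
        using nbhd_mult[OF xy(1,2)] nbhd_carrier[THEN subsetD] by (auto simp: topspace_T)
      then show "\<exists>Ua V. openin T Ua \<and> openin T V \<and> x \<in> Ua \<and> y \<in> V \<and>
          Ua \<times> V \<subseteq> {x \<in> topspace (prod_topology T T). (case x of (x, y) \<Rightarrow> x \<otimes> y) \<in> U}"
        by (intro exI[of _ "nbhd x j"] exI[of _ "nbhd y j"] conjI openin_nbhd nbhd_self xy)
    qed
  qed (auto simp: topspace_T)
  show "continuous_map T T (\<lambda>x. inv x)"
    unfolding continuous_map
  proof (intro conjI allI impI)
    fix U assume U: "openin T U"
    have "\<exists>j. nbhd x j \<subseteq> {x \<in> carrier G. inv x \<in> U}" if x: "x \<in> carrier G" "inv x \<in> U" for x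
    proof -
      obtain j where "nbhd (inv x) j \<subseteq> U" using openin_nbhdE[OF U x(2)] .
      then have "nbhd x j \<subseteq> {x \<in> carrier G. inv x \<in> U}"
        using nbhd_inv[OF x(1), of _ j] nbhd_carrier[THEN subsetD] by auto
      then show ?thesis by blast
    qed
    then show "openin T {x \<in> topspace T. inv x \<in> U}" by (auto simp: openin_T_iff topspace_T)
  qed (auto simp: topspace_T)
qed

lemma Hausdorff_T: "Hausdorff_space T"
  unfolding Hausdorff_space_def
proof (intro allI impI)
  fix x y assume "x \<in> topspace T \<and> y \<in> topspace T \<and> x \<noteq> y"
  then have xy: "x \<in> carrier G" "y \<in> carrier G" "x \<noteq> y" by (auto simp: topspace_T)
  have "\<exists>j. inv x \<otimes> y \<notin> F j"
  proof (rule ccontr)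
    assume "\<nexists>j. inv x \<otimes> y \<notin> F j"
    then have "inv x \<otimes> y = \<one>" using F_separated by blast
    then show False using xy by (metis inv_closed inv_equality inv_inv)
  qed
  then obtain j where j: "inv x \<otimes> y \<notin> F j" by blast
  have "disjnt (nbhd x j) (nbhd y j)"
  proof (rule ccontr)
    assume "\<not> ?thesis"
    then obtain z where "z \<in> nbhd x j" "z \<in> nbhd y j" by (auto simp: disjnt_def)
    then have "nbhd x j = nbhd y j" using nbhd_eq xy by metis
    then show False using nbhd_self[OF xy(2)] j by (auto simp: nbhd_def)
  qed
  then show "\<exists>U V. openin T U \<and> openin T V \<and> x \<in> U \<and> y \<in> V \<and> disjnt U V"
    by (intro exI[of _ "nbhd x j"] exI[of _ "nbhd y j"] conjI openin_nbhd nbhd_self xy)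
qed

text \<open>A cover without finite subcover yields a nested sequence of cosets that are not finitely covered;
  their common point lies in a member of the cover, which contains one of them.\<close>

lemma compact_T: "compact_space T"
  unfolding compact_space_alt
proof (intro allI impI, elim conjE)
  fix \<U> assume op: "\<forall>U\<in>\<U>. openin T U" and cov: "topspace T \<subseteq> \<Union>\<U>"
  define bad where "bad C \<longleftrightarrow> \<not> (\<exists>\<F>. finite \<F> \<and> \<F> \<subseteq> \<U> \<and> C \<subseteq> \<Union>\<F>)" for C
  have bad_mono: "bad C'" if "bad C" "C \<subseteq> C'" for C C' :: "'a set"
  proof (rule ccontr)
    assume "\<not> bad C'"
    then obtain \<F> where \<F>: "finite \<F>" "\<F> \<subseteq> \<U>" "C' \<subseteq> \<Union>\<F>" unfolding bad_def by auto
    then have "\<exists>\<F>. finite \<F> \<and> \<F> \<subseteq> \<U> \<and> C \<subseteq> \<Union>\<F>" using that(2) by (intro exI[of _ \<F>]) auto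
    then show False using that(1) by (simp add: bad_def)
  qed
  have bad_Un: "\<exists>x\<in>Y. bad (f x)" if "finite Y" "bad C" and CY: "C \<subseteq> (\<Union>x\<in>Y. f x)" for Y f and C :: "'a set"
  proof (rule ccontr)
    assume "\<not> ?thesis"
    then have "\<forall>x\<in>Y. \<exists>\<F>. finite \<F> \<and> \<F> \<subseteq> \<U> \<and> f x \<subseteq> \<Union>\<F>" by (simp only: bad_def not_not bex_simps)
    from bchoice[OF this] obtain g where
      g: "\<forall>x\<in>Y. finite (g x) \<and> g x \<subseteq> \<U> \<and> f x \<subseteq> \<Union>(g x)" ..
    have "C \<subseteq> \<Union>(\<Union>x\<in>Y. g x)"
    proof
      fix z assume "z \<in> C"
      then obtain x where x: "x \<in> Y" "z \<in> f x" using CY by auto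
      then have "z \<in> \<Union>(g x)" using g by blast
      then show "z \<in> \<Union>(\<Union>x\<in>Y. g x)" using x by auto
    qed
    moreover have "finite (\<Union>x\<in>Y. g x)" using that(1) g by auto
    moreover have "(\<Union>x\<in>Y. g x) \<subseteq> \<U>" using g by auto
    ultimately have "\<exists>\<F>. finite \<F> \<and> \<F> \<subseteq> \<U> \<and> C \<subseteq> \<Union>\<F>" by (intro exI conjI)
    then show False using that(2) by (simp add: bad_def)
  qed
  have step: "\<exists>z. z \<in> carrier G \<and> z \<in> C \<and> bad (nbhd z j)" if C: "bad C" "C \<subseteq> carrier G" for C j
  proof -
    obtain Y where Y: "finite Y" "Y \<subseteq> carrier G" "\<forall>y\<in>carrier G. \<exists>x\<in>Y. inv x \<otimes> y \<in> F j"
      by (rule F_finiteE)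
    have "C \<subseteq> (\<Union>x\<in>Y. C \<inter> nbhd x j)" using Y C(2) by (auto simp: nbhd_def)
    then obtain x where x: "x \<in> Y" "bad (C \<inter> nbhd x j)"
      using bad_Un[OF Y(1) C(1), of "\<lambda>x. C \<inter> nbhd x j"] by auto
    then have "C \<inter> nbhd x j \<noteq> {}" unfolding bad_def by auto
    then obtain z where z: "z \<in> C" "z \<in> nbhd x j" by auto
    have "bad (nbhd x j)" using bad_mono[OF x(2)] by auto
    moreover have "nbhd z j = nbhd x j" using nbhd_eq[OF _ z(2)] Y x by auto
    ultimately show ?thesis using z C(2) by auto
  qed
  show "\<exists>\<F>. finite \<F> \<and> \<F> \<subseteq> \<U> \<and> topspace T \<subseteq> \<Union>\<F>"
  proof (rule ccontr)
    assume "\<not> ?thesis"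
    then have "bad (carrier G)" by (simp add: bad_def topspace_T)
    then have "\<exists>a. \<forall>n. (a n \<in> carrier G \<and> bad (nbhd (a n) n)) \<and> a (Suc n) \<in> nbhd (a n) n"
    proof (intro dependent_nat_choice)
      assume "bad (carrier G)"
      then show "\<exists>x. x \<in> carrier G \<and> bad (nbhd x 0)" using step[of "carrier G" 0] by auto
    next
      fix x n assume "x \<in> carrier G \<and> bad (nbhd x n)"
      then show "\<exists>y. (y \<in> carrier G \<and> bad (nbhd y (Suc n))) \<and> y \<in> nbhd x n"
        using step[OF _ nbhd_carrier, of x n "Suc n"] by auto
    qed
    then obtain a where a: "\<And>n. a n \<in> carrier G" "\<And>n. bad (nbhd (a n) n)" "\<And>n. a (Suc n) \<in> nbhd (a n) n"
      by metis
    then obtain x where x: "x \<in> carrier G" "\<forall>i. inv (a i) \<otimes> x \<in> F i"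
      using F_complete[of a] by (auto simp: nbhd_def)
    then obtain U where U: "U \<in> \<U>" "x \<in> U" using cov topspace_T by blast
    then obtain j where j: "nbhd x j \<subseteq> U" using op openin_nbhdE[of U x] by auto
    have "nbhd (a j) j = nbhd x j" using nbhd_eq[OF a(1)[of j], of x j] x by (auto simp: nbhd_def)
    then have "\<exists>\<F>. finite \<F> \<and> \<F> \<subseteq> \<U> \<and> nbhd (a j) j \<subseteq> \<Union>\<F>" using U j by (intro exI[of _ "{U}"]) auto
    then show False using a(2)[of j] by (simp add: bad_def)
  qed
qed

lemma profinite_T: "profinite_group G T"
  unfolding profinite_group_def
proof (intro conjI topological_group_T compact_T Hausdorff_T allI impI)
  fix U assume "openin T U \<and> \<one> \<in> U"
  then obtain j where "nbhd \<one> j \<subseteq> U" using openin_nbhdE[of U \<one>] by auto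
  then show "\<exists>H. subgroup H G \<and> openin T H \<and> H \<subseteq> U"
    by (intro exI[of _ "F j"]) (simp add: F_subgroup openin_F nbhd_one)
qed

text \<open>An open normal \<open>N\<close> contains some \<open>F j\<close>, so the quotient is
  finite and all its elements have order a power of \<open>p\<close>. By Cauchy's theorem no other
  prime divides its order.\<close>

lemma pro_p_T:
  assumes p: "Factorial_Ring.prime p"
    and pow: "\<And>x j. x \<in> carrier G \<Longrightarrow> \<exists>s. x [^] (p ^ s) \<in> F j"
  shows "pro_p_group p G T"
  unfolding pro_p_group_def
proof (intro conjI profinite_T allI impI)
  fix N assume "N \<lhd> G \<and> openin T N"
  then have N: "N \<lhd> G" and op: "openin T N" by auto
  interpret N: normal N G by (rule N)
  obtain j where j: "F j \<subseteq> N" using openin_nbhdE[OF op N.one_closed] by (auto simp: nbhd_one)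
  interpret Q: group "G Mod N" by (rule N.factorgroup_is_group)
  have carQ: "carrier (G Mod N) = rcosets N" by (simp add: FactGroup_def)
  obtain Y where Y: "finite Y" "Y \<subseteq> carrier G" "\<forall>y\<in>carrier G. \<exists>x\<in>Y. inv x \<otimes> y \<in> F j"
    by (rule F_finiteE)
  have "rcosets N \<subseteq> (\<lambda>x. N #> x) ` Y"
  proof
    fix C assume "C \<in> rcosets N"
    then obtain y where y: "y \<in> carrier G" "C = N #> y" by (auto simp: RCOSETS_def)
    then obtain x where x: "x \<in> Y" "inv x \<otimes> y \<in> F j" using Y by blast
    have xc: "x \<in> carrier G" using x Y by blast
    have "x \<otimes> (inv x \<otimes> y) \<otimes> inv x \<in> N" using x j xc by (intro N.inv_op_closed2) auto
    moreover have "x \<otimes> (inv x \<otimes> y) \<otimes> inv x = y \<otimes> inv x"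
      using xc y by (simp flip: m_assoc)
    ultimately have "y \<in> N #> x" using N.rcos_module xc y by (simp add: is_group)
    then show "C \<in> (\<lambda>x. N #> x) ` Y" using repr_independence[OF _ xc N.subgroup_axioms] x y by auto
  qed
  then have fin: "finite (carrier (G Mod N))" unfolding carQ using Y(1) finite_surj by blast
  have ppow: "\<exists>s. c [^]\<^bsub>G Mod N\<^esub> (p ^ s) = \<one>\<^bsub>G Mod N\<^esub>" if c: "c \<in> carrier (G Mod N)" for c
  proof -
    obtain y where y: "y \<in> carrier G" "c = N #> y" using c by (auto simp: carQ RCOSETS_def)
    obtain s where s: "y [^] (p ^ s) \<in> F j" using pow y by blast
    have "c [^]\<^bsub>G Mod N\<^esub> (n::nat) = N #> (y [^] n)" for n
    proof (induction n)
      case 0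
      then show ?case using N.subset by (simp add: coset_mult_one)
    next
      case (Suc n)
      then show ?case using y by (simp add: N.rcos_sum)
    qed
    then have "c [^]\<^bsub>G Mod N\<^esub> (p ^ s) = N"
      using s j rcos_self coset_join2[OF _ N.subgroup_axioms] y by auto
    then show ?thesis by (auto simp: FactGroup_def)
  qed
  define M where "M = order (G Mod N)"
  have M0: "M > 0" unfolding M_def using fin by (simp add: Q.order_gt_0_iff_finite)
  have "r = p" if r: "Factorial_Ring.prime r" "r dvd M" for r
  proof (rule ccontr)
    assume "r \<noteq> p"
    obtain m where "order (G Mod N) = r ^ 1 * m" using r(2) by (auto simp: M_def elim: dvdE)
    \<comment> \<open>The Sylow theorem with exponent 1 serves as Cauchy's theorem for the prime
      \<open>r\<close>.\<close>
    then obtain H where H: "subgroup H (G Mod N)" "card H = r"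
      using sylow_thm[OF r(1) Q.is_group _ fin] by (metis power_one_right)
    have "card H > 1" using H r(1) prime_gt_1_nat by blast
    then obtain h where h: "h \<in> H" "h \<noteq> \<one>\<^bsub>G Mod N\<^esub>"
      by (metis One_nat_def card.empty card.insert empty_iff finite.emptyI insert_absorb is_singletonI'
          is_singleton_def less_not_refl less_numeral_extra(4) not_one_less_zero card_1_singleton_iff)
    have hc: "h \<in> carrier (G Mod N)" using H h subgroup.mem_carrier by metis
    interpret S: group "(G Mod N)\<lparr>carrier := H\<rparr>" using Q.subgroup_imp_group[OF H(1)] .
    have "h [^]\<^bsub>(G Mod N)\<lparr>carrier := H\<rparr>\<^esub> order ((G Mod N)\<lparr>carrier := H\<rparr>) = \<one>\<^bsub>G Mod N\<^esub>"
      using S.pow_order_eq_1[of h] h by simp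
    then have hr: "h [^]\<^bsub>G Mod N\<^esub> r = \<one>\<^bsub>G Mod N\<^esub>"
      using Q.nat_pow_consistent[of h r H] H(2) by (simp add: order_def)
    obtain s where hp: "h [^]\<^bsub>G Mod N\<^esub> (p ^ s) = \<one>\<^bsub>G Mod N\<^esub>" using ppow[OF hc] by blast
    have "Q.ord h dvd r" "Q.ord h dvd p ^ s" using hr hp hc Q.pow_eq_id by auto
    moreover have "coprime r (p ^ s)" using r(1) p \<open>r \<noteq> p\<close> by (simp add: primes_coprime)
    ultimately have "Q.ord h = 1" by (metis coprime_common_divisor nat_dvd_1_iff_1)
    then show False using h hc Q.ord_eq_1 by blast
  qed
  then have "\<exists>i. M = p ^ i"
  proof -
    obtain m where m: "M = p ^ multiplicity p M * m" "\<not> p dvd m"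
      using multiplicity_decompose'[of M p] M0 p by (metis not_prime_unit neq0_conv)
    have "m = 1"
    proof (rule ccontr)
      assume "m \<noteq> 1"
      then obtain r where "Factorial_Ring.prime r" "r dvd m" using prime_factor_nat by blast
      then show False using \<open>\<And>r. Factorial_Ring.prime r \<Longrightarrow> r dvd M \<Longrightarrow> r = p\<close> m by (metis dvd_mult)
    qed
    then show ?thesis using m by auto
  qed
  then show "\<exists>i. card (rcosets N) = p ^ i" by (simp add: M_def order_def carQ)
qed

end

text \<open>The number \<open>l s\<close> is the level at which the \<open>p ^ s\<close>-th powers
  live: \<open>power_F\<close> and \<open>root_F\<close> together say that \<open>F (l s)\<close> is
  the set of these powers. For matrices, a \<open>p\<close>-th power raises the level by
  \<open>e\<close>, so \<open>l s\<close> will be \<open>m + s * e\<close>.\<close>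

locale uniform_filtration = filtered_group +
  fixes p :: nat and l :: "nat \<Rightarrow> nat"
  assumes prime: "Factorial_Ring.prime p" and p_odd: "p \<noteq> 2"
    and l_ge: "s \<le> l s"
    and power_F: "x \<in> carrier G \<Longrightarrow> x [^] (p ^ s) \<in> F (l s)"
    and root_F: "x \<in> F (l s) \<Longrightarrow> \<exists>y\<in>carrier G. y [^] (p ^ s) = x"
    and power_cong: "x \<in> carrier G \<Longrightarrow> y \<in> carrier G \<Longrightarrow> inv x \<otimes> y \<in> F (l 1) \<Longrightarrow>
      inv (x [^] (p ^ s)) \<otimes> y [^] (p ^ s) \<in> F (l (Suc s))"
    and commutator_F: "x \<in> carrier G \<Longrightarrow> y \<in> carrier G \<Longrightarrow> x \<otimes> y \<otimes> inv x \<otimes> inv y \<in> F (l 1)"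
    and torsion_free: "x \<in> carrier G \<Longrightarrow> 0 < i \<Longrightarrow> x [^] (i :: nat) = \<one> \<Longrightarrow> x = \<one>"
begin

text \<open>Representatives modulo \<open>F (l 1)\<close> generate a dense subgroup by successive
  approximation. The error left by \<open>h\<close> is a \<open>p ^ Suc s\<close>-th power; its root
  is approximated by some \<open>g\<close> in \<open>Y\<close>, and by \<open>power_cong\<close> the
  corresponding power of \<open>g\<close> corrects \<open>h\<close> by one more step.\<close>

lemma finitely_generated: "topologically_fg G T"
proof -
  obtain Y where Y: "finite Y" "Y \<subseteq> carrier G" "\<forall>y\<in>carrier G. \<exists>x\<in>Y. inv x \<otimes> y \<in> F (l 1)"
    by (rule F_finiteE)
  have gen: "h \<in> generate G Y \<Longrightarrow> h \<in> carrier G" for h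
    using generate_in_carrier[OF Y(2)] .
  have approx: "\<exists>h\<in>generate G Y. inv h \<otimes> x \<in> F (l (Suc s))" if "x \<in> carrier G" for x s
    using that
  proof (induction s arbitrary: x)
    case 0
    then show ?case using Y(3) generate.incl[of _ Y G] by auto
  next
    case (Suc s)
    then obtain h where h: "h \<in> generate G Y" "inv h \<otimes> x \<in> F (l (Suc s))" by blast
    then obtain y where y: "y \<in> carrier G" "y [^] (p ^ Suc s) = inv h \<otimes> x" using root_F by blast
    obtain g where g: "g \<in> Y" "inv g \<otimes> y \<in> F (l 1)" using Y(3) y by blast
    have gc: "g \<in> carrier G" using g Y by blast
    define g' where "g' = g [^] (p ^ Suc s)"
    have g': "g' \<in> generate G Y"
      using generate_is_subgroup[OF Y(2)] generate.incl[OF g(1), of G]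
      unfolding g'_def by (metis group.int_pow_closed int_pow_int subgroup_int_pow_closed group_axioms)
    have "inv g' \<otimes> (inv h \<otimes> x) \<in> F (l (Suc (Suc s)))"
      using power_cong[OF gc y(1) g(2), of "Suc s"] unfolding g'_def y(2) .
    then have "inv (h \<otimes> g') \<otimes> x \<in> F (l (Suc (Suc s)))"
      using gen[OF h(1)] gen[OF g'] Suc.prems by (simp add: inv_mult_group m_assoc)
    moreover have "h \<otimes> g' \<in> generate G Y" using h(1) g' by (rule generate.eng)
    ultimately show ?case by blast
  qed
  have "x \<in> T closure_of (generate G Y)" if x: "x \<in> carrier G" for x
    unfolding in_closure_of
  proof (intro conjI allI impI)
    fix U assume "x \<in> U \<and> openin T U"
    then obtain j where j: "nbhd x j \<subseteq> U" using openin_T_iff by blast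
    obtain h where h: "h \<in> generate G Y" "inv h \<otimes> x \<in> F (l (Suc j))" using approx[OF x] by blast
    have "inv h \<otimes> x \<in> F j" using h(2) F_mono[of j "l (Suc j)"] l_ge[of "Suc j"] by auto
    then have "h \<in> nbhd x j" using gen[OF h(1)] x cong_sym by (auto simp: nbhd_def)
    then show "\<exists>y. y \<in> generate G Y \<and> y \<in> U" using h j by blast
  qed (simp add: topspace_T x)
  moreover have "T closure_of (generate G Y) \<subseteq> carrier G"
    using closure_of_subset_topspace topspace_T by metis
  ultimately show ?thesis unfolding topologically_fg_def using Y by blast
qed

text \<open>Commutators lie in \<open>F (l 1)\<close>, and every element of \<open>F (l 1)\<close>
  is itself a \<open>p\<close>-th power by \<open>root_F\<close>.\<close>

lemma powerful: "powerful p G T"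
proof -
  define P where "P = {x [^] (if p = 2 then 4 else p) | x. x \<in> carrier G}"
  have "derived G (carrier G) \<subseteq> F (l 1)"
    unfolding derived_def
    by (rule generate_subgroup_incl[OF _ F_subgroup]) (use commutator_F in auto)
  also have "F (l 1) \<subseteq> P"
    using root_F[of _ 1] p_odd by (fastforce simp: P_def)
  also have "P \<subseteq> generate G P" by (auto intro: generate.incl)
  also have "generate G P \<subseteq> T closure_of (generate G P)"
    unfolding closure_of_subset_eq[symmetric]
  proof (rule closure_of_subset)
    have "P \<subseteq> carrier G" by (auto simp: P_def)
    then show "generate G P \<subseteq> topspace T" using generate_in_carrier topspace_T by blast
  qed
  finally show ?thesis unfolding powerful_def P_def .
qed

theorem uniform: "uniform_pro_p_group p G T"
  unfolding uniform_pro_p_group_def torsion_free_def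
proof (intro conjI finitely_generated powerful ballI allI impI)
  have "\<exists>s. x [^] (p ^ s) \<in> F j" if "x \<in> carrier G" for x j
    using power_F[OF that, of j] F_mono[OF l_ge[of j]] by blast
  then show "pro_p_group p G T" by (rule pro_p_T[OF prime])
qed (use torsion_free in blast)

end

section \<open>Matrices congruent to the identity\<close>

lemma index_mult_sum:
  "A \<in> carrier_mat n n \<Longrightarrow> B \<in> carrier_mat n n \<Longrightarrow> i < n \<Longrightarrow> j < n \<Longrightarrow>
    (A * B) $$ (i, j) = (\<Sum>k<n. A $$ (i, k) * B $$ (k, j))"
  by (auto simp: scalar_prod_def lessThan_atLeast0 intro!: sum.cong)

text \<open>Pascal's rule for an arbitrary sequence, because \<open>x k\<close> will be an entry of
  the \<open>k\<close>-th power of a matrix and is not itself a power.\<close>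

lemma sum_binomial_Suc:
  fixes x :: "nat \<Rightarrow> 'a::comm_ring_1"
  shows "(\<Sum>k\<le>Suc N. of_nat (Suc N choose k) * x k) =
    (\<Sum>k\<le>N. of_nat (N choose k) * x k) + (\<Sum>k\<le>N. of_nat (N choose k) * x (Suc k))"
proof -
  have "(\<Sum>k\<le>N. of_nat (N choose k) * x k) = (\<Sum>k\<le>Suc N. of_nat (N choose k) * x k)"
    by (simp add: binomial_eq_0)
  also have "\<dots> = x 0 + (\<Sum>k\<le>N. of_nat (N choose Suc k) * x (Suc k))"
    by (subst sum.atMost_Suc_shift) simp
  finally have 1: "(\<Sum>k\<le>N. of_nat (N choose k) * x k) = x 0 + (\<Sum>k\<le>N. of_nat (N choose Suc k) * x (Suc k))" .
  have "(\<Sum>k\<le>Suc N. of_nat (Suc N choose k) * x k) = x 0 + (\<Sum>k\<le>N. of_nat (Suc N choose Suc k) * x (Suc k))"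
    by (subst sum.atMost_Suc_shift) simp
  also have "\<dots> = x 0 + ((\<Sum>k\<le>N. of_nat (N choose k) * x (Suc k)) + (\<Sum>k\<le>N. of_nat (N choose Suc k) * x (Suc k)))"
    by (simp add: distrib_right sum.distrib)
  finally show ?thesis unfolding 1 by (simp add: algebra_simps)
qed

lemma one_plus_pow_mat:
  assumes A: "(A :: 'a::comm_ring_1 mat) \<in> carrier_mat n n" and "i < n" "j < n"
  shows "((1\<^sub>m n + A) ^\<^sub>m N) $$ (i, j) = (\<Sum>k\<le>N. of_nat (N choose k) * (A ^\<^sub>m k) $$ (i, j))"
  using assms(2,3)
proof (induction N arbitrary: i j)
  case 0
  then show ?case using A by simp
next
  case (Suc N)
  define U where "U = (1\<^sub>m n + A) ^\<^sub>m N"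
  have U: "U \<in> carrier_mat n n" unfolding U_def using A by (intro pow_carrier_mat) auto
  have "U * (1\<^sub>m n + A) = U + U * A"
    using mult_add_distrib_mat[OF U _ A, of "1\<^sub>m n"] U by simp
  then have "((1\<^sub>m n + A) ^\<^sub>m Suc N) $$ (i, j) = U $$ (i, j) + (U * A) $$ (i, j)"
    using Suc.prems U A by (simp add: U_def[symmetric])
  also have "(U * A) $$ (i, j) = (\<Sum>l<n. (\<Sum>k\<le>N. of_nat (N choose k) * (A ^\<^sub>m k) $$ (i, l)) * A $$ (l, j))"
    using Suc.prems by (subst index_mult_sum[OF U A]) (auto simp: U_def Suc.IH)
  also have "\<dots> = (\<Sum>k\<le>N. of_nat (N choose k) * (\<Sum>l<n. (A ^\<^sub>m k) $$ (i, l) * A $$ (l, j)))"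
    unfolding sum_distrib_left sum_distrib_right by (subst sum.swap) (simp add: mult.assoc)
  also have "\<dots> = (\<Sum>k\<le>N. of_nat (N choose k) * (A ^\<^sub>m Suc k) $$ (i, j))"
    using Suc.prems A index_mult_sum[OF pow_carrier_mat[OF A] A] by simp
  finally show ?case
    unfolding sum_binomial_Suc U_def Suc.IH[OF Suc.prems] .
qed

locale dvr_matrices = complete_dvr R \<pi> p e q for R :: "'k::field set" and \<pi> and p e q +
  fixes n m :: nat
  assumes m_ge: "e \<le> m" and p_odd: "p \<noteq> 2"
begin

definition MM :: "nat \<Rightarrow> 'k mat set" where
  "MM j = {A \<in> carrier_mat n n. \<forall>i<n. \<forall>k<n. A $$ (i, k) \<in> L j}"

text \<open>The principal congruence subgroup of level \<open>m\<close> of the general linear group,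
  the common ambient group for all roots and powers.\<close>

definition GG :: "'k mat set" where
  "GG = {x \<in> carrier_mat n n. x - 1\<^sub>m n \<in> MM m}"

lemma m_pos: "1 \<le> m" using m_ge e_pos by simp

lemma p_ge_3: "3 \<le> p"
  using prime_p p_odd prime_ge_2_nat[of p] by auto

lemma MM_carrier: "A \<in> MM j \<Longrightarrow> A \<in> carrier_mat n n" by (simp add: MM_def)

lemma MM_I: "A \<in> carrier_mat n n \<Longrightarrow> (\<And>i k. i < n \<Longrightarrow> k < n \<Longrightarrow> A $$ (i, k) \<in> L j) \<Longrightarrow> A \<in> MM j"
  by (simp add: MM_def)

lemma MM_D: "A \<in> MM j \<Longrightarrow> i < n \<Longrightarrow> k < n \<Longrightarrow> A $$ (i, k) \<in> L j"
  by (simp add: MM_def)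

lemma MM_one: "1\<^sub>m n \<in> MM 0" by (simp add: MM_def)

lemma MM_add: "A \<in> MM j \<Longrightarrow> B \<in> MM j \<Longrightarrow> A + B \<in> MM j"
  by (auto simp: MM_def lev_add)

lemma MM_diff: "A \<in> MM j \<Longrightarrow> B \<in> MM j \<Longrightarrow> A - B \<in> MM j"
  by (auto simp: MM_def lev_diff)

lemma MM_mult: "A \<in> MM i \<Longrightarrow> B \<in> MM j \<Longrightarrow> A * B \<in> MM (i + j)"
proof (rule MM_I)
  assume A: "A \<in> MM i" and B: "B \<in> MM j"
  note c = MM_carrier[OF A] MM_carrier[OF B]
  show "A * B \<in> carrier_mat n n" using c by simp
  show "(A * B) $$ (k, l) \<in> L (i + j)" if "k < n" "l < n" for k l
    unfolding index_mult_sum[OF c that]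
    by (intro lev_sum lev_mult MM_D[OF A] MM_D[OF B]) (use that in auto)
qed

lemma MM_mono: "A \<in> MM j \<Longrightarrow> i \<le> j \<Longrightarrow> A \<in> MM i"
  by (auto simp: MM_def intro: lev_mono)

lemma MM_multR: "A \<in> MM j \<Longrightarrow> B \<in> MM 0 \<Longrightarrow> A * B \<in> MM j"
  using MM_mult[of A j B 0] by simp

lemma MM_multL: "A \<in> MM 0 \<Longrightarrow> B \<in> MM j \<Longrightarrow> A * B \<in> MM j"
  using MM_mult[of A 0 B j] by simp

lemma MM_pow: "A \<in> MM j \<Longrightarrow> A ^\<^sub>m k \<in> MM (k * j)"
proof (induction k)
  case 0
  then show ?case using MM_carrier[of A j] MM_one by auto
next
  case (Suc k)
  then show ?case using MM_mult[of "A ^\<^sub>m k" "k * j" A j] by (simp add: add.commute)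
qed

lemma diff_trans_mat:
  "A \<in> carrier_mat n n \<Longrightarrow> B \<in> carrier_mat n n \<Longrightarrow> C \<in> carrier_mat n n \<Longrightarrow> (A :: 'k mat) - C = (A - B) + (B - C)"
  by (rule eq_matI) auto

lemma MM_cong_trans:
  "A \<in> carrier_mat n n \<Longrightarrow> B \<in> carrier_mat n n \<Longrightarrow> C \<in> carrier_mat n n \<Longrightarrow> A - B \<in> MM j \<Longrightarrow> B - C \<in> MM j \<Longrightarrow>
    A - C \<in> MM j"
  using MM_add[of "A - B" j "B - C"] diff_trans_mat[of A B C] by simp

lemma MM_cong_sym: "A \<in> carrier_mat n n \<Longrightarrow> B \<in> carrier_mat n n \<Longrightarrow> A - B \<in> MM j \<Longrightarrow> B - A \<in> MM j"
  by (simp add: MM_def lev_cong_sym minus_carrier_mat)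

lemma MM_separated: "A = 0\<^sub>m n n" if "\<And>j. A \<in> MM j"
proof (rule eq_matI)
  have A: "A \<in> carrier_mat n n" using that MM_carrier by blast
  then show "dim_row A = dim_row (0\<^sub>m n n :: 'k mat)" "dim_col A = dim_col (0\<^sub>m n n :: 'k mat)" by auto
  fix i k assume "i < dim_row (0\<^sub>m n n :: 'k mat)" "k < dim_col (0\<^sub>m n n :: 'k mat)"
  then show "A $$ (i, k) = 0\<^sub>m n n $$ (i, k)" using separated[of "A $$ (i, k)"] MM_D[OF that] by auto
qed

lemma MM_eqI: "A = B" if "A \<in> carrier_mat n n" "B \<in> carrier_mat n n" "\<And>j. A - B \<in> MM j"
proof -
  have z: "A - B = 0\<^sub>m n n" using MM_separated that(3) by blast
  show ?thesis
  proof (rule eq_matI)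
    fix i k assume "i < dim_row B" "k < dim_col B"
    moreover from this have "(A - B) $$ (i, k) = 0" using z that by auto
    ultimately show "A $$ (i, k) = B $$ (i, k)" using that by auto
  qed (use that in auto)
qed

lemma MM_complete:
  assumes "\<And>i. A i \<in> carrier_mat n n" "\<And>i. A (Suc i) - A i \<in> MM i"
  shows "\<exists>B\<in>carrier_mat n n. \<forall>i. B - A i \<in> MM i"
proof -
  have "\<exists>x. \<forall>i. x - A i $$ (k, l) \<in> L i" if "k < n" "l < n" for k l
  proof (rule complete)
    fix i
    have "(A (Suc i) - A i) $$ (k, l) \<in> L i" using assms(2) that by (rule MM_D)
    then show "A (Suc i) $$ (k, l) - A i $$ (k, l) \<in> L i" using assms(1)[of i] assms(1)[of "Suc i"] that by auto
  qed
  then have "\<forall>k l. \<exists>x. k < n \<longrightarrow> l < n \<longrightarrow> (\<forall>i. x - A i $$ (k, l) \<in> L i)" by blast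
  then obtain b where b: "\<And>k l i. k < n \<Longrightarrow> l < n \<Longrightarrow> b k l - A i $$ (k, l) \<in> L i" by metis
  have "Matrix.mat n n (\<lambda>(k, l). b k l) - A i \<in> MM i" for i
    using b assms(1)[of i] by (intro MM_I) auto
  then show ?thesis by (intro bexI[of _ "Matrix.mat n n (\<lambda>(k, l). b k l)"]) auto
qed

lemma diff_mult_mat:
  assumes "A \<in> carrier_mat n n" "B \<in> carrier_mat n n" "C \<in> carrier_mat n n" "D \<in> carrier_mat n n"
  shows "(A :: 'k mat) * C - B * D = (A - B) * C + B * (C - D)"
proof (rule eq_matI)
  fix i j assume "i < dim_row ((A - B) * C + B * (C - D))" "j < dim_col ((A - B) * C + B * (C - D))"
  then have ij: "i < n" "j < n" using assms by auto
  have "((A - B) * C) $$ (i, j) = (\<Sum>k<n. A $$ (i, k) * C $$ (k, j)) - (\<Sum>k<n. B $$ (i, k) * C $$ (k, j))"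
    using assms ij by (subst index_mult_sum[of _ n]) (auto simp: algebra_simps sum_subtractf intro!: sum.cong)
  moreover have "(B * (C - D)) $$ (i, j) = (\<Sum>k<n. B $$ (i, k) * C $$ (k, j)) - (\<Sum>k<n. B $$ (i, k) * D $$ (k, j))"
    using assms ij by (subst index_mult_sum[of _ n]) (auto simp: algebra_simps sum_subtractf intro!: sum.cong)
  ultimately show "(A * C - B * D) $$ (i, j) = ((A - B) * C + B * (C - D)) $$ (i, j)"
    using assms ij index_mult_sum[of A n C i j] index_mult_sum[of B n D i j]
    by (simp del: index_mult_mat(1))
qed (use assms in auto)

lemma MM_diff_mult:
  assumes "A - B \<in> MM j" "C - D \<in> MM j" "B \<in> MM 0" "C \<in> MM 0" "A \<in> carrier_mat n n" "D \<in> carrier_mat n n"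
  shows "A * C - B * D \<in> MM j"
  unfolding diff_mult_mat[OF assms(5) MM_carrier[OF assms(3)] MM_carrier[OF assms(4)] assms(6)]
  by (intro MM_add MM_multL MM_multR assms)

text \<open>In the telescoping identity each further factor \<open>a\<close> or \<open>b\<close>
  contributes \<open>m\<close> levels, while the single factor \<open>a - b\<close> contributes
  \<open>j\<close>.\<close>

lemma pow_diff:
  assumes a: "a \<in> MM m" and b: "b \<in> MM m" and ab: "a - b \<in> MM j"
  shows "a ^\<^sub>m Suc k - b ^\<^sub>m Suc k \<in> MM (j + k * m)"
proof (induction k)
  case 0
  then show ?case using ab MM_carrier[OF a] MM_carrier[OF b] by simp
next
  case (Suc k)
  note c = MM_carrier[OF a] MM_carrier[OF b]
  have "a ^\<^sub>m Suc k * a - b ^\<^sub>m Suc k * b = (a ^\<^sub>m Suc k - b ^\<^sub>m Suc k) * a + b ^\<^sub>m Suc k * (a - b)"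
    using c by (intro diff_mult_mat) (auto intro!: pow_carrier_mat mult_carrier_mat)
  also have "\<dots> \<in> MM (j + Suc k * m)"
  proof (rule MM_add)
    show "(a ^\<^sub>m Suc k - b ^\<^sub>m Suc k) * a \<in> MM (j + Suc k * m)"
      using MM_mult[OF Suc a] by (simp add: algebra_simps)
    show "b ^\<^sub>m Suc k * (a - b) \<in> MM (j + Suc k * m)"
      using MM_mult[OF MM_pow[OF b, of "Suc k"] ab] by (simp add: algebra_simps)
  qed
  finally show ?case by simp
qed

lemma GG_carrier: "x \<in> GG \<Longrightarrow> x \<in> carrier_mat n n" by (simp add: GG_def)

lemma GG_MM0: "x \<in> GG \<Longrightarrow> x \<in> MM 0"
proof -
  assume x: "x \<in> GG"
  then have "1\<^sub>m n + (x - 1\<^sub>m n) \<in> MM 0" by (intro MM_add MM_one MM_mono[of _ m 0]) (auto simp: GG_def)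
  moreover have "1\<^sub>m n + (x - 1\<^sub>m n) = x" using GG_carrier[OF x] by (intro eq_matI) auto
  ultimately show ?thesis by simp
qed

lemma one_minus_one: "1\<^sub>m n - 1\<^sub>m n \<in> MM j"
  by (auto simp: MM_def)

lemma GG_one: "1\<^sub>m n \<in> GG"
  by (simp add: GG_def one_minus_one)

lemma GG_mult: "x \<in> GG \<Longrightarrow> y \<in> GG \<Longrightarrow> x * y \<in> GG"
  using MM_diff_mult[of x "1\<^sub>m n" m y "1\<^sub>m n"] GG_carrier[of x] GG_carrier[of y] MM_one GG_MM0[of y]
  by (auto simp: GG_def)

text \<open>With \<open>u = 1 + a\<close> and \<open>v = 1 + b\<close>, the difference \<open>u\<^sup>N - v\<^sup>N\<close> is the sum of the
  \<open>(N choose k) (a\<^sup>k - b\<^sup>k)\<close>; no commutation of \<open>a\<close> and \<open>b\<close> is needed.\<close>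

lemma GG_pow_diff_entry:
  assumes u: "u \<in> GG" and v: "v \<in> GG" and uv: "u - v \<in> MM j" and ij: "i < n" "k < n" and N: "N \<ge> 1"
    and c: "\<And>r. 2 \<le> r \<Longrightarrow> r \<le> N \<Longrightarrow> \<exists>s. of_nat (N choose r) \<in> L s \<and> t \<le> s + (j + (r - 1) * m)"
  shows "(u ^\<^sub>m N) $$ (i, k) - (v ^\<^sub>m N) $$ (i, k) - of_nat N * (u $$ (i, k) - v $$ (i, k)) \<in> L t"
proof -
  define a where "a = u - 1\<^sub>m n"
  define b where "b = v - 1\<^sub>m n"
  have ab: "a \<in> MM m" "b \<in> MM m" using u v by (auto simp: a_def b_def GG_def)
  have uc: "u \<in> carrier_mat n n" "v \<in> carrier_mat n n" using u v GG_carrier by auto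
  have ue: "u = 1\<^sub>m n + a" and ve: "v = 1\<^sub>m n + b" using uc by (auto simp: a_def b_def)
  have "a - b = u - v" unfolding a_def b_def using uc by (intro eq_matI) auto
  then have d: "a ^\<^sub>m Suc r - b ^\<^sub>m Suc r \<in> MM (j + r * m)" for r using pow_diff[OF ab] uv by simp
  define x where "x r = (a ^\<^sub>m r) $$ (i, k) - (b ^\<^sub>m r) $$ (i, k)" for r
  have x: "x (Suc r) \<in> L (j + r * m)" for r
    using MM_D[OF d ij, of r] ij MM_carrier[OF ab(1)] MM_carrier[OF ab(2)] by (simp add: x_def)
  have x0: "x 0 = 0" using MM_carrier[OF ab(1)] MM_carrier[OF ab(2)] by (simp add: x_def)
  have x1: "x 1 = u $$ (i, k) - v $$ (i, k)"
    using MM_carrier[OF ab(1)] MM_carrier[OF ab(2)] uc ij by (simp add: x_def a_def b_def)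
  have "(u ^\<^sub>m N) $$ (i, k) - (v ^\<^sub>m N) $$ (i, k) = (\<Sum>r\<le>N. of_nat (N choose r) * x r)"
    unfolding ue ve using ab[THEN MM_carrier] ij
    by (simp add: one_plus_pow_mat x_def right_diff_distrib sum_subtractf)
  also have "{..N} = insert 0 (insert 1 {2..N})" using N by auto
  also have "(\<Sum>r\<in>insert 0 (insert 1 {2..N}). of_nat (N choose r) * x r) =
      of_nat N * x 1 + (\<Sum>r\<in>{2..N}. of_nat (N choose r) * x r)"
    by (simp add: x0)
  finally have "(u ^\<^sub>m N) $$ (i, k) - (v ^\<^sub>m N) $$ (i, k) - of_nat N * (u $$ (i, k) - v $$ (i, k)) =
      (\<Sum>r\<in>{2..N}. of_nat (N choose r) * x r)"
    unfolding x1 by simp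
  also have "\<dots> \<in> L t"
  proof (rule lev_sum)
    fix r assume r: "r \<in> {2..N}"
    then obtain s where s: "of_nat (N choose r) \<in> L s" "t \<le> s + (j + (r - 1) * m)" using c by auto
    have "of_nat (N choose r) * x r \<in> L (s + (j + (r - 1) * m))"
      using lev_mult[OF s(1) x[of "r - 1"]] r by simp
    then show "of_nat (N choose r) * x r \<in> L t" using s(2) by (rule lev_mono)
  qed
  finally show ?thesis .
qed

text \<open>The map \<open>u \<mapsto> u^p\<close> is multiplication by \<open>p\<close> up to
  smaller terms. For \<open>2 \<le> r < p\<close> the binomial coefficient contributes
  \<open>e\<close> and the power difference at least \<open>m\<close> beyond \<open>j\<close>; for
  \<open>r = p\<close> the power difference contributes \<open>(p - 1) * m\<close>, which is at
  least \<open>2 * m\<close> and hence at least \<open>e + m\<close>. This is where \<open>p\<close>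
  odd and \<open>e \<le> m\<close> are used.\<close>

lemma GG_pow_p_diff_entry:
  assumes "u \<in> GG" "v \<in> GG" "u - v \<in> MM j" "i < n" "k < n"
  shows "(u ^\<^sub>m p) $$ (i, k) - (v ^\<^sub>m p) $$ (i, k) - of_nat p * (u $$ (i, k) - v $$ (i, k)) \<in> L (j + e + m)"
proof (rule GG_pow_diff_entry[OF assms])
  show "1 \<le> p" using p_ge_3 by simp
  fix r assume r: "2 \<le> r" "r \<le> p"
  show "\<exists>s. of_nat (p choose r) \<in> L s \<and> j + e + m \<le> s + (j + (r - 1) * m)"
  proof (cases "r = p")
    case True
    have "2 * m \<le> (p - 1) * m" using p_ge_3 by (intro mult_right_mono) auto
    then have "j + e + m \<le> 0 + (j + (p - 1) * m)" using m_ge by linarith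
    then show ?thesis unfolding True by (intro exI[of _ 0]) simp
  next
    case False
    then have "p dvd (p choose r)" using prime_p r by (intro dvd_choose_prime) auto
    then obtain c where "p choose r = p * c" by (elim dvdE)
    then have "of_nat (p choose r) \<in> L e" using lev_multR[OF p_lev, of "of_nat c"] by simp
    moreover have "1 * m \<le> (r - 1) * m" using r by (intro mult_right_mono) auto
    ultimately show ?thesis by (intro exI[of _ e]) auto
  qed
qed

lemma GG_pow_p_cong:
  assumes "u \<in> GG" "v \<in> GG" "u - v \<in> MM j"
  shows "u ^\<^sub>m p - v ^\<^sub>m p \<in> MM (j + e)"
proof (rule MM_I)
  have c: "u \<in> carrier_mat n n" "v \<in> carrier_mat n n" using assms GG_carrier by auto
  show "u ^\<^sub>m p - v ^\<^sub>m p \<in> carrier_mat n n" using c by (auto intro: pow_carrier_mat)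
  fix i k assume ij: "i < n" "k < n"
  have "(u - v) $$ (i, k) \<in> L j" using MM_D[OF assms(3) ij] .
  then have "of_nat p * (u $$ (i, k) - v $$ (i, k)) \<in> L (e + j)"
    using lev_mult[OF p_lev] c ij by auto
  moreover have "(u ^\<^sub>m p) $$ (i, k) - (v ^\<^sub>m p) $$ (i, k) - of_nat p * (u $$ (i, k) - v $$ (i, k)) \<in> L (e + j)"
    using GG_pow_p_diff_entry[OF assms ij] by (rule lev_mono) simp
  ultimately have "(u ^\<^sub>m p) $$ (i, k) - (v ^\<^sub>m p) $$ (i, k) \<in> L (e + j)"
    using lev_add by fastforce
  then show "(u ^\<^sub>m p - v ^\<^sub>m p) $$ (i, k) \<in> L (j + e)"
    using c ij by (simp add: add.commute)
qed

lemma lev_cancel_p: "of_nat p * x \<in> L (j + e) \<Longrightarrow> x \<in> L j"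
proof -
  assume "of_nat p * x \<in> L (j + e)"
  then have "of_nat p * x / \<pi> ^ (j + e) * (\<pi> ^ e / of_nat p) \<in> R"
    by (intro mult_closed p_lev') (simp add: lev_def)
  moreover have "of_nat p * x / \<pi> ^ (j + e) * (\<pi> ^ e / of_nat p) = x / \<pi> ^ j"
    using p_nonzero by (simp add: power_add)
  ultimately show ?thesis by (simp add: lev_def)
qed

lemma one_notin_L1: "1 \<notin> L 1"
  using pi_nonunit by (simp add: lev_def divide_inverse)

lemma inverse_of_nat_closed:
  assumes "coprime N p"
  shows "of_nat N \<noteq> (0 :: 'k)" "inverse (of_nat N) \<in> R"
proof -
  have notin: "of_nat N \<notin> L 1"
  proof
    assume N: "of_nat N \<in> L 1"
    obtain u v where "u * int N + v * int p = 1" using bezout_int[of "int N" "int p"] assms by auto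
    then have "of_int u * of_int (int N) + of_int v * of_int (int p) = (1 :: 'k)"
      by (metis of_int_1 of_int_add of_int_mult)
    then have "of_int u * of_nat N + of_int v * of_nat p = (1 :: 'k)" by simp
    moreover have "of_int u * of_nat N + of_int v * of_nat p \<in> L 1"
      using N lev_mono[OF p_lev e_pos] by (intro lev_add lev_multL) auto
    ultimately show False using one_notin_L1 by simp
  qed
  then show "of_nat N \<noteq> (0 :: 'k)" using lev_zero[of 1] by auto
  show "inverse (of_nat N) \<in> R" using notin local_ring of_nat_closed by blast
qed

text \<open>Bootstrapping on the level \<open>j\<close> of \<open>u - v\<close>: equal powers leave
  \<open>N\<close> times the entries of \<open>u - v\<close> inside the error term, and after
  division by \<open>N\<close> at least one level has been gained. Exponents prime to
  \<open>p\<close> are included for the sake of torsion-freeness and of determinants.\<close>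

lemma GG_root_unique:
  assumes u: "u \<in> GG" and v: "v \<in> GG" and eq: "u ^\<^sub>m N = v ^\<^sub>m N" and N: "N = p \<or> coprime N p \<and> N > 0"
  shows "u = v"
proof (rule MM_eqI)
  show c: "u \<in> carrier_mat n n" "v \<in> carrier_mat n n" using assms GG_carrier by auto
  show "u - v \<in> MM j" for j
  proof (induction j)
    case 0
    show ?case using u v GG_MM0 by (intro MM_diff) auto
  next
    case (Suc j)
    show ?case
    proof (rule MM_I)
      show "u - v \<in> carrier_mat n n" using c by auto
      fix i k assume ij: "i < n" "k < n"
      have "u $$ (i, k) - v $$ (i, k) \<in> L (Suc j)"
      proof (cases "N = p")
        case True
        have "- (of_nat p * (u $$ (i, k) - v $$ (i, k))) \<in> L (j + e + m)"
          using GG_pow_p_diff_entry[OF u v Suc ij] eq True by simp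
        then have "of_nat p * (u $$ (i, k) - v $$ (i, k)) \<in> L (Suc j + e)"
          using m_pos lev_mono[of _ "j + e + m" "Suc j + e"] lev_uminus by fastforce
        then show ?thesis by (rule lev_cancel_p)
      next
        case False
        then have cop: "coprime N p" "N \<ge> 1" using N by auto
        have "(u ^\<^sub>m N) $$ (i, k) - (v ^\<^sub>m N) $$ (i, k) - of_nat N * (u $$ (i, k) - v $$ (i, k)) \<in> L (j + m)"
        proof (rule GG_pow_diff_entry[OF u v Suc ij cop(2)])
          fix r assume "2 \<le> r" "r \<le> N"
          then have "1 * m \<le> (r - 1) * m" by (intro mult_right_mono) auto
          then show "\<exists>s. of_nat (N choose r) \<in> L s \<and> j + m \<le> s + (j + (r - 1) * m)"
            by (intro exI[of _ 0]) auto
        qed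
        then have "- (of_nat N * (u $$ (i, k) - v $$ (i, k))) \<in> L (Suc j)"
          using eq m_pos by (intro lev_mono[of _ "j + m" "Suc j"]) auto
        then have "of_nat N * (u $$ (i, k) - v $$ (i, k)) \<in> L (Suc j)"
          using lev_uminus by fastforce
        then have "inverse (of_nat N) * (of_nat N * (u $$ (i, k) - v $$ (i, k))) \<in> L (Suc j)"
          by (rule lev_multL[OF inverse_of_nat_closed(2)[OF cop(1)]])
        moreover have "inverse (of_nat N) * (of_nat N * z) = z" for z :: 'k
          using inverse_of_nat_closed(1)[OF cop(1)] by simp
        ultimately show ?thesis by (simp only:)
      qed
      then show "(u - v) $$ (i, k) \<in> L (Suc j)" using c ij by auto
    qed
  qed
qed

text \<open>Newton's method for \<open>y\<^sup>p = x\<close>, with the derivative \<open>p y\<^sup>p\<^sup>-\<^sup>1\<close> replaced by \<open>p\<close>.\<close>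

lemma GG_root_exists:
  assumes x: "x \<in> carrier_mat n n" "x - 1\<^sub>m n \<in> MM (m + s + e)"
  shows "\<exists>y\<in>carrier_mat n n. y - 1\<^sub>m n \<in> MM (m + s) \<and> y ^\<^sub>m p = x"
proof -
  define step where "step y = y + (1 / of_nat p) \<cdot>\<^sub>m (x - y ^\<^sub>m p)" for y :: "'k mat"
  define y where "y i = (step ^^ i) (1\<^sub>m n)" for i
  have ySuc: "y (Suc i) = y i + (1 / of_nat p) \<cdot>\<^sub>m (x - y i ^\<^sub>m p)" for i
    by (simp add: y_def step_def)
  have div: "c / of_nat p \<in> L j" if "c \<in> L (j + e)" for c j
    using lev_cancel_p[of "c / of_nat p" j] that p_nonzero by simp
  have inv: "y i \<in> carrier_mat n n \<and> y i - 1\<^sub>m n \<in> MM (m + s) \<and> x - y i ^\<^sub>m p \<in> MM (m + s + e + i * m)" for i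
  proof (induction i)
    case 0
    have [simp]: "1\<^sub>m n ^\<^sub>m k = (1\<^sub>m n :: 'k mat)" for k by (induction k) auto
    show ?case using x one_minus_one by (simp add: y_def)
  next
    case (Suc i)
    define c where "c = (1 / of_nat p) \<cdot>\<^sub>m (x - y i ^\<^sub>m p)"
    have yc: "y i \<in> carrier_mat n n" using Suc by blast
    have pc: "y i ^\<^sub>m p \<in> carrier_mat n n" using yc by (rule pow_carrier_mat)
    have xy: "x - y i ^\<^sub>m p \<in> MM (m + s + i * m + e)" using Suc by (simp add: algebra_simps)
    have centry: "c $$ (k, l) = (x - y i ^\<^sub>m p) $$ (k, l) / of_nat p" if "k < n" "l < n" for k l
      unfolding c_def using pc that by (subst index_smult_mat) auto
    have c: "c \<in> MM (m + s + i * m)"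
    proof (rule MM_I)
      show "c \<in> carrier_mat n n" unfolding c_def by (intro smult_carrier_mat minus_carrier_mat pc)
      show "c $$ (k, l) \<in> L (m + s + i * m)" if "k < n" "l < n" for k l
        using div[OF MM_D[OF xy that]] unfolding centry[OF that] .
    qed
    have cc: "c \<in> carrier_mat n n" using c MM_carrier by blast
    have y': "y (Suc i) = y i + c" by (simp add: ySuc c_def)
    have y'c: "y (Suc i) \<in> carrier_mat n n" using yc cc by (simp add: y')
    have d: "y (Suc i) - y i = c" unfolding y' using yc cc by (intro eq_matI) auto
    have one: "y (Suc i) - 1\<^sub>m n \<in> MM (m + s)"
      using MM_cong_trans[OF y'c yc one_carrier_mat, of "m + s"] Suc MM_mono[OF c, of "m + s"] by (simp add: d)
    have G: "y i \<in> GG" "y (Suc i) \<in> GG" using Suc one yc y'c by (auto simp: GG_def intro: MM_mono)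
    have "x - y (Suc i) ^\<^sub>m p \<in> MM (m + s + e + Suc i * m)"
    proof (rule MM_I)
      show "x - y (Suc i) ^\<^sub>m p \<in> carrier_mat n n" using x y'c by (auto intro: pow_carrier_mat)
      fix k l assume kl: "k < n" "l < n"
      \<comment> \<open>Since \<open>p\<close> times \<open>c\<close> is the old residual, the new
        residual is, up to sign, the deviation of the difference of \<open>p\<close>-th powers from
        its linear term. That deviation lies \<open>e + m\<close> levels above \<open>c\<close>, so
        each round gains \<open>m\<close>.\<close>
      have "y (Suc i) $$ (k, l) - y i $$ (k, l) = c $$ (k, l)" using yc cc kl by (simp add: y')
      moreover have "of_nat p * c $$ (k, l) = x $$ (k, l) - (y i ^\<^sub>m p) $$ (k, l)"
        unfolding centry[OF kl] using x pc kl p_nonzero by (subst index_minus_mat) auto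
      moreover have "(y (Suc i) ^\<^sub>m p) $$ (k, l) - (y i ^\<^sub>m p) $$ (k, l) -
          of_nat p * (y (Suc i) $$ (k, l) - y i $$ (k, l)) \<in> L (m + s + i * m + e + m)"
        using GG_pow_p_diff_entry[OF G(2,1) _ kl] c by (simp add: d)
      ultimately have "(y (Suc i) ^\<^sub>m p) $$ (k, l) - x $$ (k, l) \<in> L (m + s + e + Suc i * m)"
        by (simp add: algebra_simps)
      then show "(x - y (Suc i) ^\<^sub>m p) $$ (k, l) \<in> L (m + s + e + Suc i * m)"
        using pow_carrier_mat[OF y'c, of p] kl lev_cong_sym by (subst index_minus_mat) auto
    qed
    then show ?case using one y'c by blast
  qed
  have im: "i \<le> i * m" for i using m_pos by simp
  have "y (Suc i) - y i \<in> MM i" for i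
  proof (rule MM_I)
    have c: "y i \<in> carrier_mat n n" "y (Suc i) \<in> carrier_mat n n" "y i ^\<^sub>m p \<in> carrier_mat n n"
      using inv by (auto intro: pow_carrier_mat)
    then show "y (Suc i) - y i \<in> carrier_mat n n" by auto
    fix k l assume kl: "k < n" "l < n"
    have "(x - y i ^\<^sub>m p) $$ (k, l) \<in> L (i + e)"
      using MM_D[OF conjunct2[OF conjunct2[OF inv[of i]]] kl] by (rule lev_mono) (use im[of i] in linarith)
    from div[OF this] show "(y (Suc i) - y i) $$ (k, l) \<in> L i"
      unfolding ySuc using c kl by (subst index_minus_mat) auto
  qed
  then obtain z where z: "z \<in> carrier_mat n n" "\<And>i. z - y i \<in> MM i"
    using MM_complete[of y] inv by blast
  have z1: "z - 1\<^sub>m n \<in> MM (m + s)"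
    using MM_cong_trans[OF z(1) _ one_carrier_mat z(2)[of "m + s"]] inv[of "m + s"] by blast
  have zG: "z \<in> GG" using z z1 by (auto simp: GG_def intro: MM_mono)
  have "x = z ^\<^sub>m p"
  proof (rule MM_eqI[OF x(1) pow_carrier_mat[OF z(1)]])
    fix j
    have yG: "y j \<in> GG" using inv[of j] by (auto simp: GG_def intro: MM_mono)
    have "z ^\<^sub>m p - y j ^\<^sub>m p \<in> MM j" using GG_pow_p_cong[OF zG yG z(2)] by (rule MM_mono) simp
    moreover have "x - y j ^\<^sub>m p \<in> MM j" 
    proof (rule MM_mono)
      show "x - y j ^\<^sub>m p \<in> MM (m + s + e + j * m)" using inv by blast
    qed (use im[of j] in linarith)
    ultimately show "x - z ^\<^sub>m p \<in> MM j"
      using MM_cong_trans[OF x(1) _ pow_carrier_mat[OF z(1)]] MM_cong_sym pow_carrier_mat[OF z(1)]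
        pow_carrier_mat[OF GG_carrier[OF yG]] by blast
  qed
  then show ?thesis using z(1) z1 by blast
qed

end

section \<open>Congruence subgroups are uniform\<close>

lemma elements_mat_subset_iff:
  assumes "A \<in> carrier_mat n n"
  shows "elements_mat A \<subseteq> S \<longleftrightarrow> (\<forall>i<n. \<forall>k<n. A $$ (i, k) \<in> S)"
proof
  assume "elements_mat A \<subseteq> S"
  then show "\<forall>i<n. \<forall>k<n. A $$ (i, k) \<in> S" using elements_matI[OF assms] by (auto simp: subset_iff)
next
  assume *: "\<forall>i<n. \<forall>k<n. A $$ (i, k) \<in> S"
  show "elements_mat A \<subseteq> S"
  proof
    fix a assume "a \<in> elements_mat A"
    from elements_matD[OF this] obtain i k where "i < n" "k < n" "a = A $$ (i, k)" using assms by auto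
    then show "a \<in> S" using * by simp
  qed
qed

context complete_dvr
begin

text \<open>Expansions in base \<open>\<pi>\<close> with digits from the residue system, starting at
  position \<open>i\<close>; the induction appends one digit. The starting position will be
  \<open>m\<close>, the level of the off-diagonal entries.\<close>

lemma lev_transversal:
  "\<exists>T. finite T \<and> card T = q ^ j \<and> T \<subseteq> L i \<and> (\<forall>x\<in>L i. \<exists>!t. t \<in> T \<and> x - t \<in> L (i + j))"
proof (induction j)
  case 0
  show ?case by (rule exI[of _ "{0}"]) auto
next
  case (Suc j)
  then obtain T where T: "finite T" "card T = q ^ j" "T \<subseteq> L i"
    "\<forall>x\<in>L i. \<exists>!t. t \<in> T \<and> x - t \<in> L (i + j)" by blast
  obtain S where S: "finite S" "card S = q" "S \<subseteq> R" "\<forall>x\<in>R. \<exists>!t. t \<in> S \<and> x - t \<in> L 1"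
    using residue by blast
  define f where "f = (\<lambda>(t, s). t + \<pi> ^ (i + j) * s)"
  have pis: "\<pi> ^ (i + j) * s \<in> L (i + j)" if "s \<in> R" for s using that by (intro lev_multR lev_pi)
  have pis': "\<pi> ^ (i + j) * s \<in> L (i + Suc j) \<longleftrightarrow> s \<in> L 1" for s
    by (simp add: lev_def power_add)
  have ex: "\<exists>t\<in>T. \<exists>s\<in>S. x - f (t, s) \<in> L (i + Suc j)" if x: "x \<in> L i" for x
  proof -
    obtain t where t: "t \<in> T" "x - t \<in> L (i + j)" using T(4) x by blast
    define y where "y = (x - t) / \<pi> ^ (i + j)"
    have "y \<in> R" using t by (simp add: y_def lev_def)
    then obtain s where s: "s \<in> S" "y - s \<in> L 1" using S(4) by blast
    have "\<pi> ^ (i + j) * y = x - t" by (simp add: y_def)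
    then have "x - f (t, s) = \<pi> ^ (i + j) * (y - s)" by (simp add: f_def right_diff_distrib)
    then have "x - f (t, s) \<in> L (i + Suc j)" using pis' s by metis
    then show ?thesis using t s by blast
  qed
  have uniq: "t = t' \<and> s = s'" if ts: "t \<in> T" "s \<in> S" "t' \<in> T" "s' \<in> S"
    and d: "f (t, s) - f (t', s') \<in> L (i + Suc j)" for t s t' s'
  proof -
    have R: "s \<in> R" "s' \<in> R" using ts S by auto
    have "t - t' = (f (t, s) - f (t', s')) - \<pi> ^ (i + j) * (s - s')"
      by (simp add: f_def algebra_simps)
    also have "\<dots> \<in> L (i + j)" 
      using lev_diff[OF lev_mono[OF d, of "i + j"] pis[of "s - s'"]] R by simp
    finally have "t - t' \<in> L (i + j)" .
    moreover have "t \<in> L i" using ts T by blast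
    ultimately have tt: "t = t'" using T(4) ts lev_zero[of "i + j"] by (metis diff_self)
    then have "\<pi> ^ (i + j) * (s - s') \<in> L (i + Suc j)" using d by (simp add: f_def algebra_simps)
    then have "s - s' \<in> L 1" using pis' by blast
    then have "s = s'" using S(4) ts R lev_zero[of 1] by (metis diff_self)
    then show ?thesis using tt by blast
  qed
  have inj: "inj_on f (T \<times> S)"
  proof (rule inj_onI, clarify)
    fix t s t' s' assume "t \<in> T" "s \<in> S" "t' \<in> T" "s' \<in> S" "f (t, s) = f (t', s')"
    then show "t = t' \<and> s = s'" using uniq[of t s t' s'] lev_zero[of "i + Suc j"] by simp
  qed
  show ?case
  proof (intro exI[of _ "f ` (T \<times> S)"] conjI ballI)
    show "finite (f ` (T \<times> S))" using T S by simp
    show "card (f ` (T \<times> S)) = q ^ Suc j" using T S by (simp add: card_image[OF inj] card_cartesian_product)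
    show "f ` (T \<times> S) \<subseteq> L i"
    proof
      fix x assume "x \<in> f ` (T \<times> S)"
      then obtain t s where "t \<in> T" "s \<in> S" "x = t + \<pi> ^ (i + j) * s" by (auto simp: f_def)
      moreover from this have "\<pi> ^ (i + j) * s \<in> L i" using lev_mono[OF pis[of s], of i] S by auto
      ultimately show "x \<in> L i" using T lev_add by blast
    qed
    fix x assume x: "x \<in> L i"
    obtain t s where ts: "t \<in> T" "s \<in> S" "x - f (t, s) \<in> L (i + Suc j)" using ex[OF x] by blast
    show "\<exists>!y. y \<in> f ` (T \<times> S) \<and> x - y \<in> L (i + Suc j)"
    proof (rule ex1I[of _ "f (t, s)"])
      fix y assume y: "y \<in> f ` (T \<times> S) \<and> x - y \<in> L (i + Suc j)"
      then obtain t' s' where ts': "t' \<in> T" "s' \<in> S" "y = f (t', s')" by auto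
      then have "f (t', s') - f (t, s) \<in> L (i + Suc j)"
        using lev_diff[OF ts(3), of "x - y"] y by simp
      then have "t' = t \<and> s' = s" using uniq ts ts' by blast
      then show "y = f (t, s)" using ts' by simp
    qed (use ts in auto)
  qed
qed

end

text \<open>What a subgroup of \<open>GG\<close> must satisfy in order to be uniform. Closedness in
  the \<open>\<pi>\<close>-adic topology gives completeness of the filtration, and
  \<open>C_isolated\<close> keeps the \<open>p\<close>-th roots constructed in \<open>GG\<close>
  inside the subgroup.\<close>

locale congruence_grp = dvr_matrices R \<pi> p e q n m
  for R :: "'k::field set" and \<pi> and p e q n m +
  fixes C :: "'k mat set"
  assumes C_GG: "C \<subseteq> GG"
    and C_one: "1\<^sub>m n \<in> C"
    and C_mult: "x \<in> C \<Longrightarrow> y \<in> C \<Longrightarrow> x * y \<in> C"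
    and C_inverse: "x \<in> C \<Longrightarrow> \<exists>y\<in>C. y * x = 1\<^sub>m n"
    and C_closed: "x \<in> carrier_mat n n \<Longrightarrow> (\<And>i. \<exists>y\<in>C. x - y \<in> MM i) \<Longrightarrow> x \<in> C"
    and C_isolated: "x \<in> GG \<Longrightarrow> x ^\<^sub>m p \<in> C \<Longrightarrow> x \<in> C"
begin

abbreviation G where "G \<equiv> matrix_group n C"

lemma G_simps [simp]: "carrier G = C" "x \<otimes>\<^bsub>G\<^esub> y = x * y" "\<one>\<^bsub>G\<^esub> = 1\<^sub>m n"
  by (simp_all add: matrix_group_def)

lemma C_GG': "x \<in> C \<Longrightarrow> x \<in> GG" using C_GG by blast

lemma C_carrier: "x \<in> C \<Longrightarrow> x \<in> carrier_mat n n" using C_GG' GG_carrier by blast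

lemma C_MM0: "x \<in> C \<Longrightarrow> x \<in> MM 0" using C_GG' GG_MM0 by blast

sublocale group G
proof (rule groupI)
  fix x y z assume "x \<in> carrier G" "y \<in> carrier G" "z \<in> carrier G"
  then show "x \<otimes>\<^bsub>G\<^esub> y \<otimes>\<^bsub>G\<^esub> z = x \<otimes>\<^bsub>G\<^esub> (y \<otimes>\<^bsub>G\<^esub> z)"
    using assoc_mult_mat[of x n n y n z n] C_carrier by simp
next
  fix x assume "x \<in> carrier G"
  then show "\<exists>y\<in>carrier G. y \<otimes>\<^bsub>G\<^esub> x = \<one>\<^bsub>G\<^esub>" using C_inverse by simp
next
  fix x assume "x \<in> carrier G"
  then show "\<one>\<^bsub>G\<^esub> \<otimes>\<^bsub>G\<^esub> x = x" using left_mult_one_mat[OF C_carrier] by simp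
qed (use C_one C_mult in auto)

lemma one_mult_C [simp]: "x \<in> C \<Longrightarrow> 1\<^sub>m n * x = x"
  using left_mult_one_mat[OF C_carrier] .

lemma pow_G: "x \<in> C \<Longrightarrow> x [^]\<^bsub>G\<^esub> (k :: nat) = x ^\<^sub>m k"
  by (induction k) (use C_carrier in auto)

text \<open>Multiplication by \<open>x\<close> and by its inverse preserves levels, both being
  integral. This translates the cosets of the filtration into additive congruences of matrices,
  where completeness and Newton's method apply.\<close>

lemma cong_iff:
  assumes "x \<in> C" "y \<in> C"
  shows "inv\<^bsub>G\<^esub> x * y - 1\<^sub>m n \<in> MM j \<longleftrightarrow> y - x \<in> MM j"
proof -
  have xi: "inv\<^bsub>G\<^esub> x \<in> C" using inv_closed[of x] assms by simp
  have ix: "inv\<^bsub>G\<^esub> x * x = 1\<^sub>m n" "x * inv\<^bsub>G\<^esub> x = 1\<^sub>m n" using l_inv[of x] r_inv[of x] assms by auto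
  note c = C_carrier[OF xi] C_carrier[OF assms(1)] C_carrier[OF assms(2)]
  have d: "inv\<^bsub>G\<^esub> x * y - 1\<^sub>m n = inv\<^bsub>G\<^esub> x * (y - x)"
    using mult_minus_distrib_mat[OF c(1,3,2)] ix by simp
  have "x * (inv\<^bsub>G\<^esub> x * (y - x)) = (x * inv\<^bsub>G\<^esub> x) * (y - x)"
    using c by (intro assoc_mult_mat[symmetric, of _ n n _ n _ n]) auto
  also have "\<dots> = y - x" unfolding ix using c by (intro left_mult_one_mat) auto
  finally have d': "y - x = x * (inv\<^bsub>G\<^esub> x * (y - x))" by simp
  show ?thesis
    unfolding d using d' MM_multL[OF C_MM0[OF xi], of "y - x" j] MM_multL[OF C_MM0[OF assms(1)], of "inv\<^bsub>G\<^esub> x * (y - x)" j]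
    by auto
qed

definition FF :: "nat \<Rightarrow> 'k mat set" where
  "FF j = {x \<in> C. x - 1\<^sub>m n \<in> MM j}"

lemma FF_cong: "x \<in> C \<Longrightarrow> y \<in> C \<Longrightarrow> inv\<^bsub>G\<^esub> x \<otimes>\<^bsub>G\<^esub> y \<in> FF j \<longleftrightarrow> y - x \<in> MM j"
  using cong_iff[of x y j] C_mult[of "inv\<^bsub>G\<^esub> x" y] inv_closed[of x] by (simp add: FF_def)

text \<open>Reducing all entries modulo \<open>\<pi> ^ j\<close> has finite image. A reduced matrix
  need not belong to \<open>C\<close>, so one element of \<open>C\<close> is chosen above each
  reduction that occurs.\<close>

lemma finite_reps: "\<exists>Y. finite Y \<and> Y \<subseteq> C \<and> (\<forall>y\<in>C. \<exists>x\<in>Y. y - x \<in> MM j)"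
proof -
  obtain T where T: "finite T" "\<forall>x\<in>R. \<exists>!t. t \<in> T \<and> x - t \<in> L j"
    using lev_transversal[of j 0] by auto
  then obtain r where r: "\<And>x. x \<in> R \<Longrightarrow> r x \<in> T \<and> x - r x \<in> L j" by metis
  define f where "f A = Matrix.mat n n (\<lambda>(i, k). r (A $$ (i, k)))" for A
  have "f ` C \<subseteq> (\<lambda>g. Matrix.mat n n g) ` (PiE ({..<n} \<times> {..<n}) (\<lambda>_. T))"
  proof
    fix B assume "B \<in> f ` C"
    then obtain A where A: "A \<in> C" "B = f A" by blast
    have "A $$ (i, k) \<in> R" if "i < n" "k < n" for i k using MM_D[OF C_MM0[OF A(1)] that] by simp
    then have "restrict (\<lambda>(i, k). r (A $$ (i, k))) ({..<n} \<times> {..<n}) \<in> PiE ({..<n} \<times> {..<n}) (\<lambda>_. T)"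
      using r by auto
    moreover have "B = Matrix.mat n n (restrict (\<lambda>(i, k). r (A $$ (i, k))) ({..<n} \<times> {..<n}))"
      unfolding A f_def by (rule eq_matI) auto
    ultimately show "B \<in> (\<lambda>g. Matrix.mat n n g) ` (PiE ({..<n} \<times> {..<n}) (\<lambda>_. T))" by blast
  qed
  moreover have "finite (PiE ({..<n} \<times> {..<n}) (\<lambda>_. T))" using T by (intro finite_PiE) auto
  ultimately have fin: "finite (f ` C)" using finite_subset by blast
  define Y where "Y = inv_into C f ` f ` C"
  have "y - inv_into C f (f y) \<in> MM j" if y: "y \<in> C" for y
  proof -
    define z where "z = inv_into C f (f y)"
    have z: "z \<in> C" "f z = f y" using y by (auto simp: z_def inv_into_into f_inv_into_f)
    show "y - z \<in> MM j"
    proof (rule MM_I)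
      show "y - z \<in> carrier_mat n n" using C_carrier[OF z(1)] by (rule minus_carrier_mat)
      fix i k assume ik: "i < n" "k < n"
      have "r (z $$ (i, k)) = r (y $$ (i, k))"
        using arg_cong[OF z(2), of "\<lambda>A. A $$ (i, k)"] ik by (simp add: f_def)
      moreover have "y $$ (i, k) \<in> R" "z $$ (i, k) \<in> R"
        using MM_D[OF C_MM0[OF y] ik] MM_D[OF C_MM0[OF z(1)] ik] by auto
      ultimately have "(y $$ (i, k) - r (y $$ (i, k))) - (z $$ (i, k) - r (y $$ (i, k))) \<in> L j"
        using r by (metis lev_diff)
      then have "y $$ (i, k) - z $$ (i, k) \<in> L j" by simp
      then show "(y - z) $$ (i, k) \<in> L j"
        using C_carrier[OF z(1)] ik by (subst index_minus_mat) auto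
    qed
  qed
  then show ?thesis using fin by (intro exI[of _ Y]) (auto simp: Y_def inv_into_into)
qed

lemma FF_m: "FF j = C" if "j \<le> m"
  using C_GG' MM_mono[OF _ that] by (auto simp: FF_def GG_def)

text \<open>With \<open>x = 1 + a\<close> and \<open>y = 1 + b\<close> the difference is
  \<open>a * b - b * a\<close>. As \<open>m \<ge> e\<close>, its level \<open>2 * m\<close> is at
  least \<open>m + e\<close>, the level of the \<open>p\<close>-th powers.\<close>

lemma commutator_diff:
  assumes "x \<in> C" "y \<in> C"
  shows "x * y - y * x \<in> MM (m + m)"
proof -
  note c = C_carrier[OF assms(1)] C_carrier[OF assms(2)]
  define a b where "a = x - 1\<^sub>m n" and "b = y - 1\<^sub>m n"
  have ab: "a \<in> MM m" "b \<in> MM m" using assms C_GG' by (auto simp: a_def b_def GG_def)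
  have prod: "(u - 1\<^sub>m n) * (v - 1\<^sub>m n) = (u * v - u) - (v - 1\<^sub>m n)"
    if "u \<in> carrier_mat n n" "v \<in> carrier_mat n n" for u v :: "'k mat"
    using that minus_mult_distrib_mat[of u n n "1\<^sub>m n" "v - 1\<^sub>m n" n]
      mult_minus_distrib_mat[of u n n v n "1\<^sub>m n"] left_mult_one_mat[of "v - 1\<^sub>m n" n n]
    by (simp add: minus_carrier_mat)
  have "x * y - y * x = a * b - b * a"
    unfolding a_def b_def prod[OF c] prod[OF c(2,1)] by (rule eq_matI) (use c in auto)
  then show ?thesis using MM_diff[OF MM_mult[OF ab] MM_mult[OF ab(2,1)]] by simp
qed

lemma FF_normal: "FF j \<lhd> G"
proof -
  have sub: "subgroup (FF j) G"
  proof (rule subgroupI)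
    show "FF j \<subseteq> carrier G" by (auto simp: FF_def)
    have "1\<^sub>m n \<in> FF j" using C_one one_minus_one by (simp add: FF_def)
    then show "FF j \<noteq> {}" by auto
    fix x assume x: "x \<in> FF j"
    have xC: "x \<in> C" using x by (simp add: FF_def)
    have xi: "inv\<^bsub>G\<^esub> x \<in> C" using inv_closed[of x] xC by simp
    have "1\<^sub>m n - x \<in> MM j" using x C_carrier[OF xC] by (intro MM_cong_sym[of x "1\<^sub>m n"]) (auto simp: FF_def)
    then have "inv\<^bsub>G\<^esub> x * 1\<^sub>m n - 1\<^sub>m n \<in> MM j" by (rule iffD2[OF cong_iff[OF xC C_one]])
    then have "inv\<^bsub>G\<^esub> x - 1\<^sub>m n \<in> MM j" unfolding right_mult_one_mat[OF C_carrier[OF xi]] .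
    then show "inv\<^bsub>G\<^esub> x \<in> FF j" using xi by (simp add: FF_def)
    fix y assume y: "y \<in> FF j"
    have yC: "y \<in> C" using y by (simp add: FF_def)
    have "x * y - 1\<^sub>m n * 1\<^sub>m n \<in> MM j"
      using x y C_carrier[OF xC] C_MM0[OF yC] MM_one by (intro MM_diff_mult) (auto simp: FF_def)
    then show "x \<otimes>\<^bsub>G\<^esub> y \<in> FF j" using C_mult[OF xC yC] by (simp add: FF_def)
  qed
  have "x \<otimes>\<^bsub>G\<^esub> h \<otimes>\<^bsub>G\<^esub> inv\<^bsub>G\<^esub> x \<in> FF j" if x: "x \<in> carrier G" and h: "h \<in> FF j" for x h
  proof -
    have xC: "x \<in> C" and hC: "h \<in> C" using x h by (auto simp: FF_def)
    have xi: "inv\<^bsub>G\<^esub> x \<in> C" using inv_closed[of x] xC by simp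
    have xix: "x * inv\<^bsub>G\<^esub> x = 1\<^sub>m n" using r_inv[of x] xC by simp
    have z: "x - x \<in> MM j" "inv\<^bsub>G\<^esub> x - inv\<^bsub>G\<^esub> x \<in> MM j" using C_carrier[OF xC] C_carrier[OF xi] by (auto simp: MM_def)
    have "x * h - x * 1\<^sub>m n \<in> MM j"
      using h C_carrier xC hC C_MM0 z by (intro MM_diff_mult) (auto simp: FF_def)
    then have "x * h - x \<in> MM j" using right_mult_one_mat[OF C_carrier[OF xC]] by simp
    then have "x * h * inv\<^bsub>G\<^esub> x - x * inv\<^bsub>G\<^esub> x \<in> MM j"
      by (rule MM_diff_mult[OF _ z(2) C_MM0[OF xC] C_MM0[OF xi] C_carrier[OF C_mult[OF xC hC]] C_carrier[OF xi]])
    then show ?thesis using xix xC hC xi C_mult by (simp add: FF_def)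
  qed
  then show ?thesis using sub by (simp add: normal_inv_iff)
qed

lemma filtered: "filtered_group G FF"
proof (rule filtered_group.intro[OF is_group filtered_group_axioms.intro])
  show "FF j \<lhd> G" for j by (rule FF_normal)
  show "FF (Suc j) \<subseteq> FF j" for j using MM_mono[of _ "Suc j" j] by (auto simp: FF_def)
  show "x = \<one>\<^bsub>G\<^esub>" if x: "\<And>j. x \<in> FF j" for x
  proof -
    have "x \<in> carrier_mat n n" using x[of 0] C_carrier by (auto simp: FF_def)
    then show ?thesis using MM_eqI[of x "1\<^sub>m n"] x by (auto simp: FF_def)
  qed
  show "\<exists>x\<in>carrier G. \<forall>i. inv\<^bsub>G\<^esub> a i \<otimes>\<^bsub>G\<^esub> x \<in> FF i"
    if a: "\<And>i. a i \<in> carrier G" and d: "\<And>i. inv\<^bsub>G\<^esub> a i \<otimes>\<^bsub>G\<^esub> a (Suc i) \<in> FF i" for a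
  proof -
    have aC: "a i \<in> C" for i using a by simp
    have "a (Suc i) - a i \<in> MM i" for i using d FF_cong[OF aC aC] by blast
    then obtain x where x: "x \<in> carrier_mat n n" "\<And>i. x - a i \<in> MM i"
      using MM_complete[of a] C_carrier[OF aC] by blast
    have xC: "x \<in> C" using C_closed[OF x(1)] x(2) aC by blast
    then show ?thesis using FF_cong[OF aC xC] x(2) by auto
  qed
  show "\<exists>Y. finite Y \<and> Y \<subseteq> carrier G \<and> (\<forall>y\<in>carrier G. \<exists>x\<in>Y. inv\<^bsub>G\<^esub> x \<otimes>\<^bsub>G\<^esub> y \<in> FF j)" for j
  proof -
    obtain Y where Y: "finite Y" "Y \<subseteq> C" "\<forall>y\<in>C. \<exists>x\<in>Y. y - x \<in> MM j" using finite_reps[of j] by auto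
    have "\<exists>x\<in>Y. inv\<^bsub>G\<^esub> x \<otimes>\<^bsub>G\<^esub> y \<in> FF j" if y: "y \<in> C" for y
    proof -
      obtain x where x: "x \<in> Y" "y - x \<in> MM j" using Y(3) y by auto
      then have "inv\<^bsub>G\<^esub> x \<otimes>\<^bsub>G\<^esub> y \<in> FF j" using FF_cong[of x y j] Y(2) y by auto
      then show ?thesis using x(1) by (intro bexI)
    qed
    then show ?thesis using Y(1,2) by (intro exI[of _ Y]) simp
  qed
qed

interpretation FG: filtered_group G FF by (rule filtered)

text \<open>Roots are extracted one factor of \<open>p\<close> at a time;
  \<open>GG_root_exists\<close> lowers the level by \<open>e\<close> each time and
  \<open>C_isolated\<close> keeps the root in \<open>C\<close>.\<close>

lemma root_FF:
  "x \<in> FF (m + s * e) \<Longrightarrow> \<exists>y\<in>C. y [^]\<^bsub>G\<^esub> (p ^ s) = x"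
proof (induction s arbitrary: x)
  case 0
  then show ?case by (intro bexI[of _ x]) (auto simp: FF_def pow_G C_carrier)
next
  case (Suc s)
  then have x: "x \<in> C" "x - 1\<^sub>m n \<in> MM (m + s * e + e)" by (auto simp: FF_def algebra_simps)
  obtain y where y: "y \<in> carrier_mat n n" "y - 1\<^sub>m n \<in> MM (m + s * e)" "y ^\<^sub>m p = x"
    using GG_root_exists[OF C_carrier[OF x(1)] x(2)] by blast
  have "y \<in> GG" using y MM_mono by (auto simp: GG_def)
  then have yC: "y \<in> C" using C_isolated y(3) x(1) by simp
  then have "y \<in> FF (m + s * e)" using y by (simp add: FF_def)
  then obtain z where z: "z \<in> C" "z [^]\<^bsub>G\<^esub> (p ^ s) = y" using Suc.IH by blast
  have "z [^]\<^bsub>G\<^esub> (p ^ Suc s) = (z [^]\<^bsub>G\<^esub> (p ^ s)) [^]\<^bsub>G\<^esub> p"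
    using nat_pow_pow[of z "p ^ s" p] z(1) by (simp add: mult.commute)
  also have "\<dots> = x" unfolding z(2) using pow_G[OF yC] y(3) by simp
  finally show ?case using z(1) by blast
qed

lemma power_cong_FF:
  assumes "x \<in> C" "y \<in> C" "y - x \<in> MM (m + e)"
  shows "y [^]\<^bsub>G\<^esub> (p ^ s) - x [^]\<^bsub>G\<^esub> (p ^ s) \<in> MM (m + e + s * e)"
proof (induction s)
  case 0
  then show ?case using assms C_carrier by (simp add: pow_G)
next
  case (Suc s)
  have c: "x [^]\<^bsub>G\<^esub> (p ^ s) \<in> C" "y [^]\<^bsub>G\<^esub> (p ^ s) \<in> C"
    using nat_pow_closed[of x] nat_pow_closed[of y] assms by auto
  have "(y [^]\<^bsub>G\<^esub> (p ^ s)) ^\<^sub>m p - (x [^]\<^bsub>G\<^esub> (p ^ s)) ^\<^sub>m p \<in> MM (m + e + s * e + e)"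
    using GG_pow_p_cong[OF C_GG'[OF c(2)] C_GG'[OF c(1)] Suc] .
  moreover have "z [^]\<^bsub>G\<^esub> (p ^ Suc s) = (z [^]\<^bsub>G\<^esub> (p ^ s)) ^\<^sub>m p" if "z \<in> C" for z
    using nat_pow_pow[of z "p ^ s" p] pow_G[of "z [^]\<^bsub>G\<^esub> (p ^ s)" p] nat_pow_closed[of z "p ^ s"] that
    by (simp add: mult.commute)
  ultimately show ?case using assms by (simp add: algebra_simps)
qed

lemma power_FF: "x \<in> C \<Longrightarrow> x [^]\<^bsub>G\<^esub> (p ^ s) \<in> FF (m + s * e)"
proof (induction s)
  case 0
  then show ?case using FF_m C_carrier by (auto simp: pow_G)
next
  case (Suc s)
  define z where "z = x [^]\<^bsub>G\<^esub> (p ^ s)"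
  have z: "z \<in> C" "z - 1\<^sub>m n \<in> MM (m + s * e)" using Suc by (auto simp: z_def FF_def)
  have one: "1\<^sub>m n ^\<^sub>m p = (1\<^sub>m n :: 'k mat)" using pow_G[OF C_one, of p] nat_pow_one[of p] by simp
  have "z ^\<^sub>m p - 1\<^sub>m n ^\<^sub>m p \<in> MM (m + s * e + e)" using GG_pow_p_cong[OF C_GG'[OF z(1)] GG_one z(2)] .
  moreover have "x [^]\<^bsub>G\<^esub> (p ^ Suc s) = z [^]\<^bsub>G\<^esub> p"
    unfolding z_def using nat_pow_pow[of x "p ^ s" p] Suc.prems by (simp add: mult.commute)
  then have "x [^]\<^bsub>G\<^esub> (p ^ Suc s) = z ^\<^sub>m p" using pow_G[OF z(1)] by simp
  moreover have "z ^\<^sub>m p \<in> C" using nat_pow_closed[of z p] z pow_G[OF z(1), of p] by simp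
  ultimately show ?case by (simp add: FF_def one algebra_simps)
qed

text \<open>Uniqueness of \<open>p\<close>-th roots strips factors \<open>p\<close> from the
  exponent, and uniqueness of roots of order prime to \<open>p\<close> disposes of the rest.\<close>

lemma torsion_free_C:
  assumes "x \<in> C" "0 < i" "x [^]\<^bsub>G\<^esub> (i :: nat) = 1\<^sub>m n"
  shows "x = 1\<^sub>m n"
  using assms
proof (induction i arbitrary: x rule: less_induct)
  case (less i)
  have root: "y = 1\<^sub>m n" if y: "y \<in> C" "y [^]\<^bsub>G\<^esub> (N :: nat) = 1\<^sub>m n" "N = p \<or> coprime N p \<and> N > 0" for y N
    using GG_root_unique[OF C_GG'[OF y(1)] GG_one _ y(3)] pow_G[OF y(1), of N] pow_G[OF C_one, of N]
      nat_pow_one[of N] y(2) by simp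
  show ?case
  proof (cases "p dvd i")
    case True
    then obtain i' where i': "i = i' * p" by (metis dvd_def mult.commute)
    have "(x [^]\<^bsub>G\<^esub> i') [^]\<^bsub>G\<^esub> p = 1\<^sub>m n" using nat_pow_pow[of x i' p] less.prems i' by simp
    then have "x [^]\<^bsub>G\<^esub> i' = 1\<^sub>m n" using root nat_pow_closed[of x i'] less.prems by simp
    moreover have "i' < i" "0 < i'" using i' less.prems p_ge_3 by auto
    ultimately show ?thesis using less.IH less.prems by blast
  next
    case False
    then have "coprime i p" using prime_p by (metis coprime_commute prime_imp_coprime)
    then show ?thesis using root less.prems by blast
  qed
qed

lemma uniform_filtration: "uniform_filtration G FF p (\<lambda>s. m + s * e)"
proof (rule uniform_filtration.intro[OF filtered uniform_filtration_axioms.intro])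
  show "Factorial_Ring.prime p" by (rule prime_p)
  show "p \<noteq> 2" by (rule p_odd)
  show "s \<le> m + s * e" for s using e_pos by (simp add: trans_le_add2)
  show "x [^]\<^bsub>G\<^esub> p ^ s \<in> FF (m + s * e)" if "x \<in> carrier G" for x s using power_FF that by simp
  show "\<exists>y\<in>carrier G. y [^]\<^bsub>G\<^esub> p ^ s = x" if "x \<in> FF (m + s * e)" for x s using root_FF that by simp
  show "inv\<^bsub>G\<^esub> (x [^]\<^bsub>G\<^esub> p ^ s) \<otimes>\<^bsub>G\<^esub> y [^]\<^bsub>G\<^esub> p ^ s \<in> FF (m + Suc s * e)"
    if xy: "x \<in> carrier G" "y \<in> carrier G" "inv\<^bsub>G\<^esub> x \<otimes>\<^bsub>G\<^esub> y \<in> FF (m + 1 * e)" for x y s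
  proof -
    have "y - x \<in> MM (m + e)" using FF_cong[of x y "m + e"] xy by simp
    then have "y [^]\<^bsub>G\<^esub> (p ^ s) - x [^]\<^bsub>G\<^esub> (p ^ s) \<in> MM (m + Suc s * e)"
      using power_cong_FF[of x y s] xy by (simp add: algebra_simps)
    then show ?thesis
      using FF_cong[of "x [^]\<^bsub>G\<^esub> p ^ s" "y [^]\<^bsub>G\<^esub> p ^ s"] nat_pow_closed[of x] nat_pow_closed[of y] xy by simp
  qed
  show "x \<otimes>\<^bsub>G\<^esub> y \<otimes>\<^bsub>G\<^esub> inv\<^bsub>G\<^esub> x \<otimes>\<^bsub>G\<^esub> inv\<^bsub>G\<^esub> y \<in> FF (m + 1 * e)"
    if "x \<in> carrier G" "y \<in> carrier G" for x y
  proof -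
    have xy: "x \<in> C" "y \<in> C" using that by auto
    then have "y * x \<in> C" "x * y \<in> C" by (auto intro: C_mult)
    then have "inv\<^bsub>G\<^esub> (y \<otimes>\<^bsub>G\<^esub> x) \<otimes>\<^bsub>G\<^esub> (x \<otimes>\<^bsub>G\<^esub> y) \<in> FF (m + e)"
      using FF_cong[of "y * x" "x * y" "m + e"] commutator_diff[OF xy] MM_mono[of _ "m + m" "m + e"] m_ge by simp
    \<comment> \<open>The additive estimate concerns the inverse of \<open>y x\<close> times
      \<open>x y\<close>. Conjugation by \<open>y x\<close> moves that inverse to the right and
      yields the commutator in the order used by \<open>derived\<close>.\<close>
    then have "(y \<otimes>\<^bsub>G\<^esub> x) \<otimes>\<^bsub>G\<^esub> (inv\<^bsub>G\<^esub> (y \<otimes>\<^bsub>G\<^esub> x) \<otimes>\<^bsub>G\<^esub> (x \<otimes>\<^bsub>G\<^esub> y)) \<otimes>\<^bsub>G\<^esub> inv\<^bsub>G\<^esub> (y \<otimes>\<^bsub>G\<^esub> x) \<in> FF (m + e)"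
      using that by (intro normal.inv_op_closed2[OF FF_normal] m_closed)
    moreover have "g \<otimes>\<^bsub>G\<^esub> (inv\<^bsub>G\<^esub> g \<otimes>\<^bsub>G\<^esub> z) = z" if "g \<in> carrier G" "z \<in> carrier G" for g z
      using that by (simp only: m_assoc[symmetric] m_closed inv_closed r_inv l_one)
    then have "(y \<otimes>\<^bsub>G\<^esub> x) \<otimes>\<^bsub>G\<^esub> (inv\<^bsub>G\<^esub> (y \<otimes>\<^bsub>G\<^esub> x) \<otimes>\<^bsub>G\<^esub> (x \<otimes>\<^bsub>G\<^esub> y)) \<otimes>\<^bsub>G\<^esub> inv\<^bsub>G\<^esub> (y \<otimes>\<^bsub>G\<^esub> x)
        = (x \<otimes>\<^bsub>G\<^esub> y) \<otimes>\<^bsub>G\<^esub> inv\<^bsub>G\<^esub> (y \<otimes>\<^bsub>G\<^esub> x)"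
      using that by (simp only: m_closed)
    then have "(y \<otimes>\<^bsub>G\<^esub> x) \<otimes>\<^bsub>G\<^esub> (inv\<^bsub>G\<^esub> (y \<otimes>\<^bsub>G\<^esub> x) \<otimes>\<^bsub>G\<^esub> (x \<otimes>\<^bsub>G\<^esub> y)) \<otimes>\<^bsub>G\<^esub> inv\<^bsub>G\<^esub> (y \<otimes>\<^bsub>G\<^esub> x)
        = x \<otimes>\<^bsub>G\<^esub> y \<otimes>\<^bsub>G\<^esub> inv\<^bsub>G\<^esub> x \<otimes>\<^bsub>G\<^esub> inv\<^bsub>G\<^esub> y"
      using that by (simp only: m_assoc[symmetric] m_closed inv_closed inv_mult_group)
    ultimately show ?thesis by simp
  qed
  show "x = \<one>\<^bsub>G\<^esub>" if "x \<in> carrier G" "0 < i" "x [^]\<^bsub>G\<^esub> i = \<one>\<^bsub>G\<^esub>" for x and i :: nat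
    using torsion_free_C that by simp
qed

lemma mat_cong_iff:
  assumes "x \<in> carrier_mat n n" "y \<in> carrier_mat n n"
  shows "mat_cong R \<pi> j x y \<longleftrightarrow> x - y \<in> MM j"
proof -
  have c: "x - y \<in> carrier_mat n n" using assms by (intro minus_carrier_mat)
  then show ?thesis unfolding mat_cong_def PIdl_power MM_def elements_mat_subset_iff[OF c] by simp
qed

lemma adic_topology_eq: "adic_topology R \<pi> G = FG.T"
proof -
  have "{y \<in> carrier G. mat_cong R \<pi> j y x} = FG.nbhd x j" if "x \<in> carrier G" for x j
    using that mat_cong_iff[of _ x j] C_carrier FF_cong[of x _ j] by (auto simp: FG.nbhd_def)
  then show ?thesis unfolding adic_topology_def FG.T_def by (intro arg_cong[of _ _ topology_generated_by]) blast
qed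

theorem uniform: "uniform_pro_p_group p G (adic_topology R \<pi> G)"
  unfolding adic_topology_eq using uniform_filtration.uniform[OF uniform_filtration] .

end

section \<open>Special linear and isometry groups\<close>

context complete_dvr
begin

lemma prod_cong_lev:
  assumes "\<And>i. i \<in> A \<Longrightarrow> f i \<in> R" "\<And>i. i \<in> A \<Longrightarrow> g i \<in> R" "\<And>i. i \<in> A \<Longrightarrow> f i - g i \<in> L j"
  shows "prod f A - prod g A \<in> L j"
  using assms
proof (induction A rule: infinite_finite_induct)
  case (insert a A)
  have "prod f A \<in> R" "g a \<in> R" using insert by (auto intro: prod_closed)
  then have "(f a - g a) * prod f A + g a * (prod f A - prod g A) \<in> L j"
    using insert by (intro lev_add lev_multL lev_multR) auto
  moreover have "prod f (insert a A) - prod g (insert a A) = (f a - g a) * prod f A + g a * (prod f A - prod g A)"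
    using insert by (simp add: algebra_simps)
  ultimately show ?case by simp
qed auto

lemma det_closed:
  assumes "A \<in> carrier_mat n n" "\<And>i k. i < n \<Longrightarrow> k < n \<Longrightarrow> A $$ (i, k) \<in> R"
  shows "det A \<in> R"
  unfolding det_def'[OF assms(1)]
proof (intro sum_closed mult_closed of_int_closed prod_closed assms(2))
  fix f i assume "f \<in> {f. f permutes {0..<n}}" "i \<in> {0..<n}"
  then show "i < n" "f i < n" using permutes_in_image[of f "{0..<n}" i] by auto
qed

lemma det_cong_lev:
  assumes "A \<in> carrier_mat n n" "B \<in> carrier_mat n n"
    and "\<And>i k. i < n \<Longrightarrow> k < n \<Longrightarrow> A $$ (i, k) \<in> R" "\<And>i k. i < n \<Longrightarrow> k < n \<Longrightarrow> B $$ (i, k) \<in> R"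
    and "\<And>i k. i < n \<Longrightarrow> k < n \<Longrightarrow> A $$ (i, k) - B $$ (i, k) \<in> L j"
  shows "det A - det B \<in> L j"
  unfolding det_def'[OF assms(1)] det_def'[OF assms(2)] sum_subtractf[symmetric] right_diff_distrib[symmetric]
proof (intro lev_sum lev_multL of_int_closed prod_cong_lev assms(3-5))
  fix f i assume "f \<in> {f. f permutes {0..<n}}" "i \<in> {0..<n}"
  then show "i < n" "f i < n" "i < n" "f i < n" "i < n" "f i < n"
    using permutes_in_image[of f "{0..<n}" i] by auto
qed

text \<open>Characteristic zero, derived from \<open>p\<close> being nonzero: factors of
  \<open>p\<close> are stripped from \<open>N\<close>, and a number prime to \<open>p\<close> is a
  unit modulo \<open>\<pi>\<close> by a Bezout relation.\<close>

lemma of_nat_nonzero: "N > 0 \<Longrightarrow> of_nat N \<noteq> (0 :: 'k)"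
proof (induction N rule: less_induct)
  case (less N)
  show ?case
  proof (cases "p dvd N")
    case True
    then obtain N' where N': "N = p * N'" by (elim dvdE)
    then have "N' < N" "N' > 0" using less.prems prime_gt_1_nat[OF prime_p] by auto
    then show ?thesis using less.IH[of N'] p_nonzero N' by simp
  next
    case False
    then have "coprime N p" using prime_p by (metis coprime_commute prime_imp_coprime)
    then obtain u v where uv: "u * int N + v * int p = 1" using bezout_int[of "int N" "int p"] by auto
    have "of_int u * of_nat N + of_int v * of_nat p = (1 :: 'k)"
      using arg_cong[OF uv, of "of_int :: int \<Rightarrow> 'k"] by simp
    moreover have "of_int v * of_nat p \<in> L 1" using lev_mono[OF p_lev e_pos] by (intro lev_multL) auto
    moreover have "1 \<notin> L 1" using pi_nonunit by (simp add: lev_def divide_inverse)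
    ultimately show ?thesis by auto
  qed
qed

lemma unit_one_plus:
  assumes "x - 1 \<in> L 1"
  shows "x \<noteq> 0" "inverse x \<in> R"
proof -
  have n1: "1 \<notin> L 1" using pi_nonunit by (simp add: lev_def divide_inverse)
  have "x \<notin> L 1"
  proof
    assume "x \<in> L 1"
    then have "x - (x - 1) \<in> L 1" using assms by (rule lev_diff)
    then show False using n1 by simp
  qed
  moreover have "x \<in> R" using add_closed[OF lev_R[OF assms] one_closed] by simp
  ultimately show "x \<noteq> 0" "inverse x \<in> R" using local_ring[of x] lev_zero[of 1] by auto
qed

end

context dvr_matrices
begin

definition SLC :: "'k mat set" where
  "SLC = {x \<in> GG. det x = 1}"

lemma MM0_D: "A \<in> MM 0 \<Longrightarrow> i < n \<Longrightarrow> k < n \<Longrightarrow> A $$ (i, k) \<in> R"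
  using MM_D[of A 0] by simp

lemma det_cong_MM:
  assumes "A \<in> MM 0" "B \<in> MM 0" "A - B \<in> MM j"
  shows "det A - det B \<in> L j"
proof (rule det_cong_lev[OF MM_carrier[OF assms(1)] MM_carrier[OF assms(2)] MM0_D[OF assms(1)] MM0_D[OF assms(2)]])
  fix i k assume "i < n" "k < n"
  then show "A $$ (i, k) - B $$ (i, k) \<in> L j"
    using MM_D[OF assms(3), of i k] MM_carrier[OF assms(2)] by simp
qed auto

lemma det_GG: "x \<in> GG \<Longrightarrow> det x - 1 \<in> L m"
  using det_cong_MM[OF GG_MM0 MM_one, of x m] by (simp add: GG_def)

lemma transpose_MM: "A \<in> MM j \<Longrightarrow> A\<^sup>T \<in> MM j"
  by (auto simp: MM_def)

lemma adj_MM0: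
  assumes "A \<in> MM 0"
  shows "adj_mat A \<in> MM 0"
proof (rule MM_I)
  note c = MM_carrier[OF assms]
  show "adj_mat A \<in> carrier_mat n n" by (rule adj_mat(1)[OF c])
  fix i k assume ik: "i < n" "k < n"
  have "det (mat_delete A k i) \<in> R"
  proof (rule det_closed)
    show "mat_delete A k i \<in> carrier_mat (n - 1) (n - 1)" using mat_delete_carrier[OF c] .
    show "mat_delete A k i $$ (r, s) \<in> R" if "r < n - 1" "s < n - 1" for r s
      unfolding mat_delete_def using that c MM0_D[OF assms] by auto
  qed
  then have "cofactor A k i \<in> R" unfolding cofactor_def by (intro mult_closed power_closed) auto
  then show "adj_mat A $$ (i, k) \<in> L 0" using c ik by (simp add: adj_mat_def)
qed

lemma GG_inverse:
  assumes x: "x \<in> GG" and y: "y \<in> MM 0" "y * x = 1\<^sub>m n"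
  shows "y \<in> GG"
proof -
  note c = GG_carrier[OF x] MM_carrier[OF y(1)]
  have "y * 1\<^sub>m n - y * x \<in> MM m"
  proof (rule MM_diff_mult)
    show "y - y \<in> MM m" using c by (auto simp: MM_def)
    show "1\<^sub>m n - x \<in> MM m" using x by (intro MM_cong_sym[of x "1\<^sub>m n"]) (auto simp: GG_def)
  qed (use c y MM_one in auto)
  then show ?thesis using c y(2) right_mult_one_mat[OF c(2)] by (simp add: GG_def)
qed

text \<open>The case of 1 by 1 matrices of \<open>GG_root_unique\<close>. It is applied to
  determinants, which are congruent to 1.\<close>

lemma scalar_root_unique:
  assumes "c - 1 \<in> L m" "c ^ N = 1" "N = p \<or> coprime N p \<and> N > 0"
  shows "c = 1"
proof -
  interpret s: dvr_matrices R \<pi> p e q 1 m by unfold_locales (fact m_ge p_odd)+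
  define M where "M = Matrix.mat 1 1 (\<lambda>_. c)"
  have M: "M \<in> carrier_mat 1 1" by (simp add: M_def)
  have pw: "(M ^\<^sub>m k) $$ (0, 0) = c ^ k" for k
  proof (induction k)
    case (Suc k)
    then show ?case using index_mult_sum[OF pow_carrier_mat[OF M] M, of 0 0 k] by (simp add: M_def)
  qed (simp add: M_def)
  have "M \<in> s.GG" 
    unfolding s.GG_def s.MM_def M_def using assms(1) by auto
  moreover have "M ^\<^sub>m N = 1\<^sub>m 1 ^\<^sub>m N"
  proof -
    have one: "1\<^sub>m 1 ^\<^sub>m N = (1\<^sub>m 1 :: 'k mat)" by (induction N) auto
    show ?thesis unfolding one
      by (rule eq_matI) (use pw[of N] assms(2) pow_carrier_mat[OF M, of N] in auto)
  qed
  ultimately have "M = 1\<^sub>m 1" using s.GG_root_unique[OF _ s.GG_one _ assms(3)] by blast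
  then have "M $$ (0, 0) = 1\<^sub>m 1 $$ (0, 0)" by simp
  then show ?thesis by (simp add: M_def)
qed

text \<open>An isometry has determinant of square 1. Since \<open>p\<close> is odd, congruence to
  the identity excludes the value \<open>- 1\<close>.\<close>

lemma det_square_one: "x \<in> GG \<Longrightarrow> det x * det x = 1 \<Longrightarrow> det x = 1"
proof -
  assume x: "x \<in> GG" and d: "det x * det x = 1"
  have "coprime p 2" using prime_p p_odd by (metis coprime_commute prime_imp_coprime primes_dvd_imp_eq two_is_prime_nat)
  then show "det x = 1"
    using scalar_root_unique[OF det_GG[OF x], of 2] d by (simp add: power2_eq_square coprime_commute)
qed

lemma adj_SLC:
  assumes "x \<in> SLC"
  shows "adj_mat x \<in> SLC" "adj_mat x * x = 1\<^sub>m n" "x * adj_mat x = 1\<^sub>m n"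
proof -
  have x: "x \<in> GG" "det x = 1" using assms by (auto simp: SLC_def)
  note c = GG_carrier[OF x(1)]
  have one: "1 \<cdot>\<^sub>m 1\<^sub>m n = (1\<^sub>m n :: 'k mat)" by (rule eq_matI) auto
  show e: "adj_mat x * x = 1\<^sub>m n" "x * adj_mat x = 1\<^sub>m n" using adj_mat(2,3)[OF c] x(2) one by auto
  have "det (adj_mat x) * det x = 1" using det_mult[OF adj_mat(1)[OF c] c] e by simp
  moreover have "adj_mat x \<in> GG" using GG_inverse[OF x(1) adj_MM0[OF GG_MM0[OF x(1)]] e(1)] .
  ultimately show "adj_mat x \<in> SLC" using x(2) by (simp add: SLC_def)
qed

lemma SLC_congruence: "congruence_grp R \<pi> p e q n m SLC"
proof unfold_locales
  show "SLC \<subseteq> GG" by (auto simp: SLC_def)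
  show "1\<^sub>m n \<in> SLC" by (simp add: SLC_def GG_one)
  show "x * y \<in> SLC" if "x \<in> SLC" "y \<in> SLC" for x y
    using that GG_mult det_mult[OF GG_carrier GG_carrier, of x y] by (auto simp: SLC_def)
  show "\<exists>y\<in>SLC. y * x = 1\<^sub>m n" if "x \<in> SLC" for x using adj_SLC[OF that] by (intro bexI)
  show "x \<in> SLC" if xc: "x \<in> carrier_mat n n" and ap: "\<And>i. \<exists>y\<in>SLC. x - y \<in> MM i" for x
  proof -
    obtain y where y: "y \<in> SLC" "x - y \<in> MM m" using ap[of m] by auto
    have yG: "y \<in> GG" using y by (simp add: SLC_def)
    have "x - 1\<^sub>m n \<in> MM m"
      using MM_cong_trans[OF xc GG_carrier[OF yG] one_carrier_mat y(2)] yG by (simp add: GG_def)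
    then have xG: "x \<in> GG" using xc by (simp add: GG_def)
    have "det x - 1 \<in> L i" for i
    proof -
      obtain z where z: "z \<in> SLC" "x - z \<in> MM i" using ap[of i] by auto
      then show ?thesis using det_cong_MM[OF GG_MM0[OF xG] GG_MM0, of z i] by (simp add: SLC_def)
    qed
    then have "det x - 1 = 0" by (rule separated)
    then show ?thesis using xG by (simp add: SLC_def)
  qed
  show "x \<in> SLC" if x: "x \<in> GG" "x ^\<^sub>m p \<in> SLC" for x
  proof -
    have "det (x ^\<^sub>m k) = det x ^ k" for k
    proof (induction k)
      case (Suc k)
      then show ?case using det_mult[OF pow_carrier_mat[OF GG_carrier[OF x(1)]] GG_carrier[OF x(1)], of k]
        by simp
    qed (use GG_carrier[OF x(1)] in simp)
    then have "det x ^ p = 1" using x(2) by (simp add: SLC_def)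
    then show ?thesis using scalar_root_unique[OF det_GG[OF x(1)]] x(1) by (simp add: SLC_def)
  qed
qed

end

context congruence_grp
begin

text \<open>If the \<open>p\<close>-th power of \<open>x\<close> is fixed, then \<open>x\<close> and
  \<open>\<theta> x\<close> are two \<open>p\<close>-th roots of the same element, hence equal; so
  the fixed points are isolated. Continuity of \<open>\<theta>\<close> makes them closed.\<close>

lemma fixed_points_congruence:
  assumes hom: "\<theta> \<in> hom G G"
    and cont: "\<And>x y i. x \<in> C \<Longrightarrow> y \<in> C \<Longrightarrow> x - y \<in> MM i \<Longrightarrow> \<theta> x - \<theta> y \<in> MM i"
  shows "congruence_grp R \<pi> p e q n m {x \<in> C. \<theta> x = x}"
proof -
  interpret h: group_hom G G \<theta> by unfold_locales (rule hom)
  have th: "\<theta> x \<in> C" if "x \<in> C" for x using h.hom_closed[of x] that by simp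
  show ?thesis
  proof unfold_locales
    show "{x \<in> C. \<theta> x = x} \<subseteq> GG" using C_GG by auto
    show "1\<^sub>m n \<in> {x \<in> C. \<theta> x = x}" using C_one h.hom_one by simp
    show "x * y \<in> {x \<in> C. \<theta> x = x}" if "x \<in> {x \<in> C. \<theta> x = x}" "y \<in> {x \<in> C. \<theta> x = x}" for x y
      using that h.hom_mult[of x y] C_mult by simp
    show "\<exists>y\<in>{x \<in> C. \<theta> x = x}. y * x = 1\<^sub>m n" if "x \<in> {x \<in> C. \<theta> x = x}" for x
      using that h.hom_inv[of x] l_inv[of x] inv_closed[of x]
      by (intro bexI[of _ "inv\<^bsub>G\<^esub> x"]) auto
    show "x \<in> {x \<in> C. \<theta> x = x}"
      if xc: "x \<in> carrier_mat n n" and ap: "\<And>i. \<exists>y\<in>{x \<in> C. \<theta> x = x}. x - y \<in> MM i" for x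
    proof -
      have xC: "x \<in> C" using C_closed[OF xc] ap by blast
      have "\<theta> x = x"
      proof (rule MM_eqI[OF C_carrier[OF th[OF xC]] xc])
        fix i
        obtain y where y: "y \<in> C" "\<theta> y = y" "x - y \<in> MM i" using ap[of i] by auto
        have "\<theta> x - y \<in> MM i" using cont[OF xC y(1,3)] y(2) by simp
        moreover have "y - x \<in> MM i" using MM_cong_sym[OF xc C_carrier[OF y(1)] y(3)] .
        ultimately show "\<theta> x - x \<in> MM i"
          by (rule MM_cong_trans[OF C_carrier[OF th[OF xC]] C_carrier[OF y(1)] xc])
      qed
      then show ?thesis using xC by simp
    qed
    show "x \<in> {x \<in> C. \<theta> x = x}" if x: "x \<in> GG" "x ^\<^sub>m p \<in> {x \<in> C. \<theta> x = x}" for x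
    proof -
      have xC: "x \<in> C" using C_isolated x by simp
      have "\<theta> x ^\<^sub>m p = \<theta> (x ^\<^sub>m p)"
        using h.hom_nat_pow[of x p] pow_G[OF xC] pow_G[OF th[OF xC]] xC by simp
      then have "\<theta> x = x" using GG_root_unique[OF C_GG'[OF th[OF xC]] x(1), of p] x(2) by simp
      then show ?thesis using xC by simp
    qed
  qed
qed

end

context dvr_matrices
begin

definition form_grp :: "'k mat \<Rightarrow> 'k mat set" where
  "form_grp s = {x \<in> SLC. x\<^sup>T * s * x = s}"

text \<open>The isometry equation says that \<open>x\<close> is fixed by the automorphism sending
  \<open>x\<close> to its inverse transpose conjugated by the form. On \<open>SLC\<close> the
  inverse is the adjugate, which keeps the automorphism visibly integral and defined by
  polynomials.\<close>

lemma form_grp_congruence: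
  assumes s: "s \<in> MM 0" and s': "s' \<in> MM 0" and ss: "s' * s = 1\<^sub>m n" "s * s' = 1\<^sub>m n"
  shows "congruence_grp R \<pi> p e q n m (form_grp s)"
proof -
  interpret S: congruence_grp R \<pi> p e q n m SLC by (rule SLC_congruence)
  define \<theta> where "\<theta> x = s' * (adj_mat x)\<^sup>T * s" for x
  have sc: "s \<in> carrier_mat n n" "s' \<in> carrier_mat n n" using s s' MM_carrier by auto
  have assoc: "A * B * D = A * (B * D)"
    if "A \<in> carrier_mat n n" "B \<in> carrier_mat n n" "D \<in> carrier_mat n n" for A B D :: "'k mat"
    using that by (rule assoc_mult_mat)
  have mc: "A * B \<in> carrier_mat n n" if "A \<in> carrier_mat n n" "B \<in> carrier_mat n n" for A B :: "'k mat"
    using that by simp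
  have ss_cancel: "s' * (s * A) = A" "s * (s' * A) = A" if A: "A \<in> carrier_mat n n" for A
    using assoc[OF sc(2,1) A] assoc[OF sc A] ss left_mult_one_mat[OF A] by simp_all
  have xc: "x \<in> carrier_mat n n" "adj_mat x \<in> carrier_mat n n" "(adj_mat x)\<^sup>T \<in> carrier_mat n n" "x\<^sup>T \<in> carrier_mat n n"
    if "x \<in> SLC" for x
    using S.C_carrier[OF that] S.C_carrier[OF adj_SLC(1)[OF that]] by auto
  have adjT: "(adj_mat x)\<^sup>T * x\<^sup>T = 1\<^sub>m n" "x\<^sup>T * (adj_mat x)\<^sup>T = 1\<^sub>m n" if x: "x \<in> SLC" for x
  proof -
    have one: "(1\<^sub>m n)\<^sup>T = (1\<^sub>m n :: 'k mat)" by simp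
    show "(adj_mat x)\<^sup>T * x\<^sup>T = 1\<^sub>m n"
      unfolding transpose_mult[OF xc(1,2)[OF x], symmetric] adj_SLC(3)[OF x] by (rule one)
    show "x\<^sup>T * (adj_mat x)\<^sup>T = 1\<^sub>m n"
      unfolding transpose_mult[OF xc(2,1)[OF x], symmetric] adj_SLC(2)[OF x] by (rule one)
  qed
  have adj_mult: "adj_mat (x * y) = adj_mat y * adj_mat x" if x: "x \<in> SLC" and y: "y \<in> SLC" for x y
  proof -
    have xy: "x * y \<in> SLC" using S.C_mult x y by blast
    note cx = xc(1,2)[OF x] and cy = xc(1,2)[OF y] and cxy = xc(1,2)[OF xy]
    have "x * y * (adj_mat y * adj_mat x) = x * (y * (adj_mat y * adj_mat x))"
      using cx cy by (intro assoc) auto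
    also have "y * (adj_mat y * adj_mat x) = adj_mat x"
      using assoc[OF cy(1) cy(2) cx(2)] adj_SLC(3)[OF y] left_mult_one_mat[OF cx(2)] by simp
    finally have e: "x * y * (adj_mat y * adj_mat x) = 1\<^sub>m n" using adj_SLC(3)[OF x] by simp
    have "adj_mat (x * y) = adj_mat (x * y) * (x * y * (adj_mat y * adj_mat x))"
      unfolding e using right_mult_one_mat[OF cxy(2)] by simp
    also have "\<dots> = adj_mat (x * y) * (x * y) * (adj_mat y * adj_mat x)"
      using cxy cx cy by (intro assoc[symmetric]) auto
    also have "\<dots> = adj_mat y * adj_mat x"
      using adj_SLC(2)[OF xy] left_mult_one_mat[OF mc[OF cy(2) cx(2)]] by simp
    finally show ?thesis .
  qed
  have \<theta>_eq: "\<theta> x = x \<longleftrightarrow> x\<^sup>T * s * x = s" if x: "x \<in> SLC" for x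
  proof -
    note c = xc[OF x]
    have 1: "\<theta> x = s' * ((adj_mat x)\<^sup>T * s)" unfolding \<theta>_def using assoc[OF sc(2) c(3) sc(1)] .
    have 2: "x\<^sup>T * s * x = x\<^sup>T * (s * x)" using assoc[OF c(4) sc(1) c(1)] .
    have "\<theta> x = x \<longleftrightarrow> (adj_mat x)\<^sup>T * s = s * x"
      unfolding 1 using ss_cancel(2)[OF mc[OF c(3) sc(1)]] ss_cancel(1)[OF c(1)] by metis
    also have "\<dots> \<longleftrightarrow> x\<^sup>T * (s * x) = s"
    proof
      assume e: "(adj_mat x)\<^sup>T * s = s * x"
      have "x\<^sup>T * ((adj_mat x)\<^sup>T * s) = s"
        using assoc[OF c(4,3) sc(1)] adjT(2)[OF x] left_mult_one_mat[OF sc(1)] by simp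
      then show "x\<^sup>T * (s * x) = s" by (simp add: e)
    next
      assume e: "x\<^sup>T * (s * x) = s"
      have "(adj_mat x)\<^sup>T * (x\<^sup>T * (s * x)) = s * x"
        using assoc[OF c(3,4) mc[OF sc(1) c(1)]] adjT(1)[OF x] left_mult_one_mat[OF mc[OF sc(1) c(1)]] by simp
      then show "(adj_mat x)\<^sup>T * s = s * x" by (simp add: e)
    qed
    finally show ?thesis by (simp add: 2)
  qed
  have \<theta>_mult: "\<theta> (x * y) = \<theta> x * \<theta> y" if x: "x \<in> SLC" and y: "y \<in> SLC" for x y
  proof -
    note cx = xc[OF x] and cy = xc[OF y]
    define a b where "a = (adj_mat x)\<^sup>T" and "b = (adj_mat y)\<^sup>T"
    have ab: "a \<in> carrier_mat n n" "b \<in> carrier_mat n n" using cx cy by (auto simp: a_def b_def)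
    have "\<theta> (x * y) = s' * (a * b) * s"
      unfolding \<theta>_def adj_mult[OF x y] using transpose_mult[OF cy(2) cx(2)] by (simp add: a_def b_def)
    also have "\<dots> = s' * (a * (b * s))"
      using assoc[OF sc(2) mc[OF ab] sc(1)] assoc[OF ab sc(1)] by simp
    also have "\<dots> = s' * (a * (s * (s' * (b * s))))"
      using ss_cancel(2)[OF mc[OF ab(2) sc(1)]] by simp
    also have "\<dots> = (s' * a * s) * (s' * b * s)"
      using assoc[OF sc(2) ab(2) sc(1)] assoc[OF sc(2) ab(1) sc(1)]
        assoc[OF sc(2) mc[OF ab(1) sc(1)] mc[OF sc(2) mc[OF ab(2) sc(1)]]]
        assoc[OF ab(1) sc(1) mc[OF sc(2) mc[OF ab(2) sc(1)]]] by simp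
    finally show ?thesis by (simp add: \<theta>_def a_def b_def)
  qed
  have diff: "\<theta> x - \<theta> y \<in> MM i" if xy: "adj_mat x - adj_mat y \<in> MM i" "x \<in> MM 0" "y \<in> MM 0" for x y i
  proof -
    have a: "adj_mat x \<in> MM 0" "adj_mat y \<in> MM 0" using xy adj_MM0 by auto
    note ac = MM_carrier[OF a(1)] MM_carrier[OF a(2)]
    have z: "A - A \<in> MM i" if "A \<in> carrier_mat n n" for A using that by (auto simp: MM_def)
    have "(adj_mat x)\<^sup>T - (adj_mat y)\<^sup>T \<in> MM i"
      using transpose_MM[OF xy(1)] transpose_minus[OF ac] by simp
    then have "s' * (adj_mat x)\<^sup>T - s' * (adj_mat y)\<^sup>T \<in> MM i"
      using ac by (intro MM_diff_mult[OF z[OF sc(2)] _ s' transpose_MM[OF a(1)] sc(2)]) auto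
    then show ?thesis unfolding \<theta>_def
      using sc ac by (intro MM_diff_mult[OF _ z[OF sc(1)] MM_multL[OF s' transpose_MM[OF a(2)]] s _ sc(1)]) auto
  qed
  have \<theta>_SLC: "\<theta> x \<in> SLC" if x: "x \<in> SLC" for x
  proof -
    have "adj_mat x \<in> GG" using adj_SLC(1)[OF x] by (simp add: SLC_def)
    have one: "\<theta> (1\<^sub>m n) = 1\<^sub>m n"
    proof -
      have "adj_mat (1\<^sub>m n) = (1\<^sub>m n :: 'k mat)"
        using adj_SLC(2)[OF S.C_one] right_mult_one_mat[OF xc(2)[OF S.C_one]] by simp
      then show ?thesis using right_mult_one_mat[OF sc(2)] ss by (simp add: \<theta>_def)
    qed
    have "adj_mat x - adj_mat (1\<^sub>m n) \<in> MM m"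
    proof -
      have "adj_mat (1\<^sub>m n) = (1\<^sub>m n :: 'k mat)"
        using adj_SLC(2)[OF S.C_one] right_mult_one_mat[OF xc(2)[OF S.C_one]] by simp
      then show ?thesis using \<open>adj_mat x \<in> GG\<close> by (simp add: GG_def)
    qed
    from diff[OF this S.C_MM0[OF x] MM_one] have "\<theta> x - 1\<^sub>m n \<in> MM m" by (simp add: one)
    moreover have tc: "\<theta> x \<in> carrier_mat n n" unfolding \<theta>_def using mc[OF mc[OF sc(2) xc(3)[OF x]] sc(1)] .
    moreover have "det (\<theta> x) = 1"
    proof -
      have "det (\<theta> x) = det s' * det (adj_mat x) * det s"
        unfolding \<theta>_def using det_mult[OF mc[OF sc(2) xc(3)[OF x]] sc(1)] det_mult[OF sc(2) xc(3)[OF x]]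
          det_transpose[OF xc(2)[OF x]] by simp
      also have "det (adj_mat x) = 1" using adj_SLC(1)[OF x] by (simp add: SLC_def)
      also have "det s' * 1 * det s = det (s' * s)" using det_mult[OF sc(2,1)] by simp
      finally show ?thesis by (simp add: ss)
    qed
    ultimately show ?thesis by (simp add: SLC_def GG_def)
  qed
  have adj_diff: "adj_mat x - adj_mat y \<in> MM i" if x: "x \<in> SLC" and y: "y \<in> SLC" and d: "x - y \<in> MM i" for x y i
  proof -
    have inv: "inv\<^bsub>S.G\<^esub> z = adj_mat z" if "z \<in> SLC" for z
      using S.inv_equality[of "adj_mat z" z] adj_SLC[OF that] that by simp
    have "y - x \<in> MM i" using MM_cong_sym[OF xc(1)[OF x] xc(1)[OF y] d] .
    then have "adj_mat x * y - 1\<^sub>m n \<in> MM i" using S.cong_iff[OF x y, of i] inv[OF x] by simp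
    then have "adj_mat x * y * adj_mat y - 1\<^sub>m n * adj_mat y \<in> MM i"
      using S.C_MM0[OF adj_SLC(1)[OF y]] MM_one xc(2)[OF x] xc(1,2)[OF y]
      by (intro MM_diff_mult) (auto simp: MM_def)
    moreover have "adj_mat x * y * adj_mat y = adj_mat x"
      using assoc[OF xc(2)[OF x] xc(1,2)[OF y]] adj_SLC(3)[OF y] right_mult_one_mat[OF xc(2)[OF x]] by simp
    ultimately show ?thesis using left_mult_one_mat[OF xc(2)[OF y]] by simp
  qed
  have "congruence_grp R \<pi> p e q n m {x \<in> SLC. \<theta> x = x}"
  proof (rule S.fixed_points_congruence)
    show "\<theta> \<in> hom S.G S.G" using \<theta>_SLC \<theta>_mult by (auto intro!: homI)
    show "\<theta> x - \<theta> y \<in> MM i" if "x \<in> SLC" "y \<in> SLC" "x - y \<in> MM i" for x y i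
      using diff[OF adj_diff[OF that] S.C_MM0 S.C_MM0] that by simp
  qed
  moreover have "{x \<in> SLC. \<theta> x = x} = form_grp s" using \<theta>_eq by (auto simp: form_grp_def)
  ultimately show ?thesis by simp
qed

end

section \<open>Conjugation by a diagonal matrix\<close>

locale weighted_grp = congruence_grp R \<pi> p e q n m C
  for R :: "'k::field set" and \<pi> and p e q n m C +
  fixes k :: nat and c :: "nat \<Rightarrow> nat" and b :: nat
  assumes C_SLC: "C \<subseteq> SLC" and b_less: "b < n" and k_pos: "1 \<le> k" and c_b: "c b = 0"
    and c_pos: "j < n \<Longrightarrow> j \<noteq> b \<Longrightarrow> 1 \<le> c j"
begin

definition conj :: "'k mat \<Rightarrow> 'k mat" where
  "conj x = Matrix.mat n n (\<lambda>(i, j). x $$ (i, j) * \<pi> ^ (k * c j) / \<pi> ^ (k * c i))"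

text \<open>Taking the whole preimage of \<open>C\<close> makes \<open>D\<close> a subgroup at once;
  the congruences that describe it are recovered from \<open>conj_SLC_iff\<close>.\<close>

definition D :: "'k mat set" where
  "D = {x \<in> C. conj x \<in> C}"

lemma conj_carrier [simp]: "conj x \<in> carrier_mat n n" by (simp add: conj_def)

lemma conj_index: "i < n \<Longrightarrow> j < n \<Longrightarrow> conj x $$ (i, j) = x $$ (i, j) * \<pi> ^ (k * c j) / \<pi> ^ (k * c i)"
  by (simp add: conj_def)

lemma conj_mult:
  assumes "x \<in> carrier_mat n n" "y \<in> carrier_mat n n"
  shows "conj (x * y) = conj x * conj y"
proof (rule eq_matI)
  fix i j assume "i < dim_row (conj x * conj y)" "j < dim_col (conj x * conj y)"
  then have ij: "i < n" "j < n" by (auto simp: conj_def)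
  have "conj (x * y) $$ (i, j) = (\<Sum>l<n. x $$ (i, l) * y $$ (l, j)) * \<pi> ^ (k * c j) / \<pi> ^ (k * c i)"
    using ij by (simp only: conj_index index_mult_sum[OF assms ij])
  also have "\<dots> = (\<Sum>l<n. conj x $$ (i, l) * conj y $$ (l, j))"
    unfolding sum_distrib_right sum_divide_distrib
    by (intro sum.cong) (use ij in \<open>auto simp: conj_index\<close>)
  also have "\<dots> = (conj x * conj y) $$ (i, j)"
    using index_mult_sum[OF conj_carrier conj_carrier ij] by simp
  finally show "conj (x * y) $$ (i, j) = (conj x * conj y) $$ (i, j)" .
qed (auto simp: conj_def)

lemma conj_one: "conj (1\<^sub>m n) = 1\<^sub>m n"
  by (rule eq_matI) (auto simp: conj_def)

lemma det_conj:
  assumes x: "x \<in> carrier_mat n n"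
  shows "det (conj x) = det x"
proof -
  define P where "P = Matrix.mat n n (\<lambda>(i, j). if i = j then \<pi> ^ (k * c i) else 0)"
  define Q where "Q = Matrix.mat n n (\<lambda>(i, j). if i = j then 1 / \<pi> ^ (k * c i) else 0)"
  have PQc: "P \<in> carrier_mat n n" "Q \<in> carrier_mat n n" by (auto simp: P_def Q_def)
  have "P * Q = 1\<^sub>m n"
  proof (rule eq_matI)
    fix i j assume "i < dim_row (1\<^sub>m n :: 'k mat)" "j < dim_col (1\<^sub>m n :: 'k mat)"
    then have ij: "i < n" "j < n" by auto
    have "(P * Q) $$ (i, j) = (\<Sum>l<n. if l = i then \<pi> ^ (k * c i) * Q $$ (i, j) else 0)"
      unfolding index_mult_sum[OF PQc ij] by (intro sum.cong) (use ij in \<open>auto simp: P_def\<close>)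
    also have "\<dots> = 1\<^sub>m n $$ (i, j)" using ij by (simp add: Q_def)
    finally show "(P * Q) $$ (i, j) = 1\<^sub>m n $$ (i, j)" .
  qed (use PQc in auto)
  then have "det P * det Q = 1" using det_mult[OF PQc] by simp
  then have "det P \<noteq> 0" by auto
  have "P * conj x = x * P"
  proof (rule eq_matI)
    fix i j assume "i < dim_row (x * P)" "j < dim_col (x * P)"
    then have ij: "i < n" "j < n" using x PQc by auto
    have "(P * conj x) $$ (i, j) = (\<Sum>l<n. if l = i then \<pi> ^ (k * c i) * conj x $$ (i, j) else 0)"
      unfolding index_mult_sum[OF PQc(1) conj_carrier ij] by (intro sum.cong) (use ij in \<open>auto simp: P_def\<close>)
    also have "\<dots> = x $$ (i, j) * \<pi> ^ (k * c j)" using ij by (simp add: conj_index)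
    also have "\<dots> = (\<Sum>l<n. if l = j then x $$ (i, j) * \<pi> ^ (k * c j) else 0)" using ij by simp
    also have "\<dots> = (x * P) $$ (i, j)"
      unfolding index_mult_sum[OF x PQc(1) ij] by (intro sum.cong) (use ij in \<open>auto simp: P_def\<close>)
    finally show "(P * conj x) $$ (i, j) = (x * P) $$ (i, j)" .
  qed (use x PQc in \<open>auto simp: conj_def\<close>)
  then have "det P * det (conj x) = det x * det P"
    using det_mult[OF PQc(1) conj_carrier] det_mult[OF x PQc(1)] by metis
  then show ?thesis using \<open>det P \<noteq> 0\<close> by simp
qed

text \<open>Conjugation divides the entry \<open>(i, j)\<close> by a power of \<open>\<pi>\<close>
  when \<open>c j < c i\<close> and multiplies it by one otherwise. Hence only entries of the first
  kind impose a condition, and these are off the diagonal.\<close>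

lemma conj_SLC_iff:
  assumes x: "x \<in> SLC"
  shows "conj x \<in> SLC \<longleftrightarrow> (\<forall>i<n. \<forall>j<n. c j < c i \<longrightarrow> x $$ (i, j) \<in> L (m + k * (c i - c j)))"
proof -
  have xG: "x \<in> GG" and d: "det x = 1" using x by (auto simp: SLC_def)
  note xc = GG_carrier[OF xG]
  have ent: "(conj x - 1\<^sub>m n) $$ (i, j) \<in> L m \<longleftrightarrow> (c j < c i \<longrightarrow> x $$ (i, j) \<in> L (m + k * (c i - c j)))"
    if ij: "i < n" "j < n" for i j
  proof -
    have x1: "x $$ (i, j) - 1\<^sub>m n $$ (i, j) \<in> L m"
      using xG MM_D[of "x - 1\<^sub>m n" m i j] ij xc by (simp add: GG_def)
    show ?thesis
    proof (cases "c j < c i")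
      case True
      then have ne: "i \<noteq> j" by auto
      have "k * c i = k * (c i - c j) + k * c j" using True by (simp flip: add_mult_distrib2)
      then have "conj x $$ (i, j) = x $$ (i, j) / \<pi> ^ (k * (c i - c j))"
        using ij by (simp add: conj_index power_add)
      then show ?thesis using True ne ij by (simp add: lev_def power_add mult.commute)
    next
      case False
      then have "k * c j = k * (c j - c i) + k * c i" by (simp flip: add_mult_distrib2)
      then have "conj x $$ (i, j) = x $$ (i, j) * \<pi> ^ (k * (c j - c i))"
        using ij by (simp add: conj_index power_add)
      then have "(conj x - 1\<^sub>m n) $$ (i, j) = (x $$ (i, j) - 1\<^sub>m n $$ (i, j)) * \<pi> ^ (k * (c j - c i))"
        using ij False by (cases "i = j") auto
      also have "\<dots> \<in> L m" using x1 by (intro lev_multR power_closed) auto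
      finally show ?thesis using False by simp
    qed
  qed
  have "conj x \<in> SLC \<longleftrightarrow> conj x - 1\<^sub>m n \<in> MM m"
    using det_conj[OF xc] d by (simp add: SLC_def GG_def)
  also have "\<dots> \<longleftrightarrow> (\<forall>i<n. \<forall>j<n. (conj x - 1\<^sub>m n) $$ (i, j) \<in> L m)"
    unfolding MM_def using minus_carrier_mat[of "1\<^sub>m n" n n "conj x"] by simp
  also have "\<dots> \<longleftrightarrow> (\<forall>i<n. \<forall>j<n. c j < c i \<longrightarrow> x $$ (i, j) \<in> L (m + k * (c i - c j)))"
    using ent by auto
  finally show ?thesis .
qed

lemma subgroup_D: "subgroup D G"
proof (rule subgroupI)
  show "D \<subseteq> carrier G" by (auto simp: D_def)
  have "1\<^sub>m n \<in> D" using C_one conj_one by (simp add: D_def)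
  then show "D \<noteq> {}" by auto
  fix x assume x: "x \<in> D"
  then have xC: "x \<in> C" "conj x \<in> C" by (auto simp: D_def)
  have xi: "inv\<^bsub>G\<^esub> x \<in> C" using inv_closed[of x] xC by simp
  have "conj (inv\<^bsub>G\<^esub> x) * conj x = conj (inv\<^bsub>G\<^esub> x * x)"
    using conj_mult[OF C_carrier[OF xi] C_carrier[OF xC(1)]] by simp
  also have "\<dots> = 1\<^sub>m n" using l_inv[of x] xC conj_one by simp
  finally have e: "conj (inv\<^bsub>G\<^esub> x) * conj x = 1\<^sub>m n" .
  define z where "z = inv\<^bsub>G\<^esub> (conj x)"
  have z: "z \<in> C" "conj x * z = 1\<^sub>m n" using inv_closed[of "conj x"] r_inv[of "conj x"] xC by (auto simp: z_def)
  have "conj (inv\<^bsub>G\<^esub> x) * (conj x * z) = 1\<^sub>m n * z"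
    unfolding e[symmetric]
    using assoc_mult_mat[OF conj_carrier conj_carrier C_carrier[OF z(1)]] by (rule sym)
  then have "conj (inv\<^bsub>G\<^esub> x) = z" using z right_mult_one_mat[OF conj_carrier] by simp
  then show "inv\<^bsub>G\<^esub> x \<in> D" using xi z by (simp add: D_def)
  fix y assume "y \<in> D"
  then show "x \<otimes>\<^bsub>G\<^esub> y \<in> D" using xC C_mult conj_mult C_carrier by (simp add: D_def)
qed

lemma conj_iterate_index: "j < n \<Longrightarrow> ((conj ^^ i) x) $$ (j, b) = x $$ (j, b) / \<pi> ^ (i * (k * c j))"
  by (induction i) (auto simp: conj_index b_less c_b power_add)

text \<open>Elements of an invariant normal subgroup stabilise the line spanned by the \<open>b\<close>-th basis vector,
  and so do all their conjugates; \<open>eigen\<close> says that only scalars stabilise all the resulting lines.\<close>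

theorem self_similar_G:
  assumes eigen: "\<And>x. x \<in> C \<Longrightarrow> (\<And>u. u \<in> C \<Longrightarrow> \<exists>r. \<forall>j<n. (x * u) $$ (j, b) = r * u $$ (j, b)) \<Longrightarrow>
      \<exists>r. x = r \<cdot>\<^sub>m 1\<^sub>m n"
    and A: "finite A" "card A = \<delta>"
    and U: "\<And>a. a \<in> A \<Longrightarrow> U a \<in> C"
    and trans: "\<And>x. x \<in> C \<Longrightarrow> \<exists>!a. a \<in> A \<and> inv\<^bsub>G\<^esub> (U a) * x \<in> D"
  shows "self_similar G \<delta>"
proof -
  obtain h where h: "bij_betw h {..<\<delta>} A"
    using ex_bij_betw_nat_finite[OF A(1)] A(2) by (auto simp: lessThan_atLeast0)
  have hA: "i < \<delta> \<Longrightarrow> h i \<in> A" for i using h by (auto simp: bij_betw_def)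
  have "virtual_endo G D conj \<delta> (\<lambda>i. U (h i))"
  proof (rule virtual_endo.intro[OF is_group virtual_endo_axioms.intro])
    show "subgroup D G" by (rule subgroup_D)
    show "conj x \<in> carrier G" if "x \<in> D" for x using that by (simp add: D_def)
    show "conj (x \<otimes>\<^bsub>G\<^esub> y) = conj x \<otimes>\<^bsub>G\<^esub> conj y" if "x \<in> D" "y \<in> D" for x y
      using that conj_mult C_carrier by (simp add: D_def)
    show "U (h i) \<in> carrier G" if "i < \<delta>" for i using U hA that by simp
    show "\<exists>!i. i < \<delta> \<and> inv\<^bsub>G\<^esub> (U (h i)) \<otimes>\<^bsub>G\<^esub> x \<in> D" if x: "x \<in> carrier G" for x
    proof -
      obtain a where a: "a \<in> A" "inv\<^bsub>G\<^esub> (U a) * x \<in> D" "\<And>a'. a' \<in> A \<Longrightarrow> inv\<^bsub>G\<^esub> (U a') * x \<in> D \<Longrightarrow> a' = a"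
        using trans[of x] x by auto
      obtain i where i: "i < \<delta>" "h i = a" using h a(1) by (auto simp: bij_betw_def)
      show ?thesis
      proof (rule ex1I[of _ i])
        show "i < \<delta> \<and> inv\<^bsub>G\<^esub> (U (h i)) \<otimes>\<^bsub>G\<^esub> x \<in> D" using i a(2) by simp
        fix i' assume i': "i' < \<delta> \<and> inv\<^bsub>G\<^esub> (U (h i')) \<otimes>\<^bsub>G\<^esub> x \<in> D"
        then have "h i' = a" using a(3)[of "h i'"] hA[of i'] by simp
        then show "i' = i" using i i' h by (auto simp: bij_betw_def inj_on_def)
      qed
    qed
    show "N = {\<one>\<^bsub>G\<^esub>}" if N: "N \<lhd> G" "N \<subseteq> D" "conj ` N \<subseteq> N" for N
    proof -
      have NC: "N \<subseteq> C" using N(2) by (auto simp: D_def)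
      \<comment> \<open>All iterates of \<open>conj\<close> stay in \<open>N\<close> and so have
        integral entries, while each iteration divides this entry by
        \<open>\<pi> ^ (k * c j)\<close>. By separatedness the entry vanishes.\<close>
      have zero: "x $$ (j, b) = 0" if x: "x \<in> N" and j: "j < n" "j \<noteq> b" for x j
      proof (rule separated)
        fix i
        have it: "(conj ^^ i) x \<in> N" for i by (induction i) (use x N(3) in auto)
        have "((conj ^^ i) x) $$ (j, b) \<in> R" using MM0_D[OF C_MM0 j(1) b_less] it NC by blast
        then have "x $$ (j, b) \<in> L (i * (k * c j))"
          by (simp add: conj_iterate_index[OF j(1)] lev_def)
        moreover have "i * 1 \<le> i * (k * c j)" using k_pos c_pos[OF j] by (intro mult_left_mono) auto
        ultimately show "x $$ (j, b) \<in> L i" using lev_mono by auto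
      qed
      have "x = 1\<^sub>m n" if x: "x \<in> N" for x
      proof -
        have xC: "x \<in> C" using x NC by blast
        note xc = C_carrier[OF xC]
        have "\<exists>r. \<forall>j<n. (x * u) $$ (j, b) = r * u $$ (j, b)" if u: "u \<in> C" for u
        proof -
          have ui: "inv\<^bsub>G\<^esub> u \<in> C" and uu: "u * inv\<^bsub>G\<^esub> u = 1\<^sub>m n" using inv_closed[of u] r_inv[of u] u by auto
          \<comment> \<open>By normality this conjugate is in \<open>N\<close> too, so its column
            \<open>b\<close> is a multiple of the basis vector; moving \<open>u\<close> back makes
            column \<open>b\<close> of \<open>u\<close> an eigenvector of \<open>x\<close>.\<close>
          define y where "y = inv\<^bsub>G\<^esub> u * x * u"
          have y: "y \<in> N" unfolding y_def using normal.inv_op_closed1[OF N(1), of u x] u x by simp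
          have yc: "y \<in> carrier_mat n n" using C_carrier y NC by blast
          note cs = C_carrier[OF u] C_carrier[OF ui]
          have "u * y = u * inv\<^bsub>G\<^esub> u * (x * u)"
            unfolding y_def using cs xc
            by (simp add: assoc_mult_mat[of _ n n _ n _ n])
          then have uy: "x * u = u * y" using uu left_mult_one_mat[of "x * u" n n] cs xc by simp
          have "(x * u) $$ (j, b) = y $$ (b, b) * u $$ (j, b)" if j: "j < n" for j
          proof -
            have "(x * u) $$ (j, b) = (\<Sum>l<n. u $$ (j, l) * y $$ (l, b))"
              unfolding uy index_mult_sum[OF cs(1) yc j b_less] ..
            also have "\<dots> = (\<Sum>l<n. if l = b then u $$ (j, b) * y $$ (b, b) else 0)"
              by (intro sum.cong) (auto simp: zero[OF y])
            finally show ?thesis using b_less by simp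
          qed
          then show ?thesis by blast
        qed
        then obtain r where r: "x = r \<cdot>\<^sub>m 1\<^sub>m n" using eigen[OF xC] by blast
        have "det x = 1" using xC C_SLC by (auto simp: SLC_def)
        then have rn: "r ^ n = 1" unfolding r by (simp add: det_smult)
        have "x ^\<^sub>m i = r ^ i \<cdot>\<^sub>m 1\<^sub>m n" for i
        proof (induction i)
          case 0
          show ?case using xc by (intro eq_matI) auto
        next
          case (Suc i)
          have "(r ^ i \<cdot>\<^sub>m 1\<^sub>m n) * x = r ^ i \<cdot>\<^sub>m (1\<^sub>m n * x)" using xc by (intro mult_smult_assoc_mat) auto
          also have "1\<^sub>m n * x = x" using xc by simp
          also have "r ^ i \<cdot>\<^sub>m x = r ^ Suc i \<cdot>\<^sub>m 1\<^sub>m n" unfolding r by (intro eq_matI) auto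
          finally show ?case using Suc by simp
        qed
        then have "x ^\<^sub>m n = 1 \<cdot>\<^sub>m 1\<^sub>m n" by (simp only: rn)
        also have "1 \<cdot>\<^sub>m 1\<^sub>m n = (1\<^sub>m n :: 'k mat)" by (rule eq_matI) auto
        finally have "x [^]\<^bsub>G\<^esub> n = 1\<^sub>m n" using pow_G[OF xC] by simp
        then show ?thesis using torsion_free_C[OF xC, of n] b_less by simp
      qed
      then have "N \<subseteq> {1\<^sub>m n}" by (simp add: subset_iff)
      moreover have "1\<^sub>m n \<in> N" using subgroup.one_closed[OF normal_imp_subgroup[OF N(1)]] by simp
      ultimately have "N = {1\<^sub>m n}" by (simp add: subset_antisym)
      then show ?thesis by simp
    qed
  qed
  then show ?thesis by (rule virtual_endo.self_similar)
qed

text \<open>Three eigenvectors per index suffice: the basis vector at \<open>b\<close> alone, and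
  the same plus \<open>t * \<pi> ^ m\<close> times the basis vector at \<open>i\<close> for
  \<open>t = 1, 2\<close>. The coordinate at \<open>i\<close> shows that both have eigenvalue
  \<open>x $$ (i, i)\<close>; comparing the coordinates at \<open>b\<close> then forces
  \<open>x $$ (b, i) = 0\<close>. The factor \<open>\<pi> ^ m\<close> makes these vectors columns of
  congruence matrices.\<close>

lemma scalar_of_eigenvectors:
  assumes x: "x \<in> carrier_mat n n"
    and eig: "\<And>v. v b = 1 \<Longrightarrow> (\<And>j. j \<noteq> b \<Longrightarrow> v j \<in> L m) \<Longrightarrow>
      \<exists>r. \<forall>j<n. (\<Sum>l<n. x $$ (j, l) * v l) = r * v j"
  shows "\<exists>r. x = r \<cdot>\<^sub>m 1\<^sub>m n"
proof -
  have "\<exists>r. \<forall>j<n. (\<Sum>l<n. x $$ (j, l) * (if l = b then 1 else 0)) = r * (if j = b then 1 else 0)"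
    by (rule eig) auto
  then obtain r0 where r0: "\<forall>j<n. (\<Sum>l<n. x $$ (j, l) * (if l = b then 1 else 0)) = r0 * (if j = b then 1 else 0)" ..
  then have col: "x $$ (j, b) = (if j = b then r0 else 0)" if "j < n" for j
  proof -
    have "(\<Sum>l<n. x $$ (j, l) * (if l = b then 1 else 0)) = (\<Sum>l<n. if l = b then x $$ (j, b) else 0)"
      by (intro sum.cong) auto
    also have "\<dots> = x $$ (j, b)" using b_less by simp
    finally have "x $$ (j, b) = r0 * (if j = b then 1 else 0)" using r0 that by simp
    then show ?thesis by simp
  qed
  have entry: "x $$ (j, i) = (if j = i then r0 else 0)" if i: "i < n" "i \<noteq> b" and j: "j < n" for i j
  proof -
    have two: "\<exists>r. \<forall>j<n. x $$ (j, b) + of_nat t * \<pi> ^ m * x $$ (j, i) =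
        r * (if j = b then 1 else if j = i then of_nat t * \<pi> ^ m else 0)" for t
    proof -
      have "\<exists>r. \<forall>j<n. (\<Sum>l<n. x $$ (j, l) * (if l = b then 1 else if l = i then of_nat t * \<pi> ^ m else 0)) =
          r * (if j = b then 1 else if j = i then of_nat t * \<pi> ^ m else 0)"
        by (rule eig) (auto intro: lev_multL lev_pi)
      moreover have "(\<Sum>l<n. x $$ (j, l) * (if l = b then 1 else if l = i then of_nat t * \<pi> ^ m else 0)) =
          x $$ (j, b) + of_nat t * \<pi> ^ m * x $$ (j, i)" for j
      proof -
        have "(\<Sum>l<n. x $$ (j, l) * (if l = b then 1 else if l = i then of_nat t * \<pi> ^ m else 0)) =
            (\<Sum>l<n. (if l = b then x $$ (j, b) else 0) + (if l = i then of_nat t * \<pi> ^ m * x $$ (j, i) else 0))"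
          by (intro sum.cong) (use i in auto)
        then show ?thesis using i b_less by (simp add: sum.distrib)
      qed
      ultimately show ?thesis by simp
    qed
    obtain r1 where r1: "\<forall>j<n. x $$ (j, b) + of_nat 1 * \<pi> ^ m * x $$ (j, i) =
        r1 * (if j = b then 1 else if j = i then of_nat 1 * \<pi> ^ m else 0)" using two by blast
    obtain r2 where r2: "\<forall>j<n. x $$ (j, b) + of_nat 2 * \<pi> ^ m * x $$ (j, i) =
        r2 * (if j = b then 1 else if j = i then of_nat 2 * \<pi> ^ m else 0)" using two by blast
    have n2: "(2 :: 'k) \<noteq> 0" using of_nat_nonzero[of 2] by simp
    have "x $$ (i, i) = r1" "x $$ (i, i) = r2"
      using r1[rule_format, OF i(1)] r2[rule_format, OF i(1)] i col[OF i(1)] n2 by auto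
    moreover have "r0 + \<pi> ^ m * x $$ (b, i) = r1" "r0 + 2 * \<pi> ^ m * x $$ (b, i) = r2"
      using r1[rule_format, OF b_less] r2[rule_format, OF b_less] col[OF b_less] by auto
    ultimately have rr: "x $$ (i, i) = r0 + \<pi> ^ m * x $$ (b, i)"
      "r0 + \<pi> ^ m * x $$ (b, i) = r0 + 2 * (\<pi> ^ m * x $$ (b, i))" by (simp_all add: mult.assoc)
    from rr(2) have "\<pi> ^ m * x $$ (b, i) = \<pi> ^ m * x $$ (b, i) + \<pi> ^ m * x $$ (b, i)"
      by (simp only: mult_2 add_left_cancel)
    then have "\<pi> ^ m * x $$ (b, i) = 0" by (metis add_cancel_right_right)
    with rr(1) have "\<pi> ^ m * x $$ (b, i) = 0" "x $$ (i, i) = r0" by auto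
    then have "x $$ (b, i) = 0" "x $$ (i, i) = r0" by auto
    moreover have "x $$ (j, i) = 0" if "j \<noteq> i" "j \<noteq> b"
      using r1[rule_format, OF j] col[OF j] that by auto
    ultimately show ?thesis using i by auto
  qed
  have "x = r0 \<cdot>\<^sub>m 1\<^sub>m n"
  proof (rule eq_matI)
    fix j i assume "j < dim_row (r0 \<cdot>\<^sub>m 1\<^sub>m n)" "i < dim_col (r0 \<cdot>\<^sub>m 1\<^sub>m n)"
    then have ji: "j < n" "i < n" by auto
    then have "x $$ (j, i) = (if j = i then r0 else 0)" using col entry by (cases "i = b") auto
    then show "x $$ (j, i) = (r0 \<cdot>\<^sub>m 1\<^sub>m n) $$ (j, i)" using ji by simp
  qed (use x in auto)
  then show ?thesis by (rule exI)
qed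

lemma mult_column:
  assumes "x \<in> carrier_mat n n" "u \<in> carrier_mat n n" "j < n" "\<And>l. l < n \<Longrightarrow> u $$ (l, b) = v l"
  shows "(x * u) $$ (j, b) = (\<Sum>l<n. x $$ (j, l) * v l)"
  using assms b_less by (subst index_mult_sum) auto

end

section \<open>The special linear group\<close>

locale SL_grp = dvr_matrices R \<pi> p e q n m for R :: "'k::field set" and \<pi> and p e q n m +
  fixes k :: nat
  assumes n_pos: "1 \<le> n" and k_pos: "1 \<le> k"
begin

sublocale weighted_grp R \<pi> p e q n m SLC k "\<lambda>i. if i = 0 then 0 else 1" 0
  by (rule weighted_grp.intro[OF SLC_congruence weighted_grp_axioms.intro]) (use n_pos k_pos in auto)

definition U :: "(nat \<Rightarrow> 'k) \<Rightarrow> 'k mat" where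
  "U a = Matrix.mat n n (\<lambda>(i, j). if i = j then 1 else if j = 0 then a i else 0)"

lemma U_carrier: "U a \<in> carrier_mat n n" by (simp add: U_def)

lemma U_mult_index:
  assumes "y \<in> carrier_mat n n" "i < n" "j < n"
  shows "(U a * y) $$ (i, j) = y $$ (i, j) + (if i = 0 then 0 else a i * y $$ (0, j))"
proof -
  have "(U a * y) $$ (i, j) = (\<Sum>l<n. (if l = i then y $$ (i, j) else 0) +
      (if l = 0 then (if i = 0 then 0 else a i * y $$ (0, j)) else 0))"
    unfolding index_mult_sum[OF U_carrier assms] by (intro sum.cong) (use assms in \<open>auto simp: U_def\<close>)
  then show ?thesis using assms n_pos by (simp add: sum.distrib)
qed

lemma U_SLC:
  assumes "\<And>i. 1 \<le> i \<Longrightarrow> i < n \<Longrightarrow> a i \<in> L m"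
  shows "U a \<in> SLC"
proof -
  have "det (U a) = prod_list (diag_mat (U a))"
    by (rule det_lower_triangular[OF _ U_carrier]) (auto simp: U_def)
  also have "diag_mat (U a) = replicate n 1"
    by (rule nth_equalityI) (auto simp: diag_mat_def U_def)
  finally have "det (U a) = 1" by simp
  moreover have "U a - 1\<^sub>m n \<in> MM m"
    using assms by (intro MM_I) (auto simp: U_def)
  ultimately show ?thesis by (simp add: SLC_def GG_def U_carrier)
qed

lemma inv_U:
  assumes "\<And>i. 1 \<le> i \<Longrightarrow> i < n \<Longrightarrow> a i \<in> L m"
  shows "inv\<^bsub>G\<^esub> (U a) = U (\<lambda>i. - a i)"
proof -
  have "U (\<lambda>i. - a i) * U a = 1\<^sub>m n"
  proof (rule eq_matI)
    fix i j assume "i < dim_row (1\<^sub>m n :: 'k mat)" "j < dim_col (1\<^sub>m n :: 'k mat)"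
    then have ij: "i < n" "j < n" by auto
    show "(U (\<lambda>i. - a i) * U a) $$ (i, j) = 1\<^sub>m n $$ (i, j)"
      unfolding U_mult_index[OF U_carrier ij] using ij by (auto simp: U_def)
  qed (use U_carrier in auto)
  moreover have "U (\<lambda>i. - a i) \<in> SLC" using assms by (intro U_SLC lev_uminus)
  ultimately show ?thesis using inv_equality[of "U (\<lambda>i. - a i)" "U a"] U_SLC[OF assms] by simp
qed

lemma D_iff: "x \<in> SLC \<Longrightarrow> x \<in> D \<longleftrightarrow> (\<forall>i. 1 \<le> i \<longrightarrow> i < n \<longrightarrow> x $$ (i, 0) \<in> L (m + k))"
  using conj_SLC_iff[of x] n_pos by (auto simp: D_def)

text \<open>The coset of \<open>x\<close> is determined by its first column divided by the unit in
  the corner, modulo \<open>\<pi> ^ (m + k)\<close>. The \<open>n - 1\<close> lower entries of the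
  normalised column lie in \<open>L m\<close>, so there are \<open>q ^ k\<close> choices for each,
  realised by the unipotent matrices \<open>U a\<close>.\<close>

theorem self_similar_SLC: "self_similar (matrix_group n SLC) (q ^ ((n - 1) * k))"
proof -
  obtain T where T: "finite T" "card T = q ^ k" "T \<subseteq> L m" "\<forall>x\<in>L m. \<exists>!t. t \<in> T \<and> x - t \<in> L (m + k)"
    using lev_transversal[of k m] by auto
  define A where "A = PiE {1..<n} (\<lambda>_. T)"
  have Am: "a i \<in> L m" if "a \<in> A" "1 \<le> i" "i < n" for a i
    using that T(3) by (auto simp: A_def PiE_def Pi_def)
  show ?thesis
  proof (rule self_similar_G)
    show "finite A" unfolding A_def using T by (intro finite_PiE) auto
    show "card A = q ^ ((n - 1) * k)"
      unfolding A_def using T by (simp add: card_PiE mult.commute flip: power_mult)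
    show "U a \<in> SLC" if "a \<in> A" for a using Am[OF that] by (intro U_SLC)
    show "\<exists>!a. a \<in> A \<and> inv\<^bsub>G\<^esub> (U a) * x \<in> D" if x: "x \<in> SLC" for x
    proof -
      note xc = C_carrier[OF x]
      have xe: "x $$ (i, j) - 1\<^sub>m n $$ (i, j) \<in> L m" if "i < n" "j < n" for i j
        using x MM_D[of "x - 1\<^sub>m n" m i j] that xc by (simp add: SLC_def GG_def)
      define r where "r = x $$ (0, 0)"
      have r: "r \<noteq> 0" "inverse r \<in> R" "r \<in> R"
        using unit_one_plus[of r] xe[of 0 0] n_pos m_pos lev_mono[of _ m 1] MM0_D[OF C_MM0[OF x], of 0 0]
        by (auto simp: r_def)
      define w where "w i = x $$ (i, 0) * inverse r" for i
      have w: "w i \<in> L m" if "1 \<le> i" "i < n" for i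
        using xe[of i 0] that n_pos r(2) by (auto simp: w_def intro: lev_multR)
      have iff: "inv\<^bsub>G\<^esub> (U a) * x \<in> D \<longleftrightarrow> (\<forall>i. 1 \<le> i \<longrightarrow> i < n \<longrightarrow> w i - a i \<in> L (m + k))" if a: "a \<in> A" for a
      proof -
        have S: "U (\<lambda>i. - a i) * x \<in> SLC" using x Am[OF a] by (intro C_mult U_SLC lev_uminus)
        have "(U (\<lambda>i. - a i) * x) $$ (i, 0) \<in> L (m + k) \<longleftrightarrow> w i - a i \<in> L (m + k)" if i: "1 \<le> i" "i < n" for i
        proof -
          have e: "(U (\<lambda>i. - a i) * x) $$ (i, 0) = (w i - a i) * r"
            using U_mult_index[OF xc, of i 0 "\<lambda>i. - a i"] i n_pos r(1)
            by (simp add: w_def r_def algebra_simps)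
          have "w i - a i = ((w i - a i) * r) * inverse r" using r(1) by simp
          then show ?thesis unfolding e using lev_multR[OF _ r(3), of "w i - a i"] lev_multR[OF _ r(2), of "(w i - a i) * r"] by metis
        qed
        then show ?thesis using inv_U[OF Am[OF a]] D_iff[OF S] by auto
      qed
      obtain g where g: "\<And>x. x \<in> L m \<Longrightarrow> g x \<in> T \<and> x - g x \<in> L (m + k)" using T(4) by metis
      define a where "a = restrict (\<lambda>i. g (w i)) {1..<n}"
      have aA: "a \<in> A" using g w by (auto simp: A_def a_def)
      show ?thesis
      proof (rule ex1I[of _ a])
        show "a \<in> A \<and> inv\<^bsub>G\<^esub> (U a) * x \<in> D" using aA iff[OF aA] g w by (auto simp: a_def)
        fix a' assume a': "a' \<in> A \<and> inv\<^bsub>G\<^esub> (U a') * x \<in> D"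
        show "a' = a"
        proof (rule PiE_ext[of a' "{1..<n}" "\<lambda>_. T" a])
          show "a' \<in> PiE {1..<n} (\<lambda>_. T)" "a \<in> PiE {1..<n} (\<lambda>_. T)" using a' aA by (auto simp: A_def)
          fix i assume i: "i \<in> {1..<n}"
          have "a' i \<in> T" "w i - a' i \<in> L (m + k)" using a' iff[of a'] i by (auto simp: A_def)
          moreover have "a i \<in> T" "w i - a i \<in> L (m + k)" using aA i g[OF w[of i]] by (auto simp: A_def a_def)
          moreover have "w i \<in> L m" using w i by auto
          ultimately show "a' i = a i" using T(4) by metis
        qed
      qed
    qed
    show "\<exists>r. x = r \<cdot>\<^sub>m 1\<^sub>m n"
      if x: "x \<in> SLC" and eig: "\<And>u. u \<in> SLC \<Longrightarrow> \<exists>r. \<forall>j<n. (x * u) $$ (j, 0) = r * u $$ (j, 0)" for x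
    proof (rule scalar_of_eigenvectors[OF C_carrier[OF x]])
      fix v :: "nat \<Rightarrow> 'k" assume v: "v 0 = 1" "\<And>j. j \<noteq> 0 \<Longrightarrow> v j \<in> L m"
      have "U v \<in> SLC" using v by (intro U_SLC) auto
      moreover have "U v $$ (j, 0) = v j" if "j < n" for j using that v n_pos by (auto simp: U_def)
      ultimately show "\<exists>r. \<forall>j<n. (\<Sum>l<n. x $$ (j, l) * v l) = r * v j"
        using eig[of "U v"] mult_column[OF C_carrier[OF x] U_carrier] by auto
    qed
  qed
qed

end

section \<open>Isometry groups of monomial forms\<close>

text \<open>A monomial form: \<open>\<sigma>\<close> pairs the basis vectors and
  \<open>\<epsilon>\<close> gives the signs, with \<open>\<eta> = 1\<close> for symmetric and
  \<open>\<eta> = - 1\<close> for alternating forms. The involution may have fixed points, which the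
  odd orthogonal form requires; only the chosen \<open>b\<close> must be moved, so that its basis
  vector is isotropic.\<close>

locale form_data = dvr_matrices R \<pi> p e q n m for R :: "'k::field set" and \<pi> and p e q n m +
  fixes \<sigma> :: "nat \<Rightarrow> nat" and \<epsilon> :: "nat \<Rightarrow> 'k" and \<eta> :: 'k and b k :: nat
  assumes sigma_less: "i < n \<Longrightarrow> \<sigma> i < n"
    and sigma_sigma: "i < n \<Longrightarrow> \<sigma> (\<sigma> i) = i"
    and eps: "i < n \<Longrightarrow> \<epsilon> i = 1 \<or> \<epsilon> i = - 1"
    and eps_sigma: "i < n \<Longrightarrow> \<epsilon> (\<sigma> i) = \<eta> * \<epsilon> i"
    and b_less: "b < n" and sigma_b: "\<sigma> b \<noteq> b" and k_pos: "1 \<le> k"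
begin

definition s :: "'k mat" where
  "s = Matrix.mat n n (\<lambda>(i, j). if j = \<sigma> i then \<epsilon> i else 0)"

abbreviation b' :: nat where "b' \<equiv> \<sigma> b"

definition mids :: "nat set" where "mids = {..<n} - {b, b'}"

text \<open>The value of the form at a vector paired with itself, restricted to the orthogonal
  complement of the hyperbolic plane of \<open>b\<close> and \<open>b'\<close>.\<close>

definition Q :: "(nat \<Rightarrow> 'k) \<Rightarrow> 'k" where
  "Q a = (\<Sum>l\<in>mids. \<epsilon> l * a l * a (\<sigma> l))"

lemma b'_less: "b' < n" using sigma_less b_less .

lemma sigma_b': "\<sigma> b' = b" using sigma_sigma b_less .

lemma finite_mids: "finite mids" by (simp add: mids_def)

lemma card_mids: "card mids = n - 2"
  unfolding mids_def using b_less b'_less sigma_b by (subst card_Diff_subset) auto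

lemma midsD: "i \<in> mids \<Longrightarrow> i < n \<and> i \<noteq> b \<and> i \<noteq> b'" by (auto simp: mids_def)

lemma sigma_eq_iff: "i < n \<Longrightarrow> j < n \<Longrightarrow> \<sigma> i = j \<longleftrightarrow> i = \<sigma> j"
  using sigma_sigma by metis

lemma sigma_mids: "i \<in> mids \<Longrightarrow> \<sigma> i \<in> mids"
  using sigma_less sigma_eq_iff[of i b] sigma_eq_iff[of i b'] sigma_b' b_less b'_less by (auto simp: mids_def)

lemma sigma_bij: "bij_betw \<sigma> mids mids"
proof (rule bij_betwI[of _ _ _ \<sigma>])
  show "\<sigma> \<in> mids \<rightarrow> mids" "\<sigma> \<in> mids \<rightarrow> mids" by (rule Pi_I, erule sigma_mids)+
  show "\<sigma> (\<sigma> i) = i" "\<sigma> (\<sigma> i) = i" if "i \<in> mids" for i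
    by (rule sigma_sigma[OF conjunct1[OF midsD[OF that]]])+
qed

lemma sum_split: "(\<Sum>l<n. f l) = f b + f b' + (\<Sum>l\<in>mids. f l)" for f :: "nat \<Rightarrow> 'k"
proof -
  have "{..<n} = insert b (insert b' mids)" using b_less b'_less by (auto simp: mids_def)
  then have "(\<Sum>l<n. f l) = (\<Sum>l\<in>insert b (insert b' mids). f l)" by (rule arg_cong)
  also have "b \<notin> insert b' mids" "b' \<notin> mids" using sigma_b by (simp_all add: mids_def)
  then have "(\<Sum>l\<in>insert b (insert b' mids). f l) = f b + f b' + (\<Sum>l\<in>mids. f l)"
    using finite_mids by (simp add: add.assoc)
  finally show ?thesis .
qed

lemma eps_R: "i < n \<Longrightarrow> \<epsilon> i \<in> R" using eps[of i] by auto

lemma eps_sq: "i < n \<Longrightarrow> \<epsilon> i * \<epsilon> i = 1" using eps[of i] by auto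

lemma eps_nonzero: "i < n \<Longrightarrow> \<epsilon> i \<noteq> 0" using eps[of i] by auto

lemma eta_eq: "\<eta> = \<epsilon> b * \<epsilon> b'" using eps_sigma[OF b_less] eps_sq[OF b_less] by (simp add: algebra_simps)

lemma eta_sq: "\<eta> * \<eta> = 1"
  unfolding eta_eq using eps_sq[OF b_less] eps_sq[OF b'_less] by (simp add: algebra_simps)

lemma s_carrier: "s \<in> carrier_mat n n" by (simp add: s_def)

lemma s_MM: "s \<in> MM 0" by (intro MM_I s_carrier) (auto simp: s_def eps_R)

lemma s_index: "i < n \<Longrightarrow> j < n \<Longrightarrow> s $$ (i, j) = (if j = \<sigma> i then \<epsilon> i else 0)"
  by (simp add: s_def)

lemma s_mult_index:
  assumes "y \<in> carrier_mat n n" "i < n" "j < n"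
  shows "(s * y) $$ (i, j) = \<epsilon> i * y $$ (\<sigma> i, j)"
proof -
  have "(s * y) $$ (i, j) = (\<Sum>l<n. if l = \<sigma> i then \<epsilon> i * y $$ (\<sigma> i, j) else 0)"
    unfolding index_mult_sum[OF s_carrier assms] by (intro sum.cong) (use assms in \<open>auto simp: s_index\<close>)
  then show ?thesis using assms sigma_less by simp
qed

lemma form_index:
  assumes "x \<in> carrier_mat n n" "y \<in> carrier_mat n n" "i < n" "j < n"
  shows "(x\<^sup>T * s * y) $$ (i, j) = (\<Sum>l<n. \<epsilon> l * x $$ (l, i) * y $$ (\<sigma> l, j))"
proof -
  have "x\<^sup>T * s * y = x\<^sup>T * (s * y)"
    using assms s_carrier by (intro assoc_mult_mat[of _ n n _ n _ n]) auto
  then have "(x\<^sup>T * s * y) $$ (i, j) = (\<Sum>l<n. x\<^sup>T $$ (i, l) * (s * y) $$ (l, j))"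
    using assms s_carrier index_mult_sum[of "x\<^sup>T" n "s * y" i j] by simp
  also have "\<dots> = (\<Sum>l<n. \<epsilon> l * x $$ (l, i) * y $$ (\<sigma> l, j))"
    by (intro sum.cong) (use assms s_mult_index[OF assms(2)] in auto)
  finally show ?thesis .
qed

lemma s_transpose_inverse: "s\<^sup>T * s = 1\<^sub>m n" "s * s\<^sup>T = 1\<^sub>m n"
proof -
  show "s * s\<^sup>T = 1\<^sub>m n"
  proof (rule eq_matI)
    fix i j assume "i < dim_row (1\<^sub>m n :: 'k mat)" "j < dim_col (1\<^sub>m n :: 'k mat)"
    then have ij: "i < n" "j < n" by auto
    have "(s * s\<^sup>T) $$ (i, j) = \<epsilon> i * s $$ (j, \<sigma> i)"
      using s_mult_index[of "s\<^sup>T" i j] s_carrier ij sigma_less by simp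
    also have "\<dots> = 1\<^sub>m n $$ (i, j)"
      using ij sigma_less[OF ij(1)] sigma_sigma[OF ij(1)] sigma_sigma[OF ij(2)] eps_sq[OF ij(1)]
      by (auto simp: s_index)
    finally show "(s * s\<^sup>T) $$ (i, j) = 1\<^sub>m n $$ (i, j)" .
  qed (use s_carrier in auto)
  then show "s\<^sup>T * s = 1\<^sub>m n"
    using mat_mult_left_right_inverse[of s n "s\<^sup>T"] s_carrier by simp
qed

lemma det_s: "det s \<noteq> 0"
  using det_mult[of s n "s\<^sup>T"] s_carrier s_transpose_inverse by auto

text \<open>Taking determinants in the isometry equation gives \<open>det x * det x = 1\<close>, and
  \<open>det_square_one\<close> removes the sign.\<close>

lemma form_grp_iff: "x \<in> form_grp s \<longleftrightarrow> x \<in> GG \<and> x\<^sup>T * s * x = s"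
proof
  assume "x \<in> GG \<and> x\<^sup>T * s * x = s"
  then have x: "x \<in> GG" and f: "x\<^sup>T * s * x = s" by auto
  note xc = GG_carrier[OF x]
  have "det (x\<^sup>T * s * x) = det x * det s * det x"
    using det_mult[of "x\<^sup>T * s" n x] det_mult[of "x\<^sup>T" n s] det_transpose[OF xc] xc s_carrier by simp
  then have "det s * (det x * det x) = det s * 1" using f by (simp add: mult_ac)
  then have "det x * det x = 1" using det_s by (metis mult_left_cancel)
  then show "x \<in> form_grp s" using det_square_one[OF x] x f by (simp add: form_grp_def SLC_def)
qed (auto simp: form_grp_def SLC_def)

definition c :: "nat \<Rightarrow> nat" where
  "c i = (if i = b then 0 else if i = b' then 2 else 1)"

text \<open>The constant sum makes the diagonal matrix a similitude of the form. Conjugation by it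
  therefore respects the isometry equation, as \<open>conj_form\<close> computes.\<close>

lemma c_sum: "i < n \<Longrightarrow> c i + c (\<sigma> i) = 2"
proof -
  assume "i < n"
  then consider "i = b" | "i = b'" | "i \<in> mids" by (auto simp: mids_def)
  then show ?thesis
  proof cases
    case 3
    then show ?thesis using midsD[OF 3] midsD[OF sigma_mids[OF 3]] by (simp add: c_def)
  qed (use sigma_b sigma_b' in \<open>simp_all add: c_def\<close>)
qed

sublocale weighted_grp R \<pi> p e q n m "form_grp s" k c b
proof (rule weighted_grp.intro[OF form_grp_congruence weighted_grp_axioms.intro])
  show "s \<in> MM 0" "s\<^sup>T \<in> MM 0" using s_MM transpose_MM by auto
qed (use s_transpose_inverse b_less k_pos in \<open>auto simp: form_grp_def c_def\<close>)

lemma form_entry: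
  assumes "x \<in> form_grp s" "i < n" "j < n"
  shows "(\<Sum>l<n. \<epsilon> l * x $$ (l, i) * x $$ (\<sigma> l, j)) = (if j = \<sigma> i then \<epsilon> i else 0)"
proof -
  have "(x\<^sup>T * s * x) $$ (i, j) = s $$ (i, j)" using assms(1) form_grp_iff by simp
  then show ?thesis
    using form_index[OF C_carrier[OF assms(1)] C_carrier[OF assms(1)] assms(2,3)] s_index[OF assms(2,3)] by simp
qed

lemma conj_form:
  assumes x: "x \<in> form_grp s"
  shows "(conj x)\<^sup>T * s * conj x = s"
proof (rule eq_matI)
  fix i j assume "i < dim_row s" "j < dim_col s"
  then have ij: "i < n" "j < n" using s_carrier by auto
  have "((conj x)\<^sup>T * s * conj x) $$ (i, j) = (\<Sum>l<n. \<epsilon> l * conj x $$ (l, i) * conj x $$ (\<sigma> l, j))"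
    by (rule form_index[OF conj_carrier conj_carrier ij])
  also have "\<dots> = (\<Sum>l<n. \<epsilon> l * x $$ (l, i) * x $$ (\<sigma> l, j) * (\<pi> ^ (k * (c i + c j)) / \<pi> ^ (k * 2)))"
  proof (rule sum.cong[OF refl])
    fix l assume "l \<in> {..<n}"
    then have l: "l < n" by simp
    have "\<pi> ^ (k * 2) = \<pi> ^ (k * c l) * \<pi> ^ (k * c (\<sigma> l))"
      unfolding c_sum[OF l, symmetric] by (simp add: power_add distrib_left)
    then show "\<epsilon> l * conj x $$ (l, i) * conj x $$ (\<sigma> l, j) =
        \<epsilon> l * x $$ (l, i) * x $$ (\<sigma> l, j) * (\<pi> ^ (k * (c i + c j)) / \<pi> ^ (k * 2))"
      using l sigma_less[OF l] ij by (simp add: conj_index power_add distrib_left)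
  qed
  also have "\<dots> = (if j = \<sigma> i then \<epsilon> i else 0) * (\<pi> ^ (k * (c i + c j)) / \<pi> ^ (k * 2))"
    unfolding sum_distrib_right[symmetric] form_entry[OF x ij] ..
  also have "\<dots> = s $$ (i, j)" using c_sum[OF ij(1)] s_index[OF ij] by simp
  finally show "((conj x)\<^sup>T * s * conj x) $$ (i, j) = s $$ (i, j)" .
qed (use s_carrier in \<open>auto simp: conj_def\<close>)

lemma bb_unit:
  assumes "x \<in> form_grp s"
  shows "x $$ (b, b) \<noteq> 0" "inverse (x $$ (b, b)) \<in> R" "x $$ (b, b) \<in> R"
proof -
  have "(x - 1\<^sub>m n) $$ (b, b) \<in> L m"
    using assms C_GG' b_less by (intro MM_D) (auto simp: GG_def)
  then have "x $$ (b, b) - 1 \<in> L m" using C_carrier[OF assms] b_less by simp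
  then have "x $$ (b, b) - 1 \<in> L 1" using m_pos lev_mono by blast
  then show "x $$ (b, b) \<noteq> 0" "inverse (x $$ (b, b)) \<in> R" using unit_one_plus by auto
  show "x $$ (b, b) \<in> R" using MM0_D[OF C_MM0[OF assms] b_less b_less] .
qed

lemma off_diagonal:
  assumes "x \<in> form_grp s" "i < n" "j < n" "i \<noteq> j"
  shows "x $$ (i, j) \<in> L m"
proof -
  have "(x - 1\<^sub>m n) $$ (i, j) \<in> L m"
    using assms C_GG' by (intro MM_D) (auto simp: GG_def)
  then show ?thesis using C_carrier[OF assms(1)] assms by simp
qed

lemma lev_unit_cancel:
  assumes "r \<noteq> 0" "inverse r \<in> R" "r * y \<in> L j"
  shows "y \<in> L j"
proof -
  have "inverse r * (r * y) \<in> L j" by (rule lev_multL[OF assms(2,3)])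
  moreover have "inverse r * (r * y) = y" using assms(1) by simp
  ultimately show ?thesis by (simp only:)
qed

lemma eps_lev_cancel: "i < n \<Longrightarrow> \<epsilon> i * y \<in> L j \<Longrightarrow> y \<in> L j"
  using lev_unit_cancel[of "\<epsilon> i" y j] eps[of i] by auto

text \<open>Of the conditions of \<open>conj_SLC_iff\<close>, those on row \<open>b'\<close> follow
  from those on column \<open>b\<close>: the orthogonality relation between columns \<open>b\<close>
  and \<open>j\<close> can be solved for \<open>x $$ (b', j)\<close>, whose coefficient contains the
  unit \<open>x $$ (b, b)\<close>.\<close>

lemma D_iff:
  assumes x: "x \<in> form_grp s"
  shows "x \<in> D \<longleftrightarrow> (\<forall>i\<in>mids. x $$ (i, b) \<in> L (m + k)) \<and> x $$ (b', b) \<in> L (m + 2 * k)"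
proof -
  have xS: "x \<in> SLC" using x by (simp add: form_grp_def)
  have "x \<in> D \<longleftrightarrow> conj x \<in> form_grp s" using x by (simp add: D_def)
  also have "\<dots> \<longleftrightarrow> conj x \<in> SLC" by (simp add: form_grp_def conj_form[OF x])
  also have "\<dots> \<longleftrightarrow> (\<forall>i<n. \<forall>j<n. c j < c i \<longrightarrow> x $$ (i, j) \<in> L (m + k * (c i - c j)))"
    by (rule conj_SLC_iff[OF xS])
  also have "\<dots> \<longleftrightarrow> (\<forall>i\<in>mids. x $$ (i, b) \<in> L (m + k)) \<and> x $$ (b', b) \<in> L (m + 2 * k)"
  proof
    assume *: "\<forall>i<n. \<forall>j<n. c j < c i \<longrightarrow> x $$ (i, j) \<in> L (m + k * (c i - c j))"
    show "(\<forall>i\<in>mids. x $$ (i, b) \<in> L (m + k)) \<and> x $$ (b', b) \<in> L (m + 2 * k)"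
    proof
      show "\<forall>i\<in>mids. x $$ (i, b) \<in> L (m + k)"
        using *[rule_format, OF _ b_less] by (force simp: c_def dest: midsD)
      show "x $$ (b', b) \<in> L (m + 2 * k)"
        using *[rule_format, OF b'_less b_less] sigma_b by (simp add: c_def mult.commute)
    qed
  next
    assume *: "(\<forall>i\<in>mids. x $$ (i, b) \<in> L (m + k)) \<and> x $$ (b', b) \<in> L (m + 2 * k)"
    have row: "x $$ (b', j) \<in> L (m + k)" if j: "j \<in> mids" for j
    proof -
      have jn: "j < n" "j \<noteq> b" "j \<noteq> b'" using midsD[OF j] by auto
      have R: "x $$ (i, l) \<in> R" if "i < n" "l < n" for i l using MM0_D[OF C_MM0[OF x] that] .
      have "\<epsilon> b * x $$ (b, b) * x $$ (b', j) + \<epsilon> b' * x $$ (b', b) * x $$ (b, j) +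
          (\<Sum>l\<in>mids. \<epsilon> l * x $$ (l, b) * x $$ (\<sigma> l, j)) = 0"
        using form_entry[OF x b_less jn(1)] jn sum_split[of "\<lambda>l. \<epsilon> l * x $$ (l, b) * x $$ (\<sigma> l, j)"]
        by (simp add: sigma_b')
      then have "\<epsilon> b * (x $$ (b, b) * x $$ (b', j)) = - (\<epsilon> b' * x $$ (b', b) * x $$ (b, j) +
          (\<Sum>l\<in>mids. \<epsilon> l * x $$ (l, b) * x $$ (\<sigma> l, j)))"
        unfolding mult.assoc[of "\<epsilon> b"] by (simp only: eq_neg_iff_add_eq_0 add.assoc)
      also have "\<dots> \<in> L (m + k)"
      proof (intro lev_uminus lev_add lev_sum)
        have "x $$ (b', b) \<in> L (m + k)" using lev_mono[of _ "m + 2 * k" "m + k"] * by simp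
        then show "\<epsilon> b' * x $$ (b', b) * x $$ (b, j) \<in> L (m + k)"
          using R[OF b_less jn(1)] eps_R[OF b'_less] by (intro lev_multR lev_multL)
        show "\<epsilon> l * x $$ (l, b) * x $$ (\<sigma> l, j) \<in> L (m + k)" if l: "l \<in> mids" for l
          using * l midsD[OF l] R[OF _ jn(1)] eps_R sigma_less by (intro lev_multR lev_multL) auto
      qed
      finally show ?thesis
        using eps_lev_cancel[OF b_less] lev_unit_cancel[OF bb_unit(1,2)[OF x]] by blast
    qed
    show "\<forall>i<n. \<forall>j<n. c j < c i \<longrightarrow> x $$ (i, j) \<in> L (m + k * (c i - c j))"
    proof (intro allI impI)
      fix i j assume ij: "i < n" "j < n" "c j < c i"
      show "x $$ (i, j) \<in> L (m + k * (c i - c j))"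
      proof (cases "i = b'")
        case True
        then have "j \<noteq> b'" using ij by auto
        then show ?thesis using True * row[of j] ij sigma_b
          by (cases "j = b") (auto simp: c_def mids_def mult.commute)
      next
        case False
        then have "i \<noteq> b" "j = b" using ij by (auto simp: c_def split: if_splits)
        then show ?thesis using False * ij by (auto simp: c_def mids_def)
      qed
    qed
  qed
  finally show ?thesis .
qed

text \<open>For an isometry \<open>u\<close> and \<open>x = u * y\<close>, the transpose of
  \<open>u\<close> times \<open>s * x\<close> equals \<open>s * y\<close>. The entries of the
  quotient are thus pairings of columns, and no inverse has to be computed.\<close>

lemma inverse_mult_entry:
  assumes u: "u \<in> form_grp s" and x: "x \<in> form_grp s" and jl: "j < n" "l < n"
  shows "\<epsilon> j * (inv\<^bsub>G\<^esub> u * x) $$ (\<sigma> j, l) = (\<Sum>i<n. \<epsilon> i * u $$ (i, j) * x $$ (\<sigma> i, l))"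
proof -
  have ui: "inv\<^bsub>G\<^esub> u \<in> form_grp s" and uu: "u * inv\<^bsub>G\<^esub> u = 1\<^sub>m n" using inv_closed[of u] r_inv[of u] u by auto
  note cs = C_carrier[OF u] C_carrier[OF x] C_carrier[OF ui]
  define y where "y = inv\<^bsub>G\<^esub> u * x"
  have y: "y \<in> carrier_mat n n" using cs by (simp add: y_def)
  have "u * y = x"
    unfolding y_def using assoc_mult_mat[OF cs(1,3,2)] uu left_mult_one_mat[OF cs(2)] by simp
  then have "u\<^sup>T * s * x = u\<^sup>T * s * (u * y)" by simp
  also have "\<dots> = u\<^sup>T * s * u * y" using cs y s_carrier by (intro assoc_mult_mat[symmetric, of _ n n _ n _ n]) auto
  also have "\<dots> = s * y" using u by (simp add: form_grp_def)
  finally have "(u\<^sup>T * s * x) $$ (j, l) = \<epsilon> j * y $$ (\<sigma> j, l)" using s_mult_index[OF y jl] by simp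
  then show ?thesis using form_index[OF cs(1,2) jl] by (simp add: y_def)
qed

text \<open>A Siegel or Eichler transformation: it fixes the basis vector at \<open>b'\<close> and
  sends the one at \<open>b\<close> to itself plus \<open>a\<close> plus \<open>z\<close> times the
  one at \<open>b'\<close>. The entries of row \<open>b'\<close> are then dictated by orthogonality
  of the columns.\<close>

definition U :: "(nat \<Rightarrow> 'k) \<Rightarrow> 'k \<Rightarrow> 'k mat" where
  "U a z = Matrix.mat n n (\<lambda>(i, j). if i = j then 1 else if j = b then (if i = b' then z else a i)
     else if i = b' then - (\<epsilon> b * \<epsilon> (\<sigma> j) * a (\<sigma> j)) else 0)"

lemma U_carrier: "U a z \<in> carrier_mat n n" by (simp add: U_def)

lemma U_column_b: "i < n \<Longrightarrow> U a z $$ (i, b) = (if i = b then 1 else if i = b' then z else a i)"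
  using b_less by (auto simp: U_def)

text \<open>The pairings with the columns of \<open>U a z\<close> are computed for an arbitrary
  vector \<open>w\<close>, since \<open>w\<close> will be a column of \<open>U a z\<close> itself in
  \<open>U_form_grp\<close> and a column of \<open>x\<close> in
  \<open>quotient_entries\<close>.\<close>

lemma pair_U_b:
  "(\<Sum>l<n. \<epsilon> l * U a z $$ (l, b) * w (\<sigma> l)) = \<epsilon> b * w b' + \<epsilon> b' * z * w b + (\<Sum>l\<in>mids. \<epsilon> l * a l * w (\<sigma> l))"
proof -
  have "(\<Sum>l\<in>mids. \<epsilon> l * U a z $$ (l, b) * w (\<sigma> l)) = (\<Sum>l\<in>mids. \<epsilon> l * a l * w (\<sigma> l))"
    by (intro sum.cong) (auto simp: U_column_b dest: midsD)
  then show ?thesis unfolding sum_split using b_less b'_less sigma_b by (simp add: U_column_b sigma_b')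
qed

lemma pair_U_b':
  "(\<Sum>l<n. \<epsilon> l * U a z $$ (l, b') * w (\<sigma> l)) = \<epsilon> b' * w b"
proof -
  have "(\<Sum>l<n. \<epsilon> l * U a z $$ (l, b') * w (\<sigma> l)) = (\<Sum>l<n. if l = b' then \<epsilon> b' * w b else 0)"
    by (intro sum.cong) (use sigma_b b'_less in \<open>auto simp: U_def sigma_b'\<close>)
  then show ?thesis using b'_less by simp
qed

lemma pair_U_mid:
  assumes "j \<in> mids"
  shows "(\<Sum>l<n. \<epsilon> l * U a z $$ (l, j) * w (\<sigma> l)) = \<epsilon> j * w (\<sigma> j) - \<eta> * \<epsilon> (\<sigma> j) * a (\<sigma> j) * w b"
proof -
  have j: "j < n" "j \<noteq> b" "j \<noteq> b'" using midsD[OF assms] by auto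
  have "(\<Sum>l<n. \<epsilon> l * U a z $$ (l, j) * w (\<sigma> l)) =
      (\<Sum>l<n. (if l = j then \<epsilon> j * w (\<sigma> j) else 0) +
        (if l = b' then - (\<epsilon> b' * \<epsilon> b) * \<epsilon> (\<sigma> j) * a (\<sigma> j) * w b else 0))"
    by (intro sum.cong) (use j b'_less in \<open>auto simp: U_def sigma_b'\<close>)
  also have "\<dots> = \<epsilon> j * w (\<sigma> j) + - (\<epsilon> b' * \<epsilon> b) * \<epsilon> (\<sigma> j) * a (\<sigma> j) * w b"
    using j b'_less by (simp add: sum.distrib)
  finally show ?thesis by (simp add: eta_eq mult.commute)
qed

text \<open>The row \<open>b'\<close> was chosen to make all pairings of distinct columns correct.
  What remains is that column \<open>b\<close> be isotropic, which is the equation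
  \<open>iso\<close>; for \<open>\<eta> = - 1\<close> both of its terms vanish.\<close>

lemma U_form_grp:
  assumes a: "\<And>i. i \<in> mids \<Longrightarrow> a i \<in> L m" and z: "z \<in> L m" and iso: "(1 + \<eta>) * \<epsilon> b * z + Q a = 0"
  shows "U a z \<in> form_grp s"
proof -
  have "U a z - 1\<^sub>m n \<in> MM m"
  proof (rule MM_I)
    show "U a z - 1\<^sub>m n \<in> carrier_mat n n" by (rule minus_carrier_mat) simp
    fix i j assume ij: "i < n" "j < n"
    have aR: "a (\<sigma> j) \<in> L m" if "j \<noteq> b" "j \<noteq> b'" using a sigma_mids ij that by (auto simp: mids_def)
    show "(U a z - 1\<^sub>m n) $$ (i, j) \<in> L m"
      using ij a z aR eps_R[OF b_less] eps_R[OF sigma_less[OF ij(2)]]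
      by (auto simp: U_def mids_def intro!: lev_uminus lev_multL)
  qed
  then have G: "U a z \<in> GG" by (simp add: GG_def U_carrier)
  have "(U a z)\<^sup>T * s * U a z = s"
  proof (rule eq_matI)
    fix i j assume "i < dim_row s" "j < dim_col s"
    then have ij: "i < n" "j < n" using s_carrier by auto
    define w where "w l = U a z $$ (l, j)" for l
    have wb: "w b = (if j = b then 1 else 0)" unfolding w_def using b_less ij sigma_b by (auto simp: U_def)
    have wb': "w b' = (if j = b then z else if j = b' then 1 else - (\<epsilon> b * \<epsilon> (\<sigma> j) * a (\<sigma> j)))"
      unfolding w_def using b'_less ij sigma_b by (auto simp: U_def)
    have wm: "w l = (if j = b then a l else if l = j then 1 else 0)" if "l \<in> mids" for l
      unfolding w_def using ij midsD[OF that] by (auto simp: U_def)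
    have e: "((U a z)\<^sup>T * s * U a z) $$ (i, j) = (\<Sum>l<n. \<epsilon> l * U a z $$ (l, i) * w (\<sigma> l))"
      unfolding form_index[OF U_carrier U_carrier ij] by (simp add: w_def)
    consider "i = b" | "i = b'" | "i \<in> mids" using ij by (auto simp: mids_def)
    then have "(\<Sum>l<n. \<epsilon> l * U a z $$ (l, i) * w (\<sigma> l)) = (if j = \<sigma> i then \<epsilon> i else 0)"
    proof cases
      case 1
      have mid_sum: "(\<Sum>l\<in>mids. \<epsilon> l * a l * w (\<sigma> l)) =
          (if j = b then Q a else if j = b' then 0 else \<epsilon> (\<sigma> j) * a (\<sigma> j))"
      proof (cases "j = b \<or> j = b'")
        case True
        have "(\<Sum>l\<in>mids. \<epsilon> l * a l * w (\<sigma> l)) = (\<Sum>l\<in>mids. \<epsilon> l * a l * (if j = b then a (\<sigma> l) else 0))"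
          by (intro sum.cong) (use True wm[OF sigma_mids] midsD[OF sigma_mids] sigma_b in auto)
        then show ?thesis using True sigma_b by (auto simp: Q_def)
      next
        case False
        then have jm: "j \<in> mids" using ij by (simp add: mids_def)
        have "(\<Sum>l\<in>mids. \<epsilon> l * a l * w (\<sigma> l)) = (\<Sum>l\<in>mids. if l = \<sigma> j then \<epsilon> (\<sigma> j) * a (\<sigma> j) else 0)"
          by (intro sum.cong) (use False wm[OF sigma_mids] sigma_eq_iff[OF _ ij(2)] midsD in auto)
        then show ?thesis using False sigma_mids[OF jm] finite_mids by simp
      qed
      have "\<epsilon> b' = \<eta> * \<epsilon> b" by (rule eps_sigma[OF b_less])
      then have iso': "\<epsilon> b * z + \<epsilon> b' * z + Q a = 0" using iso by (simp add: algebra_simps)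
      consider "j = b" | "j = b'" | "j \<noteq> b" "j \<noteq> b'" by blast
      then show ?thesis
      proof cases
        case 1
        then show ?thesis
          unfolding \<open>i = b\<close> pair_U_b wb wb' mid_sum using iso' sigma_b by simp
      next
        case 2
        then show ?thesis
          unfolding \<open>i = b\<close> pair_U_b wb wb' mid_sum using sigma_b by simp
      next
        case 3
        then show ?thesis
          unfolding \<open>i = b\<close> pair_U_b wb wb' mid_sum using eps_sq[OF b_less] by (simp flip: mult.assoc)
      qed
    next
      case 2
      then show ?thesis unfolding 2 pair_U_b' wb by (simp add: sigma_b')
    next
      case 3
      have i: "i < n" "i \<noteq> b" "i \<noteq> b'" using midsD[OF 3] by auto
      have ei: "\<eta> * \<epsilon> (\<sigma> i) = \<epsilon> i" using eps_sigma[OF i(1)] eta_sq by (simp flip: mult.assoc)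
      have "b \<noteq> \<sigma> i" using sigma_mids[OF 3] midsD by blast
      then show ?thesis
        unfolding pair_U_mid[OF 3] wb wm[OF sigma_mids[OF 3]] ei by auto
    qed
    then show "((U a z)\<^sup>T * s * U a z) $$ (i, j) = s $$ (i, j)" using e s_index[OF ij] by simp
  qed (use s_carrier U_carrier in auto)
  then show ?thesis using G form_grp_iff by blast
qed

lemma quotient_entries:
  assumes u: "U a z \<in> form_grp s" and x: "x \<in> form_grp s"
  shows "i \<in> mids \<Longrightarrow> (inv\<^bsub>G\<^esub> (U a z) * x) $$ (i, b) = x $$ (i, b) - a i * x $$ (b, b)"
    and "\<epsilon> b * (inv\<^bsub>G\<^esub> (U a z) * x) $$ (b', b) =
      \<epsilon> b * x $$ (b', b) + \<epsilon> b' * z * x $$ (b, b) + (\<Sum>l\<in>mids. \<epsilon> l * a l * x $$ (\<sigma> l, b))"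
proof -
  show "\<epsilon> b * (inv\<^bsub>G\<^esub> (U a z) * x) $$ (b', b) =
      \<epsilon> b * x $$ (b', b) + \<epsilon> b' * z * x $$ (b, b) + (\<Sum>l\<in>mids. \<epsilon> l * a l * x $$ (\<sigma> l, b))"
    unfolding inverse_mult_entry[OF u x b_less b_less] by (rule pair_U_b[of a z "\<lambda>i. x $$ (i, b)"])
  assume i: "i \<in> mids"
  note si = sigma_mids[OF i]
  have ii: "\<sigma> (\<sigma> i) = i" "i < n" "\<sigma> i < n" using midsD[OF i] midsD[OF si] sigma_sigma by auto
  have "\<epsilon> (\<sigma> i) * (inv\<^bsub>G\<^esub> (U a z) * x) $$ (i, b) = \<epsilon> (\<sigma> i) * x $$ (i, b) - \<eta> * \<epsilon> i * a i * x $$ (b, b)"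
    using inverse_mult_entry[OF u x ii(3) b_less] pair_U_mid[OF si, of a z "\<lambda>i. x $$ (i, b)"] ii by simp
  also have "\<dots> = \<epsilon> (\<sigma> i) * (x $$ (i, b) - a i * x $$ (b, b))"
    using eps_sigma[OF ii(2)] by (simp add: algebra_simps)
  finally show "(inv\<^bsub>G\<^esub> (U a z) * x) $$ (i, b) = x $$ (i, b) - a i * x $$ (b, b)"
    using eps_nonzero[OF ii(3)] by simp
qed

lemma mid_condition:
  assumes u: "U a z \<in> form_grp s" and x: "x \<in> form_grp s" and i: "i \<in> mids"
  shows "(inv\<^bsub>G\<^esub> (U a z) * x) $$ (i, b) \<in> L j \<longleftrightarrow> x $$ (i, b) * inverse (x $$ (b, b)) - a i \<in> L j"
proof -
  define r where "r = x $$ (b, b)"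
  note r = bb_unit[OF x, folded r_def]
  have e: "(inv\<^bsub>G\<^esub> (U a z) * x) $$ (i, b) = r * (x $$ (i, b) * inverse r - a i)"
    unfolding quotient_entries(1)[OF u x i] using r(1) by (simp add: r_def[symmetric] algebra_simps)
  show ?thesis unfolding e r_def[symmetric] using lev_unit_cancel[OF r(1,2)] lev_multL[OF r(3)] by blast
qed

lemma quotient_mem: "u \<in> form_grp s \<Longrightarrow> x \<in> form_grp s \<Longrightarrow> inv\<^bsub>G\<^esub> u * x \<in> form_grp s"
  using C_mult inv_closed[of u] by simp

lemma mid_choice:
  assumes T: "T \<subseteq> L m" "\<forall>x\<in>L m. \<exists>!t. t \<in> T \<and> x - t \<in> L (m + k)" and w: "\<And>i. i \<in> mids \<Longrightarrow> w i \<in> L m"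
  shows "\<exists>!a. a \<in> PiE mids (\<lambda>_. T) \<and> (\<forall>i\<in>mids. w i - a i \<in> L (m + k))"
proof -
  obtain g where g: "\<And>x. x \<in> L m \<Longrightarrow> g x \<in> T \<and> x - g x \<in> L (m + k)" using T(2) by metis
  define a where "a = restrict (\<lambda>i. g (w i)) mids"
  show ?thesis
  proof (rule ex1I[of _ a])
    show a: "a \<in> PiE mids (\<lambda>_. T) \<and> (\<forall>i\<in>mids. w i - a i \<in> L (m + k))" using g w by (auto simp: a_def)
    fix a' assume a': "a' \<in> PiE mids (\<lambda>_. T) \<and> (\<forall>i\<in>mids. w i - a' i \<in> L (m + k))"
    show "a' = a"
    proof (rule PiE_ext[of a' mids "\<lambda>_. T" a])
      show "a' \<in> PiE mids (\<lambda>_. T)" "a \<in> PiE mids (\<lambda>_. T)" using a a' by auto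
      fix i assume i: "i \<in> mids"
      have "a' i \<in> T" "a i \<in> T" "w i - a' i \<in> L (m + k)" "w i - a i \<in> L (m + k)" using a a' i by auto
      then show "a' i = a i" using T(2) w[OF i] by metis
    qed
  qed
qed

text \<open>Exchanging \<open>l\<close> and \<open>\<sigma> l\<close> reverses the sign of each
  term, and 2 is nonzero.\<close>

lemma Q_skew: "\<eta> = - 1 \<Longrightarrow> Q a = 0"
proof -
  assume eta: "\<eta> = - 1"
  have "Q a = (\<Sum>l\<in>mids. \<epsilon> (\<sigma> l) * a (\<sigma> l) * a (\<sigma> (\<sigma> l)))"
    unfolding Q_def by (rule sum.reindex_bij_betw[OF sigma_bij, symmetric])
  also have "\<dots> = (\<Sum>l\<in>mids. - (\<epsilon> l * a l * a (\<sigma> l)))"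
    by (intro sum.cong) (use midsD eps_sigma sigma_sigma eta in auto)
  finally have "Q a = - Q a" by (simp add: Q_def sum_negf)
  then have "2 * Q a = 0" by simp
  then show ?thesis using of_nat_nonzero[of 2] by simp
qed

text \<open>Isotropy imposes nothing here, so \<open>z\<close> is a free coordinate. Having weight 2
  it matters modulo \<open>\<pi> ^ (m + 2 * k)\<close>, and the index is \<open>q\<close> to the
  power \<open>k * (n - 2) + 2 * k\<close>.\<close>

theorem self_similar_skew:
  assumes eta: "\<eta> = - 1"
  shows "self_similar (matrix_group n (form_grp s)) (q ^ (n * k))"
proof -
  have n2: "2 \<le> n" using b_less b'_less sigma_b by auto
  obtain T where T: "finite T" "card T = q ^ k" "T \<subseteq> L m" "\<forall>x\<in>L m. \<exists>!t. t \<in> T \<and> x - t \<in> L (m + k)"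
    using lev_transversal[of k m] by auto
  obtain S where S: "finite S" "card S = q ^ (2 * k)" "S \<subseteq> L m"
    "\<forall>x\<in>L m. \<exists>!t. t \<in> S \<and> x - t \<in> L (m + 2 * k)"
    using lev_transversal[of "2 * k" m] by auto
  define A where "A = PiE mids (\<lambda>_. T) \<times> S"
  define V where "V = (\<lambda>(a, z). U a z)"
  have UC: "U a z \<in> form_grp s" if "\<And>i. i \<in> mids \<Longrightarrow> a i \<in> L m" "z \<in> L m" for a z
    using that eta Q_skew[OF eta] by (intro U_form_grp) auto
  show ?thesis
  proof (rule self_similar_G)
    show "finite A" unfolding A_def using T S finite_mids by (intro finite_cartesian_product finite_PiE) auto
    have "card A = q ^ (k * (n - 2)) * q ^ (2 * k)"
      unfolding A_def using T S finite_mids by (simp add: card_cartesian_product card_PiE card_mids flip: power_mult)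
    also have "\<dots> = q ^ (n * k)"
    proof -
      have "k * (n - 2) + 2 * k = (n - 2 + 2) * k" unfolding add_mult_distrib by (simp only: mult.commute)
      also have "n - 2 + 2 = n" using n2 by simp
      finally have "k * (n - 2) + 2 * k = n * k" .
      then show ?thesis by (simp only: power_add[symmetric])
    qed
    finally show "card A = q ^ (n * k)" .
    show "V a \<in> form_grp s" if "a \<in> A" for a
      using that T(3) S(3) by (auto simp: A_def V_def PiE_def Pi_def intro!: UC)
    show "\<exists>!a. a \<in> A \<and> inv\<^bsub>G\<^esub> (V a) * x \<in> D" if x: "x \<in> form_grp s" for x
    proof -
      define r where "r = x $$ (b, b)"
      note r = bb_unit[OF x, folded r_def]
      define w where "w i = x $$ (i, b) * inverse r" for i
      have w: "w i \<in> L m" if "i \<in> mids" for i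
        using off_diagonal[OF x, of i b] midsD[OF that] b_less r(2) by (auto simp: w_def intro: lev_multR)
      \<comment> \<open>This is the value of \<open>z\<close> for which the entry
        \<open>(b', b)\<close> of the quotient vanishes. It depends on \<open>a\<close>, so
        \<open>a\<close> is determined first and \<open>z\<close> afterwards.\<close>
      define y where "y a = (\<epsilon> b * x $$ (b', b) + (\<Sum>l\<in>mids. \<epsilon> l * a l * x $$ (\<sigma> l, b))) * inverse r * \<epsilon> b" for a
      have y: "y a \<in> L m" if "\<And>i. i \<in> mids \<Longrightarrow> a i \<in> L m" for a
      proof -
        have "\<epsilon> b * x $$ (b', b) \<in> L m" using off_diagonal[OF x b'_less b_less sigma_b] eps_R[OF b_less] by (intro lev_multL)
        moreover have "(\<Sum>l\<in>mids. \<epsilon> l * a l * x $$ (\<sigma> l, b)) \<in> L m"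
          using that eps_R midsD sigma_mids MM0_D[OF C_MM0[OF x] _ b_less] by (intro lev_sum lev_multR lev_multL) auto
        ultimately show ?thesis unfolding y_def
          by (intro lev_multR[OF lev_multR[OF lev_add r(2)] eps_R[OF b_less]])
      qed
      have iff: "inv\<^bsub>G\<^esub> (U a z) * x \<in> D \<longleftrightarrow> (\<forall>i\<in>mids. w i - a i \<in> L (m + k)) \<and> y a - z \<in> L (m + 2 * k)"
        if az: "\<And>i. i \<in> mids \<Longrightarrow> a i \<in> L m" "z \<in> L m" for a z
      proof -
        define v where "v = inv\<^bsub>G\<^esub> (U a z) * x"
        have e: "\<epsilon> b * v $$ (b', b) = \<epsilon> b * r * (y a - z)"
        proof -
          have "\<epsilon> b * r * (y a - z) = (\<epsilon> b * \<epsilon> b) * (inverse r * r) * (\<epsilon> b * x $$ (b', b) + (\<Sum>l\<in>mids. \<epsilon> l * a l * x $$ (\<sigma> l, b))) - \<epsilon> b * r * z"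
            by (simp add: y_def algebra_simps)
          also have "\<dots> = \<epsilon> b * x $$ (b', b) + (\<Sum>l\<in>mids. \<epsilon> l * a l * x $$ (\<sigma> l, b)) - \<epsilon> b * r * z"
            using eps_sq[OF b_less] r(1) by simp
          also have "\<dots> = \<epsilon> b * x $$ (b', b) + \<epsilon> b' * z * x $$ (b, b) + (\<Sum>l\<in>mids. \<epsilon> l * a l * x $$ (\<sigma> l, b))"
            using eps_sigma[OF b_less] eta by (simp add: r_def algebra_simps)
          also have "\<dots> = \<epsilon> b * v $$ (b', b)"
            unfolding v_def by (rule quotient_entries(2)[OF UC[OF az] x, symmetric])
          finally show ?thesis by (rule sym)
        qed
        then have "\<epsilon> b * v $$ (b', b) = \<epsilon> b * (r * (y a - z))" by (simp only: mult.assoc)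
        then have v: "v $$ (b', b) = r * (y a - z)"
          using mult_left_cancel[OF eps_nonzero[OF b_less]] by blast
        have "v $$ (b', b) \<in> L (m + 2 * k) \<longleftrightarrow> y a - z \<in> L (m + 2 * k)"
          unfolding v using lev_unit_cancel[OF r(1,2)] lev_multL[OF r(3)] by blast
        moreover have "v $$ (i, b) \<in> L (m + k) \<longleftrightarrow> w i - a i \<in> L (m + k)" if "i \<in> mids" for i
          unfolding v_def w_def r_def by (rule mid_condition[OF UC[OF az] x that])
        ultimately show ?thesis using D_iff[OF quotient_mem[OF UC[OF az] x]] by (simp add: v_def)
      qed
      have "\<exists>!a. a \<in> PiE mids (\<lambda>_. T) \<and> (\<forall>i\<in>mids. w i - a i \<in> L (m + k))"
        by (rule mid_choice[OF T(3,4)]) (rule w)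
      then obtain a where a0: "a \<in> PiE mids (\<lambda>_. T) \<and> (\<forall>i\<in>mids. w i - a i \<in> L (m + k))"
        and a_uniq: "\<forall>a'. a' \<in> PiE mids (\<lambda>_. T) \<and> (\<forall>i\<in>mids. w i - a' i \<in> L (m + k)) \<longrightarrow> a' = a"
        by (rule ex1E)
      from a0 have a: "a \<in> PiE mids (\<lambda>_. T)" "\<forall>i\<in>mids. w i - a i \<in> L (m + k)" by simp_all
      have am: "a i \<in> L m" if "i \<in> mids" for i using a(1) T(3) that by auto
      have "y a \<in> L m" by (rule y) (rule am)
      with S(4) have "\<exists>!z. z \<in> S \<and> y a - z \<in> L (m + 2 * k)" by (rule bspec)
      then obtain z where z0: "z \<in> S \<and> y a - z \<in> L (m + 2 * k)"
        and z_uniq: "\<forall>z'. z' \<in> S \<and> y a - z' \<in> L (m + 2 * k) \<longrightarrow> z' = z"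
        by (rule ex1E)
      from z0 have z: "z \<in> S" "y a - z \<in> L (m + 2 * k)" by simp_all
      have zm: "z \<in> L m" using z(1) S(3) by auto
      show ?thesis
      proof (rule ex1I[of _ "(a, z)"])
        show "(a, z) \<in> A \<and> inv\<^bsub>G\<^esub> (V (a, z)) * x \<in> D"
          using a z iff[OF am zm] by (simp add: A_def V_def)
        fix az assume az: "az \<in> A \<and> inv\<^bsub>G\<^esub> (V az) * x \<in> D"
        obtain a' z' where az': "az = (a', z')" by (cases az)
        have a': "a' \<in> PiE mids (\<lambda>_. T)" "z' \<in> S" using az by (auto simp: az' A_def)
        have a'm: "a' i \<in> L m" if "i \<in> mids" for i using a'(1) T(3) that by auto
        have z'm: "z' \<in> L m" using a'(2) S(3) by auto
        have "(\<forall>i\<in>mids. w i - a' i \<in> L (m + k)) \<and> y a' - z' \<in> L (m + 2 * k)"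
          using iff[OF a'm z'm] az by (simp add: az' V_def)
        then have a'_w: "\<forall>i\<in>mids. w i - a' i \<in> L (m + k)" and z'_y: "y a' - z' \<in> L (m + 2 * k)" by simp_all
        have "a' = a" using spec[OF a_uniq, of a'] a'(1) a'_w by simp
        moreover from this have "z' = z" using spec[OF z_uniq, of z'] a'(2) z'_y by simp
        ultimately show "az = (a, z)" by (simp add: az')
      qed
    qed
    show "\<exists>r. x = r \<cdot>\<^sub>m 1\<^sub>m n"
      if x: "x \<in> form_grp s" and eig: "\<And>u. u \<in> form_grp s \<Longrightarrow> \<exists>r. \<forall>j<n. (x * u) $$ (j, b) = r * u $$ (j, b)" for x
    proof (rule scalar_of_eigenvectors[OF C_carrier[OF x]])
      fix v :: "nat \<Rightarrow> 'k" assume v: "v b = 1" "\<And>j. j \<noteq> b \<Longrightarrow> v j \<in> L m"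
      \<comment> \<open>For an alternating form every such \<open>v\<close> occurs as column
        \<open>b\<close> of a group element, so the general eigenvector criterion applies.\<close>
      have uv: "U v (v b') \<in> form_grp s" using v sigma_b midsD by (intro UC) auto
      have "U v (v b') $$ (j, b) = v j" if "j < n" for j using that v by (simp add: U_column_b)
      then show "\<exists>r. \<forall>j<n. (\<Sum>l<n. x $$ (j, l) * v l) = r * v j"
        using eig[OF uv] mult_column[OF C_carrier[OF x] U_carrier] by auto
    qed
  qed
qed

end

text \<open>The left side is linear in \<open>t\<close>, so its second difference vanishes; that of
  the right side is twice the quadratic coefficient.\<close>

lemma second_difference_zero:
  fixes x y u v w a :: "'a::comm_ring_1"
  assumes "\<And>t. t \<in> {1, 2, 3} \<Longrightarrow> t * y + x = (u + t * v + t\<^sup>2 * w) * a"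
  shows "2 * (w * a) = 0"
proof -
  have "(3 * y + x) - 2 * (2 * y + x) + (1 * y + x) =
      (u + 3 * v + 3\<^sup>2 * w) * a - 2 * ((u + 2 * v + 2\<^sup>2 * w) * a) + (u + 1 * v + 1\<^sup>2 * w) * a"
    using assms[of 1] assms[of 2] assms[of 3] by simp
  then show ?thesis by (simp add: algebra_simps power2_eq_square)
qed

lemma first_difference_zero:
  fixes x y v w :: "'a::comm_ring_1"
  assumes "\<And>t. t \<in> {1, 2} \<Longrightarrow> t * y + x = v + t * w"
  shows "y = w" "x = v"
proof -
  have "y = (2 * y + x) - (1 * y + x)" by (simp add: algebra_simps)
  also have "\<dots> = w" using assms[of 1] assms[of 2] by (simp add: algebra_simps)
  finally show "y = w" .
  then show "x = v" using assms[of 1] by simp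
qed

section \<open>Symmetric forms\<close>

context form_data
begin

lemma of_nat_numeral_nonzero: "(2 :: 'k) \<noteq> 0" "(3 :: 'k) \<noteq> 0"
  using of_nat_nonzero[of 2] of_nat_nonzero[of 3] by simp_all

text \<open>The isotropic vectors \<open>e\<^sub>b + t a + t\<^sup>2 z e\<^sub>b\<^sub>'\<close> with \<open>t = 1, 2, 3\<close> are eigenvectors; comparing
  coefficients of \<open>t\<close> shows that all eigenvalues agree.\<close>

lemma isotropic_eigenvectors:
  assumes x: "x \<in> carrier_mat n n" and a: "\<And>i. i \<in> mids \<Longrightarrow> a i \<in> L m"
    and z: "z \<in> L m" "z \<noteq> 0" "2 * \<epsilon> b * z + Q a = 0"
    and eig: "\<And>v. v b = 1 \<Longrightarrow> (\<And>i. i \<in> mids \<Longrightarrow> v i \<in> L m) \<Longrightarrow> v b' \<in> L m \<Longrightarrow>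
      2 * \<epsilon> b * v b' + Q v = 0 \<Longrightarrow> \<exists>r. \<forall>j<n. (\<Sum>l<n. x $$ (j, l) * v l) = r * v j"
    and j: "j < n"
  shows "j \<noteq> b \<Longrightarrow> x $$ (j, b) = 0"
    and "(\<Sum>l\<in>mids. x $$ (j, l) * a l) = (if j \<in> mids then x $$ (b, b) * a j else 0)"
    and "x $$ (j, b') = (if j = b' then x $$ (b, b) else 0)"
proof -
  define V where "V t l = (if l = b then 1 else if l = b' then t\<^sup>2 * z else t * a l)" for t l
  define Y where "Y j = (\<Sum>l\<in>mids. x $$ (j, l) * a l)" for j
  define Z where "Z j = x $$ (j, b') * z" for j
  have Qm: "Q f = Q g" if "\<And>l. l \<in> mids \<Longrightarrow> f l = g l" for f g
    unfolding Q_def by (intro sum.cong) (use that sigma_mids in auto)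
  have QV: "Q (V t) = t\<^sup>2 * Q a" for t
  proof -
    have "Q (V t) = Q (\<lambda>l. t * a l)" by (rule Qm) (auto simp: V_def dest: midsD)
    also have "\<dots> = t\<^sup>2 * Q a" by (simp add: Q_def sum_distrib_left power2_eq_square mult_ac)
    finally show ?thesis .
  qed
  have sumV: "(\<Sum>l<n. x $$ (j, l) * V t l) = x $$ (j, b) + t\<^sup>2 * Z j + t * Y j" for t j
  proof -
    have "(\<Sum>l\<in>mids. x $$ (j, l) * V t l) = t * Y j"
      unfolding Y_def sum_distrib_left by (intro sum.cong) (auto simp: V_def mult_ac dest: midsD)
    then show ?thesis unfolding sum_split using sigma_b by (simp add: V_def Z_def mult_ac)
  qed
  have ex: "\<exists>r. \<forall>j<n. x $$ (j, b) + t\<^sup>2 * Z j + t * Y j = r * V t j" if "t \<in> R" for t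
    unfolding sumV[symmetric]
  proof (rule eig)
    show "V t b = 1" by (simp add: V_def)
    show "V t i \<in> L m" if "i \<in> mids" for i
      using a[OF that] midsD[OF that] \<open>t \<in> R\<close> by (simp add: V_def lev_multL)
    show "V t b' \<in> L m" using z(1) sigma_b \<open>t \<in> R\<close> by (simp add: V_def lev_multL)
    have "2 * \<epsilon> b * (t\<^sup>2 * z) + t\<^sup>2 * Q a = t\<^sup>2 * (2 * \<epsilon> b * z + Q a)" by (simp add: algebra_simps)
    then show "2 * \<epsilon> b * V t b' + Q (V t) = 0" using z(3) sigma_b by (simp add: QV V_def)
  qed
  \<comment> \<open>The parameter \<open>t = 0\<close> gives the basis vector at \<open>b\<close>,
    whose eigenvalue is the reference for all others.\<close>
  obtain r0 where "\<forall>j<n. x $$ (j, b) + 0\<^sup>2 * Z j + 0 * Y j = r0 * V 0 j" using ex[of 0] by auto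
  then have r0: "x $$ (j, b) = r0 * V 0 j" if "j < n" for j using that by simp
  have colb: "x $$ (j, b) = (if j = b then r0 else 0)" if "j < n" for j
    using r0[OF that] by (simp add: V_def)
  have xbb: "x $$ (b, b) = r0" using colb[OF b_less] by simp
  show "j \<noteq> b \<Longrightarrow> x $$ (j, b) = 0" using colb[OF j] by simp
  have R: "t \<in> R" "t \<noteq> 0" if "t \<in> {1, 2, 3}" for t :: 'k
    using that of_nat_closed[of 2] of_nat_closed[of 3] of_nat_numeral_nonzero by auto
  have main: "x $$ (j, b) + t\<^sup>2 * Z j + t * Y j = (r0 + t\<^sup>2 * Z b + t * Y b) * V t j"
    if t: "t \<in> {1, 2, 3}" and j: "j < n" for t j
  proof -
    obtain r where r: "\<forall>j<n. x $$ (j, b) + t\<^sup>2 * Z j + t * Y j = r * V t j" using ex[OF R(1)[OF t]] by auto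
    have "r0 + t\<^sup>2 * Z b + t * Y b = r" using r[rule_format, OF b_less] by (simp add: V_def xbb)
    then show ?thesis using r j by simp
  qed
  have mid: "t * Z j + Y j = (r0 + t * Y b + t\<^sup>2 * Z b) * a j" if t: "t \<in> {1, 2, 3}" and j: "j \<in> mids" for t j
  proof -
    have jn: "j < n" "j \<noteq> b" "j \<noteq> b'" using midsD[OF j] by auto
    have "t * (t * Z j + Y j) = t * ((r0 + t * Y b + t\<^sup>2 * Z b) * a j)"
      using main[OF t jn(1)] colb[OF jn(1)] jn by (simp add: V_def algebra_simps power2_eq_square)
    then show ?thesis using R(2)[OF t] by simp
  qed
  have "\<exists>i\<in>mids. a i \<noteq> 0"
  proof (rule ccontr)
    assume "\<not> ?thesis"
    then have "Q a = 0" unfolding Q_def by (intro sum.neutral) auto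
    then show False using z(2,3) eps_nonzero[OF b_less] of_nat_numeral_nonzero by simp
  qed
  then obtain i where i: "i \<in> mids" "a i \<noteq> 0" by auto
  \<comment> \<open>At a coordinate with \<open>a i \<noteq> 0\<close> the image is linear in
    \<open>t\<close>, while eigenvalue times coordinate is quadratic. So the quadratic coefficient
    \<open>Z b\<close> of the eigenvalue vanishes; the coordinate at \<open>b'\<close> then removes
    the linear one, \<open>Y b\<close>.\<close>
  have "2 * (Z b * a i) = 0" by (rule second_difference_zero[OF mid[OF _ i(1)]])
  then have Zb: "Z b = 0" using i(2) of_nat_numeral_nonzero by simp
  have last: "t * Z b' + Y b' = (0 + t * r0 + t\<^sup>2 * Y b) * z" if t: "t \<in> {1, 2, 3}" for t
  proof -
    have "t * (t * Z b' + Y b') = t * ((0 + t * r0 + t\<^sup>2 * Y b) * z)"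
      using main[OF t b'_less] colb[OF b'_less] sigma_b by (simp add: V_def Zb algebra_simps power2_eq_square)
    then show ?thesis using R(2)[OF t] by simp
  qed
  have "2 * (Y b * z) = 0" by (rule second_difference_zero[OF last])
  then have Yb: "Y b = 0" using z(2) of_nat_numeral_nonzero by simp
  have ZYb': "Z b' = r0 * z" "Y b' = 0"
    by (rule first_difference_zero[of "Z b'" "Y b'" 0 "r0 * z"], use last in \<open>auto simp: Yb algebra_simps\<close>)+
  have ZYm: "Z j = 0" "Y j = r0 * a j" if "j \<in> mids" for j
    by (rule first_difference_zero[of "Z j" "Y j" "r0 * a j" 0], use mid[OF _ that] in \<open>auto simp: Yb Zb\<close>)+
  have "Y j = (if j \<in> mids then r0 * a j else 0) \<and> Z j = (if j = b' then r0 * z else 0)"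
  proof -
    have nm: "b \<notin> mids" "b' \<notin> mids" using midsD by blast+
    consider "j = b" | "j = b'" | "j \<in> mids" using j by (auto simp: mids_def)
    then show ?thesis
    proof cases
      case 1
      then show ?thesis using Yb Zb nm(1) sigma_b by simp
    next
      case 2
      then show ?thesis using ZYb' nm(2) by simp
    next
      case 3
      then show ?thesis using ZYm[OF 3] midsD[OF 3] by simp
    qed
  qed
  then have YZ: "Y j = (if j \<in> mids then r0 * a j else 0)" "Z j = (if j = b' then r0 * z else 0)" by simp_all
  show "(\<Sum>l\<in>mids. x $$ (j, l) * a l) = (if j \<in> mids then x $$ (b, b) * a j else 0)"
    using YZ(1) unfolding xbb Y_def .
  show "x $$ (j, b') = (if j = b' then x $$ (b, b) else 0)"
    using YZ(2) z(2) unfolding xbb Z_def by (simp split: if_splits)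
qed

lemma half_closed: "1 / 2 \<in> R"
proof -
  have "coprime 2 p"
    using prime_p p_odd by (metis primes_coprime two_is_prime_nat)
  then have "inverse (of_nat 2) \<in> R" by (rule inverse_of_nat_closed(2))
  then show ?thesis by (simp add: inverse_eq_divide)
qed

text \<open>The coordinate at \<open>b'\<close> that makes the basis vector at \<open>b\<close> plus
  \<open>a\<close> isotropic. It is integral because \<open>p\<close> is odd.\<close>

definition isotropic_coord :: "(nat \<Rightarrow> 'k) \<Rightarrow> 'k" where
  "isotropic_coord a = - (\<epsilon> b * (1 / 2) * Q a)"

lemma isotropic_coord_lev:
  assumes "\<And>i. i \<in> mids \<Longrightarrow> a i \<in> L m"
  shows "isotropic_coord a \<in> L m"
proof -
  have "Q a \<in> L m" unfolding Q_def
  proof (rule lev_sum)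
    fix l assume l: "l \<in> mids"
    show "\<epsilon> l * a l * a (\<sigma> l) \<in> L m"
      by (rule lev_multR[OF lev_multL[OF eps_R assms[OF l]] lev_R[OF assms[OF sigma_mids[OF l]]]])
        (use midsD[OF l] in blast)
  qed
  then show ?thesis unfolding isotropic_coord_def using eps_R[OF b_less] half_closed
    by (intro lev_uminus lev_multL mult_closed)
qed

lemma isotropic_coord_eq: "2 * \<epsilon> b * isotropic_coord a + Q a = 0"
proof -
  have "2 * \<epsilon> b * isotropic_coord a = - (2 * (1 / 2) * (\<epsilon> b * \<epsilon> b) * Q a)" by (simp add: isotropic_coord_def)
  then show ?thesis using eps_sq[OF b_less] of_nat_numeral_nonzero by simp
qed

text \<open>The vectors \<open>e\<^sub>i + t e\<^sub>\<sigma>\<^sub>i\<close> are anisotropic for \<open>t = 1, 2\<close>, also when \<open>\<sigma> i = i\<close>, and their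
  differences span.\<close>

lemma scalar_of_isotropic_eigenvectors:
  assumes eta: "\<eta> = 1" and n3: "3 \<le> n" and x: "x \<in> carrier_mat n n"
    and eig: "\<And>v. v b = 1 \<Longrightarrow> (\<And>i. i \<in> mids \<Longrightarrow> v i \<in> L m) \<Longrightarrow> v b' \<in> L m \<Longrightarrow>
      2 * \<epsilon> b * v b' + Q v = 0 \<Longrightarrow> \<exists>r. \<forall>j<n. (\<Sum>l<n. x $$ (j, l) * v l) = r * v j"
  shows "\<exists>r. x = r \<cdot>\<^sub>m 1\<^sub>m n"
proof -
  define a where "a i t l = \<pi> ^ m * ((if l = i then 1 else 0) + (if l = \<sigma> i then t else 0))" for i t l
  have aL: "a i t l \<in> L m" if "t \<in> R" for i t l
    unfolding a_def using that by (intro lev_multR lev_pi add_closed) auto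
  have Qa: "Q (a i t) \<noteq> 0" if i: "i \<in> mids" and t: "t \<in> {1, 2}" for i t
  proof -
    note in' = midsD[OF i] midsD[OF sigma_mids[OF i]]
    have ss: "\<sigma> (\<sigma> i) = i" using in' sigma_sigma by blast
    have e: "\<epsilon> (\<sigma> i) = \<epsilon> i" using eps_sigma[of i] in' eta by simp
    have sl: "\<sigma> l = i \<longleftrightarrow> l = \<sigma> i" "\<sigma> l = \<sigma> i \<longleftrightarrow> l = i" if "l \<in> mids" for l
      using sigma_eq_iff[of l i] sigma_eq_iff[of l "\<sigma> i"] midsD[OF that] in' ss by auto
    have t0: "t \<noteq> 0" "1 + t \<noteq> 0" using t of_nat_numeral_nonzero by auto
    have "Q (a i t) = (\<Sum>l\<in>mids. \<pi> ^ m * \<pi> ^ m * (\<epsilon> l *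
        ((if l = i then 1 else 0) + (if l = \<sigma> i then t else 0)) * ((if l = \<sigma> i then 1 else 0) + (if l = i then t else 0))))"
      unfolding Q_def by (intro sum.cong) (auto simp: a_def sl)
    also have "\<dots> = \<pi> ^ m * \<pi> ^ m * (if \<sigma> i = i then \<epsilon> i * (1 + t) * (1 + t) else 2 * \<epsilon> i * t)"
    proof (cases "\<sigma> i = i")
      case True
      have "(\<Sum>l\<in>mids. \<epsilon> l * ((if l = i then 1 else 0) + (if l = \<sigma> i then t else 0)) *
          ((if l = \<sigma> i then 1 else 0) + (if l = i then t else 0))) =
          (\<Sum>l\<in>mids. if l = i then \<epsilon> i * (1 + t) * (1 + t) else 0)"
        by (intro sum.cong) (auto simp: True)
      then show ?thesis using i finite_mids by (simp add: True flip: sum_distrib_left)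
    next
      case False
      have "(\<Sum>l\<in>mids. \<epsilon> l * ((if l = i then 1 else 0) + (if l = \<sigma> i then t else 0)) *
          ((if l = \<sigma> i then 1 else 0) + (if l = i then t else 0))) =
          (\<Sum>l\<in>mids. (if l = i then \<epsilon> i * t else 0) + (if l = \<sigma> i then \<epsilon> i * t else 0))"
        by (intro sum.cong) (use False e in auto)
      then show ?thesis using False i finite_mids sigma_mids[OF i]
        by (simp add: sum.distrib flip: sum_distrib_left)
    qed
    also have "\<dots> \<noteq> 0" using t0 eps_nonzero[of i] in' of_nat_numeral_nonzero by simp
    finally show ?thesis .
  qed
  have zz0: "isotropic_coord a \<noteq> 0" if "Q a \<noteq> 0" for a
    using that isotropic_coord_eq[of a] by auto
  have tR: "t \<in> R" if "t \<in> {1, 2}" for t :: 'k using that of_nat_closed[of 2] by auto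
  have iso: "j \<noteq> b \<Longrightarrow> x $$ (j, b) = 0"
    "(\<Sum>l\<in>mids. x $$ (j, l) * a i t l) = (if j \<in> mids then x $$ (b, b) * a i t j else 0)"
    "x $$ (j, b') = (if j = b' then x $$ (b, b) else 0)"
    if i: "i \<in> mids" and t: "t \<in> {1, 2}" and j: "j < n" for i t j
  proof -
    have z: "isotropic_coord (a i t) \<in> L m" "isotropic_coord (a i t) \<noteq> 0" using isotropic_coord_lev[OF aL[OF tR[OF t]]] zz0[OF Qa[OF i t]] by simp_all
    note rl = isotropic_eigenvectors[where a = "a i t" and z = "isotropic_coord (a i t)", OF x _ z isotropic_coord_eq _ j]
    show "j \<noteq> b \<Longrightarrow> x $$ (j, b) = 0" by (rule rl(1)) (rule aL[OF tR[OF t]], rule eig, assumption+)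
    show "(\<Sum>l\<in>mids. x $$ (j, l) * a i t l) = (if j \<in> mids then x $$ (b, b) * a i t j else 0)"
      by (rule rl(2)) (rule aL[OF tR[OF t]], rule eig, assumption+)
    show "x $$ (j, b') = (if j = b' then x $$ (b, b) else 0)"
      by (rule rl(3)) (rule aL[OF tR[OF t]], rule eig, assumption+)
  qed
  obtain i0 where i0: "i0 \<in> mids"
  proof -
    have "card mids \<noteq> 0" using n3 card_mids by simp
    then show ?thesis using that by (auto simp: card_eq_0_iff)
  qed
  have colb: "x $$ (j, b) = 0" if "j < n" "j \<noteq> b" for j
    using iso(1)[OF i0 _ that, of 1] by simp
  have colb': "x $$ (j, b') = (if j = b' then x $$ (b, b) else 0)" if "j < n" for j
    using iso(3)[OF i0 _ that, of 1] by simp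
  have colm: "x $$ (j, \<sigma> i) = (if j = \<sigma> i then x $$ (b, b) else 0)" if j: "j < n" and i: "i \<in> mids" for i j
  proof -
    have f: "x $$ (j, i) + t * x $$ (j, \<sigma> i) =
        (if j \<in> mids then x $$ (b, b) * ((if j = i then 1 else 0) + (if j = \<sigma> i then t else 0)) else 0)"
      if t: "t \<in> {1, 2}" for t
    proof -
      have "(\<Sum>l\<in>mids. x $$ (j, l) * a i t l) =
          (\<Sum>l\<in>mids. \<pi> ^ m * ((if l = i then x $$ (j, i) else 0) + (if l = \<sigma> i then t * x $$ (j, \<sigma> i) else 0)))"
        by (intro sum.cong) (auto simp: a_def algebra_simps)
      also have "\<dots> = \<pi> ^ m * (x $$ (j, i) + t * x $$ (j, \<sigma> i))"
        using i sigma_mids[OF i] finite_mids by (simp add: sum.distrib flip: sum_distrib_left)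
      finally have "\<pi> ^ m * (x $$ (j, i) + t * x $$ (j, \<sigma> i)) = (if j \<in> mids then x $$ (b, b) * a i t j else 0)"
        using iso(2)[OF i t j] by simp
      also have "\<dots> = \<pi> ^ m * (if j \<in> mids then x $$ (b, b) * ((if j = i then 1 else 0) + (if j = \<sigma> i then t else 0)) else 0)"
        by (simp add: a_def)
      finally show ?thesis by simp
    qed
    have "t * x $$ (j, \<sigma> i) + x $$ (j, i) = (if j \<in> mids \<and> j = i then x $$ (b, b) else 0) +
        t * (if j = \<sigma> i then x $$ (b, b) else 0)" if t: "t \<in> {1, 2}" for t
      using f[OF t] sigma_mids[OF i] i by (auto simp: algebra_simps)
    then show ?thesis by (rule first_difference_zero(1))
  qed
  have "x = x $$ (b, b) \<cdot>\<^sub>m 1\<^sub>m n"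
  proof (rule eq_matI)
    fix j i assume "j < dim_row (x $$ (b, b) \<cdot>\<^sub>m 1\<^sub>m n)" "i < dim_col (x $$ (b, b) \<cdot>\<^sub>m 1\<^sub>m n)"
    then have ji: "j < n" "i < n" by auto
    consider "i = b" | "i = b'" | "i \<in> mids" using ji by (auto simp: mids_def)
    then have "x $$ (j, i) = (if j = i then x $$ (b, b) else 0)"
    proof cases
      case 1
      then show ?thesis using colb[OF ji(1)] by simp
    next
      case 2
      then show ?thesis using colb'[OF ji(1)] by simp
    next
      case 3
      then show ?thesis using colm[OF ji(1) sigma_mids[OF 3]] sigma_sigma[OF ji(2)] by simp
    qed
    then show "x $$ (j, i) = (x $$ (b, b) \<cdot>\<^sub>m 1\<^sub>m n) $$ (j, i)" using ji by simp
  qed (use x in auto)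
  then show ?thesis by (rule exI)
qed

text \<open>Isotropy of column \<open>b\<close> expresses \<open>x $$ (b', b)\<close>, up to a unit,
  as a sum of products of two entries from \<open>L (m + k)\<close>. Such products lie in
  \<open>L (2 * m + 2 * k)\<close>, so the condition at \<open>b'\<close> is automatic.\<close>

lemma D_iff_symmetric:
  assumes eta: "\<eta> = 1" and x: "x \<in> form_grp s"
  shows "x \<in> D \<longleftrightarrow> (\<forall>i\<in>mids. x $$ (i, b) \<in> L (m + k))"
proof -
  have "x $$ (b', b) \<in> L (m + 2 * k)" if *: "\<forall>i\<in>mids. x $$ (i, b) \<in> L (m + k)"
  proof -
    have eb: "\<epsilon> b' = \<epsilon> b" using eps_sigma[OF b_less] eta by simp
    have "\<epsilon> b * x $$ (b, b) * x $$ (b', b) + \<epsilon> b' * x $$ (b', b) * x $$ (b, b) +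
        (\<Sum>l\<in>mids. \<epsilon> l * x $$ (l, b) * x $$ (\<sigma> l, b)) = 0"
      using form_entry[OF x b_less b_less] sigma_b sum_split[of "\<lambda>l. \<epsilon> l * x $$ (l, b) * x $$ (\<sigma> l, b)"]
      by (simp add: sigma_b')
    moreover have "\<epsilon> b' * x $$ (b', b) * x $$ (b, b) = \<epsilon> b * (x $$ (b, b) * x $$ (b', b))"
      unfolding eb by (simp only: mult.assoc mult.commute[of "x $$ (b', b)"])
    ultimately have "2 * (\<epsilon> b * (x $$ (b, b) * x $$ (b', b))) = - (\<Sum>l\<in>mids. \<epsilon> l * x $$ (l, b) * x $$ (\<sigma> l, b))"
      by (simp only: eq_neg_iff_add_eq_0 mult_2 mult.assoc[of "\<epsilon> b"])
    also have "\<dots> \<in> L ((m + k) + (m + k))"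
      using * sigma_mids eps_R midsD by (intro lev_uminus lev_sum lev_mult lev_multL) auto
    finally have "2 * (\<epsilon> b * (x $$ (b, b) * x $$ (b', b))) \<in> L (m + 2 * k)"
      by (rule lev_mono) simp
    then have "\<epsilon> b * (x $$ (b, b) * x $$ (b', b)) \<in> L (m + 2 * k)"
      using lev_unit_cancel[of 2] of_nat_numeral_nonzero half_closed by (simp add: inverse_eq_divide)
    then have "x $$ (b, b) * x $$ (b', b) \<in> L (m + 2 * k)" by (rule eps_lev_cancel[OF b_less])
    then show ?thesis by (rule lev_unit_cancel[OF bb_unit(1,2)[OF x]])
  qed
  then show ?thesis unfolding D_iff[OF x] by (intro iffI conjI) simp_all
qed

text \<open>With the coordinate at \<open>b'\<close> determined by isotropy, the transversal is
  indexed by the \<open>n - 2\<close> remaining coordinates. The bound \<open>3 \<le> n\<close>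
  guarantees that there is one, which supplies enough isotropic vectors.\<close>

theorem self_similar_symmetric:
  assumes eta: "\<eta> = 1" and n3: "3 \<le> n"
  shows "self_similar (matrix_group n (form_grp s)) (q ^ ((n - 2) * k))"
proof -
  obtain T where T: "finite T" "card T = q ^ k" "T \<subseteq> L m" "\<forall>x\<in>L m. \<exists>!t. t \<in> T \<and> x - t \<in> L (m + k)"
    using lev_transversal[of k m] by auto
  define A where "A = PiE mids (\<lambda>_. T)"
  have UC: "U a (isotropic_coord a) \<in> form_grp s" if "\<And>i. i \<in> mids \<Longrightarrow> a i \<in> L m" for a
    using that eta isotropic_coord_eq[of a] isotropic_coord_lev[OF that] by (intro U_form_grp) auto
  have Am: "a i \<in> L m" if "a \<in> A" "i \<in> mids" for a i
    using that T(3) by (auto simp: A_def PiE_def Pi_def)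
  show ?thesis
  proof (rule self_similar_G)
    show "finite A" unfolding A_def using T finite_mids by (intro finite_PiE) auto
    show "card A = q ^ ((n - 2) * k)"
      unfolding A_def using T finite_mids by (simp add: card_PiE card_mids mult.commute flip: power_mult)
    show "U a (isotropic_coord a) \<in> form_grp s" if "a \<in> A" for a using Am[OF that] by (intro UC)
    show "\<exists>!a. a \<in> A \<and> inv\<^bsub>G\<^esub> (U a (isotropic_coord a)) * x \<in> D" if x: "x \<in> form_grp s" for x
    proof -
      define w where "w i = x $$ (i, b) * inverse (x $$ (b, b))" for i
      have w: "w i \<in> L m" if "i \<in> mids" for i
        using off_diagonal[OF x, of i b] midsD[OF that] b_less bb_unit(2)[OF x] by (auto simp: w_def intro: lev_multR)
      have iff: "inv\<^bsub>G\<^esub> (U a (isotropic_coord a)) * x \<in> D \<longleftrightarrow> (\<forall>i\<in>mids. w i - a i \<in> L (m + k))" if a: "a \<in> A" for a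
      proof -
        have u: "U a (isotropic_coord a) \<in> form_grp s" using Am[OF a] by (intro UC)
        show ?thesis
          using D_iff_symmetric[OF eta quotient_mem[OF u x]] mid_condition[OF u x, of _ "m + k"] by (simp add: w_def)
      qed
      have "\<exists>!a. a \<in> A \<and> (\<forall>i\<in>mids. w i - a i \<in> L (m + k))"
        unfolding A_def by (rule mid_choice[OF T(3,4)]) (rule w)
      moreover have "(a \<in> A \<and> inv\<^bsub>G\<^esub> (U a (isotropic_coord a)) * x \<in> D) \<longleftrightarrow> (a \<in> A \<and> (\<forall>i\<in>mids. w i - a i \<in> L (m + k)))" for a
        using iff by (cases "a \<in> A") simp_all
      ultimately show ?thesis by simp
    qed
    show "\<exists>r. x = r \<cdot>\<^sub>m 1\<^sub>m n"
      if x: "x \<in> form_grp s" and eig: "\<And>u. u \<in> form_grp s \<Longrightarrow> \<exists>r. \<forall>j<n. (x * u) $$ (j, b) = r * u $$ (j, b)" for x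
    proof (rule scalar_of_isotropic_eigenvectors[OF eta n3 C_carrier[OF x]])
      fix v :: "nat \<Rightarrow> 'k" assume v: "v b = 1" "\<And>i. i \<in> mids \<Longrightarrow> v i \<in> L m" "v b' \<in> L m" "2 * \<epsilon> b * v b' + Q v = 0"
      have uv: "U v (v b') \<in> form_grp s" using v eta by (intro U_form_grp) auto
      have "U v (v b') $$ (j, b) = v j" if "j < n" for j using that v(1) by (simp add: U_column_b)
      then show "\<exists>r. \<forall>j<n. (\<Sum>l<n. x $$ (j, l) * v l) = r * v j"
        using eig[OF uv] mult_column[OF C_carrier[OF x] U_carrier] by auto
    qed
  qed
qed

end

section \<open>Symplectic and orthogonal groups\<close>

definition half_swap :: "nat \<Rightarrow> nat \<Rightarrow> nat" where
  "half_swap l i = (if i < l then i + l else i - l)"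

lemma half_swap:
  assumes "i < l + l"
  shows "half_swap l i < l + l" "half_swap l (half_swap l i) = i" "half_swap l i < l \<longleftrightarrow> \<not> i < l"
  using assms by (auto simp: half_swap_def)

lemma hyperbolic_form_carrier: "even n \<Longrightarrow> hyperbolic_form n \<in> carrier_mat n n"
  by (auto simp: hyperbolic_form_def Let_def elim!: evenE)

lemma hyperbolic_form_index:
  assumes "n = l + l" "i < n" "j < n"
  shows "(hyperbolic_form n :: 'a::field mat) $$ (i, j) = (if j = half_swap l i then 1 else 0)"
  using assms by (auto simp: hyperbolic_form_def Let_def half_swap_def)

lemma symplectic_form_eq:
  assumes "n = l + l"
  shows "(symplectic_form n :: 'a::field mat) =
    Matrix.mat n n (\<lambda>(i, j). if j = half_swap l i then if i < l then 1 else - 1 else 0)"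
  by (rule eq_matI) (use assms in \<open>auto simp: symplectic_form_def Let_def half_swap_def\<close>)

lemma orthogonal_form_even_eq:
  assumes "n = l + l"
  shows "(orthogonal_form n :: 'a::field mat) =
    Matrix.mat n n (\<lambda>(i, j). if j = half_swap l i then 1 else 0)"
proof (rule eq_matI)
  fix i j assume "i < dim_row (Matrix.mat n n (\<lambda>(i, j). if j = half_swap l i then 1 else 0) :: 'a mat)"
    "j < dim_col (Matrix.mat n n (\<lambda>(i, j). if j = half_swap l i then 1 else 0) :: 'a mat)"
  then show "(orthogonal_form n :: 'a mat) $$ (i, j) =
      Matrix.mat n n (\<lambda>(i, j). if j = half_swap l i then 1 else 0) $$ (i, j)"
    using assms hyperbolic_form_index[OF assms, of i j, where ?'a = 'a] by (simp add: orthogonal_form_def)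
qed (use assms hyperbolic_form_carrier[of n, where ?'a = 'a] in \<open>auto simp: orthogonal_form_def\<close>)

lemma orthogonal_form_odd_eq:
  assumes "n = Suc (l + l)"
  shows "(orthogonal_form n :: 'a::field mat) =
    Matrix.mat n n (\<lambda>(i, j). if j = (if i = 0 then 0 else Suc (half_swap l (i - 1))) then 1 else 0)"
proof (rule eq_matI)
  define H where "H = (hyperbolic_form (l + l) :: 'a mat)"
  have H: "H \<in> carrier_mat (l + l) (l + l)" unfolding H_def by (rule hyperbolic_form_carrier) simp
  have o: "(orthogonal_form n :: 'a mat) =
      four_block_mat (1\<^sub>m 1) (0\<^sub>m 1 (l + l)) (0\<^sub>m (l + l) 1) H"
    using assms by (simp add: orthogonal_form_def H_def)
  show "dim_row (orthogonal_form n :: 'a mat) = dim_row (Matrix.mat n n (\<lambda>(i, j).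
      if j = (if i = 0 then 0 else Suc (half_swap l (i - 1))) then 1 else 0) :: 'a mat)"
    "dim_col (orthogonal_form n :: 'a mat) = dim_col (Matrix.mat n n (\<lambda>(i, j).
      if j = (if i = 0 then 0 else Suc (half_swap l (i - 1))) then 1 else 0) :: 'a mat)"
    unfolding o using H assms by auto
  fix i j assume "i < dim_row (Matrix.mat n n (\<lambda>(i, j).
      if j = (if i = 0 then 0 else Suc (half_swap l (i - 1))) then 1 else 0) :: 'a mat)"
    "j < dim_col (Matrix.mat n n (\<lambda>(i, j).
      if j = (if i = 0 then 0 else Suc (half_swap l (i - 1))) then 1 else 0) :: 'a mat)"
  then have ij: "i < Suc (l + l)" "j < Suc (l + l)" using assms by auto
  show "(orthogonal_form n :: 'a mat) $$ (i, j) = Matrix.mat n n (\<lambda>(i, j).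
      if j = (if i = 0 then 0 else Suc (half_swap l (i - 1))) then 1 else 0) $$ (i, j)"
  proof (cases "i = 0 \<or> j = 0")
    case True
    then show ?thesis unfolding o using ij H assms by auto
  next
    case False
    then have "H $$ (i - 1, j - 1) = (if j - 1 = half_swap l (i - 1) then 1 else 0)"
      unfolding H_def using ij by (intro hyperbolic_form_index) auto
    then show ?thesis unfolding o using False ij H assms by auto
  qed
qed

context dvr_matrices
begin

interpretation SL: congruence_grp R \<pi> p e q n m SLC
  by (rule SLC_congruence)

lemma congruence_GG_iff:
  "x \<in> carrier_mat n n \<and> elements_mat x \<subseteq> R \<and> mat_cong R \<pi> m x (1\<^sub>m n) \<longleftrightarrow> x \<in> GG"
proof -
  have "elements_mat x \<subseteq> R" if "x \<in> GG"
    unfolding elements_mat_subset_iff[OF GG_carrier[OF that]] using MM0_D[OF GG_MM0[OF that]] by blast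
  then show ?thesis using SL.mat_cong_iff[of x "1\<^sub>m n" m] by (auto simp: GG_def)
qed

lemma SL_congruence_subgroup: "congruence_subgroup n R \<pi> m (SL n R) = matrix_group n SLC"
proof -
  have "{x \<in> SL n R. mat_cong R \<pi> m x (1\<^sub>m n)} = SLC"
    using congruence_GG_iff by (auto simp: SL_def SLC_def)
  then show ?thesis by (simp add: congruence_subgroup_def)
qed

lemma SO_congruence_subgroup:
  "congruence_subgroup n R \<pi> m (SO n R) = matrix_group n (form_grp (orthogonal_form n))"
proof -
  have "{x \<in> SO n R. mat_cong R \<pi> m x (1\<^sub>m n)} = form_grp (orthogonal_form n)"
    using congruence_GG_iff by (auto simp: SO_def SL_def SLC_def form_grp_def)
  then show ?thesis by (simp add: congruence_subgroup_def)
qed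

text \<open>The definition of \<open>Sp\<close> says nothing about determinants, whereas
  \<open>form_grp\<close> lies in \<open>SLC\<close>. The assumption bridges this and is supplied by
  \<open>form_grp_iff\<close> once the form is known to be monomial.\<close>

lemma Sp_congruence_subgroup:
  assumes "form_grp (symplectic_form n) = {x \<in> GG. x\<^sup>T * symplectic_form n * x = symplectic_form n}"
  shows "congruence_subgroup n R \<pi> m (Sp n R) = matrix_group n (form_grp (symplectic_form n))"
proof -
  have "{x \<in> Sp n R. mat_cong R \<pi> m x (1\<^sub>m n)} = form_grp (symplectic_form n)"
    unfolding assms using congruence_GG_iff by (auto simp: Sp_def)
  then show ?thesis by (simp add: congruence_subgroup_def)
qed

lemma SL_uniform_self_similar:
  assumes "n \<ge> 2" "k \<ge> 1"
  shows "uniform_pro_p_group p (congruence_subgroup n R \<pi> m (SL n R))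
      (adic_topology R \<pi> (congruence_subgroup n R \<pi> m (SL n R)))"
    and "self_similar (congruence_subgroup n R \<pi> m (SL n R)) (q ^ ((n - 1) * k))"
proof -
  interpret SL_grp R \<pi> p e q n m k by unfold_locales (use assms in auto)
  show "uniform_pro_p_group p (congruence_subgroup n R \<pi> m (SL n R))
      (adic_topology R \<pi> (congruence_subgroup n R \<pi> m (SL n R)))"
    unfolding SL_congruence_subgroup by (rule SL.uniform)
  show "self_similar (congruence_subgroup n R \<pi> m (SL n R)) (q ^ ((n - 1) * k))"
    unfolding SL_congruence_subgroup by (rule self_similar_SLC)
qed

lemma Sp_uniform_self_similar:
  assumes "n \<ge> 2" "k \<ge> 1" "even n"
  shows "uniform_pro_p_group p (congruence_subgroup n R \<pi> m (Sp n R))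
      (adic_topology R \<pi> (congruence_subgroup n R \<pi> m (Sp n R)))"
    and "self_similar (congruence_subgroup n R \<pi> m (Sp n R)) (q ^ (n * k))"
proof -
  obtain l where l: "n = l + l" using assms(3) by (metis evenE mult_2)
  interpret F: form_data R \<pi> p e q n m "half_swap l" "\<lambda>i. if i < l then 1 else - 1" "- 1" 0 k
    by unfold_locales (use l assms half_swap in \<open>auto simp: half_swap_def\<close>)
  have s: "F.s = symplectic_form n" unfolding F.s_def symplectic_form_eq[OF l] ..
  have eq: "congruence_subgroup n R \<pi> m (Sp n R) = matrix_group n (form_grp (symplectic_form n))"
    by (rule Sp_congruence_subgroup) (use F.form_grp_iff s in auto)
  show "uniform_pro_p_group p (congruence_subgroup n R \<pi> m (Sp n R))
      (adic_topology R \<pi> (congruence_subgroup n R \<pi> m (Sp n R)))"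
    unfolding eq s[symmetric] by (rule F.uniform)
  show "self_similar (congruence_subgroup n R \<pi> m (Sp n R)) (q ^ (n * k))"
    unfolding eq s[symmetric] by (rule F.self_similar_skew) simp
qed

lemma SO_uniform_self_similar:
  assumes "n \<ge> 3" "k \<ge> 1"
  shows "uniform_pro_p_group p (congruence_subgroup n R \<pi> m (SO n R))
      (adic_topology R \<pi> (congruence_subgroup n R \<pi> m (SO n R)))"
    and "self_similar (congruence_subgroup n R \<pi> m (SO n R)) (q ^ ((n - 2) * k))"
proof -
  have "uniform_pro_p_group p (congruence_subgroup n R \<pi> m (SO n R))
      (adic_topology R \<pi> (congruence_subgroup n R \<pi> m (SO n R))) \<and>
    self_similar (congruence_subgroup n R \<pi> m (SO n R)) (q ^ ((n - 2) * k))"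
  proof (cases "even n")
    case True
    then obtain l where l: "n = l + l" by (metis evenE mult_2)
    interpret F: form_data R \<pi> p e q n m "half_swap l" "\<lambda>_. 1" 1 0 k
      by unfold_locales (use l assms half_swap in \<open>auto simp: half_swap_def\<close>)
    have s: "F.s = orthogonal_form n" unfolding F.s_def orthogonal_form_even_eq[OF l] ..
    show ?thesis unfolding SO_congruence_subgroup s[symmetric]
      using F.uniform F.self_similar_symmetric assms by blast
  next
    case False
    then obtain l where l: "n = Suc (l + l)" by (metis Suc_eq_plus1 mult_2 oddE)
    \<comment> \<open>Index 0 carries the anisotropic vector and is fixed by the involution, so the
      distinguished isotropic vector has index 1.\<close>
    interpret F: form_data R \<pi> p e q n m "\<lambda>i. if i = 0 then 0 else Suc (half_swap l (i - 1))" "\<lambda>_. 1" 1 1 k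
      by unfold_locales (use l assms half_swap in \<open>auto simp: half_swap_def\<close>)
    have s: "F.s = orthogonal_form n" unfolding F.s_def orthogonal_form_odd_eq[OF l] ..
    show ?thesis unfolding SO_congruence_subgroup s[symmetric]
      using F.uniform F.self_similar_symmetric assms by blast
  qed
  then show "uniform_pro_p_group p (congruence_subgroup n R \<pi> m (SO n R))
      (adic_topology R \<pi> (congruence_subgroup n R \<pi> m (SO n R)))"
    and "self_similar (congruence_subgroup n R \<pi> m (SO n R)) (q ^ ((n - 2) * k))" by auto
qed

end

theorem theorem2:
  fixes p d e f n k m q :: nat
    and av :: "'q::field_char_0 \<Rightarrow> real"
    and \<iota> :: "'q \<Rightarrow> 'k::field"
    and R :: "'k set"
    and \<pi> :: 'k
  assumes "Factorial_Ring.prime p"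
    and "is_padic_field p av"
    and "finite_extension_of_degree \<iota> d"
    and "R = ring_of_integers av \<iota>"
    and "uniformizer R \<pi>"
    and "ramification_index p R \<pi> e"
    and "inertia_degree (\<iota> ` padic_integers av) R \<pi> f"
    and "q = p ^ f"
    and "n \<ge> 2" and "k \<ge> 1" and "m \<ge> e"
  shows "((n\<^sup>2 - 1) * d \<le> p \<longrightarrow>
           uniform_pro_p_group p (congruence_subgroup n R \<pi> m (SL n R))
             (adic_topology R \<pi> (congruence_subgroup n R \<pi> m (SL n R))) \<and>
           self_similar (congruence_subgroup n R \<pi> m (SL n R)) (q ^ ((n - 1) * k)))
       \<and> (even n \<and> (n\<^sup>2 + n) * d \<le> 2 * p \<longrightarrow>
           uniform_pro_p_group p (congruence_subgroup n R \<pi> m (Sp n R))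
             (adic_topology R \<pi> (congruence_subgroup n R \<pi> m (Sp n R))) \<and>
           self_similar (congruence_subgroup n R \<pi> m (Sp n R)) (q ^ (n * k)))
       \<and> (n \<ge> 3 \<and> (n\<^sup>2 - n) * d \<le> 2 * p \<longrightarrow>
           uniform_pro_p_group p (congruence_subgroup n R \<pi> m (SO n R))
             (adic_topology R \<pi> (congruence_subgroup n R \<pi> m (SO n R))) \<and>
           self_similar (congruence_subgroup n R \<pi> m (SO n R)) (q ^ ((n - 2) * k)))"
proof -
  interpret E: padic_extension p av \<iota> d e f R \<pi>
    by (rule padic_extension.intro[OF padic_field.intro padic_extension_axioms.intro]) (fact assms)+
  have dvr: "complete_dvr R \<pi> p e q" unfolding assms(8) by (rule E.complete_dvr)
  have matrices: "dvr_matrices R \<pi> p e q m" if "p \<noteq> 2"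
    by (rule dvr_matrices.intro[OF dvr dvr_matrices_axioms.intro]) (fact assms that)+
  have d: "1 \<le> d" using E.d_pos by simp
  \<comment> \<open>The number 6 is the least value of \<open>2 * (n\<^sup>2 - 1)\<close> and of
    \<open>n\<^sup>2 + n\<close> (at \<open>n = 2\<close>) and of \<open>n\<^sup>2 - n\<close> (at
    \<open>n = 3\<close>). With \<open>d \<ge> 1\<close> it forces \<open>p \<ge> 3\<close>.\<close>
  have odd: "p \<noteq> 2" if "6 \<le> N" "N * d \<le> 2 * p" for N
  proof -
    have "6 * 1 \<le> N * d" using that d by (intro mult_mono) auto
    then show ?thesis using that by simp
  qed
  show ?thesis
  proof (intro conjI impI)
    assume "(n\<^sup>2 - 1) * d \<le> p"
    moreover have "2 * 2 \<le> n * n" using assms(9) by (intro mult_mono) auto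
    ultimately have "p \<noteq> 2" using odd[of "2 * (n\<^sup>2 - 1)"] by (simp add: power2_eq_square)
    then interpret dvr_matrices R \<pi> p e q n m by (rule matrices)
    show "uniform_pro_p_group p (congruence_subgroup n R \<pi> m (SL n R))
        (adic_topology R \<pi> (congruence_subgroup n R \<pi> m (SL n R)))"
      "self_similar (congruence_subgroup n R \<pi> m (SL n R)) (q ^ ((n - 1) * k))"
      using SL_uniform_self_similar[OF assms(9,10)] by auto
  next
    assume *: "even n \<and> (n\<^sup>2 + n) * d \<le> 2 * p"
    have "2 * 2 \<le> n * n" using assms(9) by (intro mult_mono) auto
    then have "p \<noteq> 2" using odd[of "n\<^sup>2 + n"] * assms(9) by (simp add: power2_eq_square)
    then interpret dvr_matrices R \<pi> p e q n m by (rule matrices)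
    show "uniform_pro_p_group p (congruence_subgroup n R \<pi> m (Sp n R))
        (adic_topology R \<pi> (congruence_subgroup n R \<pi> m (Sp n R)))"
      "self_similar (congruence_subgroup n R \<pi> m (Sp n R)) (q ^ (n * k))"
      using Sp_uniform_self_similar[OF assms(9,10)] * by auto
  next
    assume *: "n \<ge> 3 \<and> (n\<^sup>2 - n) * d \<le> 2 * p"
    have "3 * 2 \<le> n * (n - 1)" using * by (intro mult_mono) auto
    then have "6 \<le> n\<^sup>2 - n" by (simp add: power2_eq_square diff_mult_distrib2)
    then have "p \<noteq> 2" using odd[of "n\<^sup>2 - n"] * by simp
    then interpret dvr_matrices R \<pi> p e q n m by (rule matrices)
    show "uniform_pro_p_group p (congruence_subgroup n R \<pi> m (SO n R))
        (adic_topology R \<pi> (congruence_subgroup n R \<pi> m (SO n R)))"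
      "self_similar (congruence_subgroup n R \<pi> m (SO n R)) (q ^ ((n - 2) * k))"
      using SO_uniform_self_similar[OF _ assms(10)] * by auto
  qed
qed

end
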